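(* Fix positive integers $k$ and $m$. Let $G$ be a group, and fix a nonempty finite subset $A\subseteq G$. \begin{enumerate} \item[(1)] (small alternation) Suppose $|AA^{-1}A|\leq k|A|$ and $\langle AA^{-1}\rangle=(AA^{-1})^m$. Then there are a normal subgroup $H$ of $\langle AA^{-1}\rangle$, of index $O_{k,m}(1)$, and a $(\delta,n)$-Bohr neighborhood $B$ in $H$, with $\delta^{-1},n\leq O_{k,m}(1)$, such that $B\subseteq (AA^{-1})^2$. Moreover, if $\langle AA^{-1}\rangle$ is abelian, then we may take $H=\langle AA^{-1}\rangle$. \item[(2)] (small tripling) Suppose $|A^3|\leq k|A|$ and $\langle A\rangle=\bar{A}^m$. Then there are a normal subgroup $H$ of $\langle A\rangle$, of index $O_{k,m}(1)$, and a $(\delta,n)$-Bohr neighborhood $B$ in $H$, with $\delta^{-1},n\leq O_{k,m}(1)$, such that $B\subseteq (AA^{-1})^2\cap A^2A^{-2}\cap (A^{-1}A)^2\cap A^{-2}A^2$. Moreover, if $\langle A\rangle$ is abelian then we may take $H=\langle A\rangle$. \end{enumerate}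
   Context: For subsets $X,Y$ of a group, $XY=\{xy:x\in X,y\in Y\}$, $X^{-1}=\{x^{-1}:x\in X\}$, $X^0=\{1\}$, $X^{n+1}=X^nX$, $X^{-n}=(X^{-1})^n$, $\bar{X}=X\cup X^{-1}\cup\{1\}$, and $\langle X\rangle$ is the subgroup generated by $X$. $O_{k,m}(1)$ denotes a quantity bounded by a constant depending only on $k,m$. Let $\mathbb{T}^n=(\mathbb{R}/\mathbb{Z})^n$ (additive, identity $0$) with $d_n$ the invariant metric induced by the product of the arclength metric on $\mathbb{R}/\mathbb{Z}$. For a group $H$, $n\in\mathbb{Z}^+$ and $\delta>0$, $B\subseteq H$ is a $(\delta,n)$-Bohr neighborhood in $H$ if there is a homomorphism $\tau\colon H\to\mathbb{T}^n$ with $B=\{x\in H:d_n(0,\tau(x))<\delta\}$. *)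

theory Defs
  imports "HOL-Analysis.Analysis" "HOL-Algebra.Generated_Groups" "HOL-Algebra.Product_Groups"
begin

section \<open>Product sets\<close>

primrec set_pow :: "('a, 'b) monoid_scheme \<Rightarrow> 'a set \<Rightarrow> nat \<Rightarrow> 'a set" (infixr \<open>[^^]\<index>\<close> 75) where
  "X [^^]\<^bsub>G\<^esub> 0 = {\<one>\<^bsub>G\<^esub>}"
| "X [^^]\<^bsub>G\<^esub> (Suc n) = (X [^^]\<^bsub>G\<^esub> n) <#>\<^bsub>G\<^esub> X"

definition sym_set :: "('a, 'b) monoid_scheme \<Rightarrow> 'a set \<Rightarrow> 'a set" where
  "sym_set G X = X \<union> set_inv\<^bsub>G\<^esub> X \<union> {\<one>\<^bsub>G\<^esub>}"


section \<open>The torus\<close>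

definition real_group :: "real monoid" where
  "real_group = \<lparr>carrier = UNIV, monoid.mult = (+), one = 0\<rparr>"

text \<open>\<open>\<real>/\<int>\<close>, whose elements are the cosets \<open>\<int> + x\<close>. The records are multiplicative, so the
  identity \<open>0\<close> of the torus appears as \<open>\<one>\<close>.\<close>

definition circle_group :: "real set monoid" where
  "circle_group = real_group Mod \<int>"

definition torus :: "nat \<Rightarrow> (nat \<Rightarrow> real set) monoid" where
  "torus n = product_group {..<n} (\<lambda>_. circle_group)"

text \<open>The arclength distance of two points of \<open>\<real>/\<int>\<close> (a circle of length \<open>1\<close>) is the distance in
  \<open>\<real>\<close> of the corresponding cosets, \<open>min {\<bar>x - y + j\<bar> | j \<in> \<int>}\<close>. On the product we take the maximum
  metric. For fixed \<open>\<tau>\<close> and \<open>\<delta>\<close> its balls contain those of the \<open>\<ell>\<^sup>1\<close> and \<open>\<ell>\<^sup>2\<close> product metrics, so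
  an inclusion \<open>B \<subseteq> S\<close> for this choice yields the one for these metrics. Only used for \<open>n > 0\<close>.\<close>

definition torus_dist :: "nat \<Rightarrow> (nat \<Rightarrow> real set) \<Rightarrow> (nat \<Rightarrow> real set) \<Rightarrow> real" where
  "torus_dist n x y = Max ((\<lambda>i. setdist (x i) (y i)) ` {..<n})"


section \<open>Bohr neighborhoods\<close>

definition bohr_nbhd :: "real \<Rightarrow> nat \<Rightarrow> ('a, 'b) monoid_scheme \<Rightarrow> 'a set \<Rightarrow> bool" where
  "bohr_nbhd \<delta> n H B \<longleftrightarrow> \<delta> > 0 \<and> n > 0 \<and>
     (\<exists>\<tau> \<in> hom H (torus n). B = {x \<in> carrier H. torus_dist n \<one>\<^bsub>torus n\<^esub> (\<tau> x) < \<delta>})"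

text \<open>The common shape of the conclusions, for a subgroup \<open>K\<close> of \<open>G\<close> and a bound \<open>C\<close>. Finiteness of
  the coset space is explicit because \<^const>\<open>card\<close> is \<open>0\<close> on infinite sets.\<close>

definition bounded_bohr_in ::
    "('a, 'b) monoid_scheme \<Rightarrow> 'a set \<Rightarrow> 'a set \<Rightarrow> nat \<Rightarrow> bool" where
  "bounded_bohr_in G K S C \<longleftrightarrow>
     (\<exists>H \<delta> n B.
        H \<lhd> (G\<lparr>carrier := K\<rparr>) \<and>
        finite (rcosets\<^bsub>G\<lparr>carrier := K\<rparr>\<^esub> H) \<and> card (rcosets\<^bsub>G\<lparr>carrier := K\<rparr>\<^esub> H) \<le> C \<and>
        bohr_nbhd \<delta> n (G\<lparr>carrier := H\<rparr>) B \<and> inverse \<delta> \<le> real C \<and> n \<le> C \<and>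
        B \<subseteq> S \<and>
        (comm_group (G\<lparr>carrier := K\<rparr>) \<longrightarrow> H = K))"


section \<open>The constant\<close>

definition bound_holds :: "nat \<Rightarrow> nat \<Rightarrow> nat \<Rightarrow> ('a, 'b) monoid_scheme \<Rightarrow> 'a set \<Rightarrow> bool" where
  "bound_holds k m C G A \<longleftrightarrow>
     (card (A <#>\<^bsub>G\<^esub> set_inv\<^bsub>G\<^esub> A <#>\<^bsub>G\<^esub> A) \<le> k * card A \<and>
      generate G (A <#>\<^bsub>G\<^esub> set_inv\<^bsub>G\<^esub> A) = (A <#>\<^bsub>G\<^esub> set_inv\<^bsub>G\<^esub> A) [^^]\<^bsub>G\<^esub> m \<longrightarrow>
        bounded_bohr_in G (generate G (A <#>\<^bsub>G\<^esub> set_inv\<^bsub>G\<^esub> A))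
          ((A <#>\<^bsub>G\<^esub> set_inv\<^bsub>G\<^esub> A) [^^]\<^bsub>G\<^esub> (2::nat)) C) \<and>
     (card (A [^^]\<^bsub>G\<^esub> (3::nat)) \<le> k * card A \<and>
      generate G A = sym_set G A [^^]\<^bsub>G\<^esub> m \<longrightarrow>
        bounded_bohr_in G (generate G A)
          ((A <#>\<^bsub>G\<^esub> set_inv\<^bsub>G\<^esub> A) [^^]\<^bsub>G\<^esub> (2::nat) \<inter>
           (A [^^]\<^bsub>G\<^esub> (2::nat) <#>\<^bsub>G\<^esub> (set_inv\<^bsub>G\<^esub> A) [^^]\<^bsub>G\<^esub> (2::nat)) \<inter>
           (set_inv\<^bsub>G\<^esub> A <#>\<^bsub>G\<^esub> A) [^^]\<^bsub>G\<^esub> (2::nat) \<inter>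
           ((set_inv\<^bsub>G\<^esub> A) [^^]\<^bsub>G\<^esub> (2::nat) <#>\<^bsub>G\<^esub> A [^^]\<^bsub>G\<^esub> (2::nat))) C)"

text \<open>The number \<open>O\<^bsub>k,m\<^esub>(1)\<close>. In a statement about groups on an arbitrary type \<open>'a\<close> that begins with
  \<open>\<exists>C\<close>, the number \<open>C\<close> could depend on \<open>'a\<close>, and would be worthless for finite \<open>'a\<close>. To have a single
  value for the groups on all types, we choose one that works for the groups with carrier in \<open>nat\<close>.
  No property of this choice is assumed: that such a value exists, and that it works for groups on
  every other type, is part of what a theorem that uses it asserts. (Every finitely generated group is
  isomorphic to one with carrier in \<open>nat\<close>.)\<close>

definition bohr_const :: "nat \<Rightarrow> nat \<Rightarrow> nat" where
  "bohr_const k m = (SOME C. \<forall>(G :: nat monoid) A.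
     group G \<and> A \<subseteq> carrier G \<and> finite A \<and> A \<noteq> {} \<longrightarrow> bound_holds k m C G A)"

end

theory Submission
  imports Defs "HOL-Algebra.Multiplicative_Group" "HOL-Library.Function_Algebras"
begin

text \<open>
  By Ruzsa's triangle inequality the group \<open>K\<close> generated in either case is finite and contains a
  translate of \<open>A\<close> of density bounded below. All four product sets have the form \<open>P P\<^sup>-\<^sup>1\<close> with
  \<open>P = X Y\<close> and \<open>X\<close>, \<open>Y\<close> among \<open>A\<close>, \<open>A\<^sup>-\<^sup>1\<close>, so \<open>x\<close> lies in such a set as soon as the convolution
  \<open>g = 1\<^sub>X * 1\<^sub>Y\<close> has nonzero correlation with its translate by \<open>x\<close>. Convolution with \<open>1\<^sub>Y\<close> has
  bounded (normalised) Hilbert--Schmidt norm and commutes with translations. Hence the eigenvectors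
  of the associated positive operator for large eigenvalues span a translation invariant space \<open>W\<close>
  of bounded dimension, and most of \<open>g\<close> lies in \<open>W\<close>. The elements of \<open>K\<close> that act on \<open>W\<close> close to
  the identity commute on \<open>W\<close>, as in the proof of Jordan's theorem on finite linear groups, and
  generate a normal subgroup \<open>H\<close> of bounded index. If \<open>K\<close> is abelian, then \<open>H = K\<close> will do. In both
  cases \<open>H\<close> is diagonalised on \<open>W\<close> by boundedly many characters. These define the homomorphism to the
  torus: where all of them have real part at least \<open>1/2\<close>, the correlation is positive.

  The argument gives an explicit constant for groups on every type. Since \<^const>\<open>bohr_const\<close> is
  chosen for groups on the natural numbers and may be smaller, the theorem is obtained by
  transport to such a group.
\<close>


section \<open>Product sets\<close>

text \<open>Bogolyubov's argument in an abelian group selects the large Fourier coefficients of an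
  indicator function. \<open>K\<close> need not be abelian, so the large eigenvalues of a positive
  operator take their place. The operator is built from the translates of both \<open>1_A\<close>
  and the indicator of the inverse set, so one space \<open>W\<close>, and hence one Bohr
  neighborhood, serves all four product sets. It is never fully diagonalised: a trace bound limits
  the number of large eigenvalues, and a maximal family of eigenvectors does the rest. The radius
  1/4 for closeness to the identity serves two purposes. Since \<open>2 * (1/4) < 1\<close>,
  repeated commutators with a fixed element contract. Since \<open>1/4 + 1/4 = 1/2\<close>, the
  powers of certain commutators stay in a ball that contains no nontrivial cyclic subgroup of
  isometries. At the end a correlation of at least half the square norm on \<open>W\<close> is set
  against a loss of at most a quarter of the square norm of \<open>g\<close>. \<open>G\<close>
  itself may be too large to embed in the natural numbers; the generated subgroup is finite, so only
  this subgroup is transported.\<close>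

context group
begin

lemma mem_set_mult: "z \<in> X <#> Y \<longleftrightarrow> (\<exists>x\<in>X. \<exists>y\<in>Y. z = x \<otimes> y)"
  by (auto simp: set_mult_def)

lemma mem_set_inv: "z \<in> set_inv X \<longleftrightarrow> (\<exists>x\<in>X. z = inv x)"
  by (auto simp: SET_INV_def)

lemma finite_set_mult: "finite X \<Longrightarrow> finite Y \<Longrightarrow> finite (X <#> Y)"
  by (auto simp: set_mult_def)

lemma finite_set_inv: "finite X \<Longrightarrow> finite (set_inv X)"
  by (auto simp: SET_INV_def)

lemma set_inv_closed: "X \<subseteq> carrier G \<Longrightarrow> set_inv X \<subseteq> carrier G"
  by (auto simp: SET_INV_def)

lemma card_set_inv: "X \<subseteq> carrier G \<Longrightarrow> card (set_inv X) = card X"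
proof -
  assume X: "X \<subseteq> carrier G"
  have "set_inv X = m_inv G ` X" by (auto simp: SET_INV_def)
  moreover have "inj_on (m_inv G) X" using X by (intro inj_onI) (metis inv_inv subsetD)
  ultimately show ?thesis by (simp add: card_image)
qed

lemma set_inv_set_inv: "X \<subseteq> carrier G \<Longrightarrow> set_inv (set_inv X) = X"
  by (force simp: SET_INV_def)

lemma set_inv_set_mult:
  assumes "X \<subseteq> carrier G" "Y \<subseteq> carrier G"
  shows "set_inv (X <#> Y) = set_inv Y <#> set_inv X"
proof -
  have "inv (x \<otimes> y) = inv y \<otimes> inv x" if "x \<in> X" "y \<in> Y" for x y
    using that assms by (meson inv_mult_group subsetD)
  then show ?thesis
    by (fastforce simp: SET_INV_def set_mult_def)
qed

lemma set_pow_closed: "X \<subseteq> carrier G \<Longrightarrow> X [^^] (n::nat) \<subseteq> carrier G"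
  by (induction n) (auto intro: setmult_subset_G[THEN subsetD] simp: set_mult_closed)

lemma finite_set_pow: "finite X \<Longrightarrow> finite (X [^^] (n::nat))"
  by (induction n) (auto intro: finite_set_mult)

lemma one_set_mult: "X \<subseteq> carrier G \<Longrightarrow> {\<one>} <#> X = X"
  by (force simp: set_mult_def)

lemma set_mult_one: "X \<subseteq> carrier G \<Longrightarrow> X <#> {\<one>} = X"
  by (force simp: set_mult_def)

lemma set_pow_2: "X \<subseteq> carrier G \<Longrightarrow> X [^^] (2::nat) = X <#> X"
  by (simp add: one_set_mult numeral_2_eq_2)

lemma set_pow_3: "X \<subseteq> carrier G \<Longrightarrow> X [^^] (3::nat) = X <#> X <#> X"
  by (simp add: one_set_mult numeral_3_eq_3)

section \<open>Cardinalities of product sets and growth of powers\<close>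

lemma card_le_set_mult_left:
  assumes "X \<subseteq> carrier G" "Y \<subseteq> carrier G" "X \<noteq> {}" "finite X" "finite Y"
  shows "card Y \<le> card (X <#> Y)"
proof -
  obtain x where x: "x \<in> X" using assms by auto
  have "inj_on ((\<otimes>) x) Y" using x assms by (auto intro!: inj_onI) (metis Units_eq Units_l_cancel subsetD)
  moreover have "(\<otimes>) x ` Y \<subseteq> X <#> Y" using x by (auto simp: set_mult_def)
  ultimately show ?thesis using card_mono[OF finite_set_mult] assms by (metis card_image)
qed

lemma card_le_set_mult_right:
  assumes "X \<subseteq> carrier G" "Y \<subseteq> carrier G" "Y \<noteq> {}" "finite X" "finite Y"
  shows "card X \<le> card (X <#> Y)"
proof -
  obtain y where y: "y \<in> Y" using assms by auto
  have "inj_on (\<lambda>x. x \<otimes> y) X" using y assms by (auto intro!: inj_onI) (metis right_cancel subsetD)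
  moreover have "(\<lambda>x. x \<otimes> y) ` X \<subseteq> X <#> Y" using y by (auto simp: set_mult_def)
  ultimately show ?thesis using card_mono[OF finite_set_mult] assms by (metis card_image)
qed

text \<open>Fix one factorisation \<open>d = x z\<close> for every \<open>d\<close> in
  \<open>X Z\<close>. The map taking \<open>(d, y)\<close> to \<open>(x y^-1, y z)\<close> is
  injective: the product of the two entries returns \<open>d\<close>, hence \<open>z\<close>, and
  then the second entry returns \<open>y\<close>.\<close>

lemma ruzsa_triangle:
  assumes X: "X \<subseteq> carrier G" "finite X" and Y: "Y \<subseteq> carrier G" "finite Y"
    and Z: "Z \<subseteq> carrier G" "finite Z"
  shows "card (X <#> Z) * card Y \<le> card (X <#> set_inv Y) * card (Y <#> Z)"
proof -
  have "\<forall>d\<in>X <#> Z. \<exists>p. fst p \<in> X \<and> snd p \<in> Z \<and> d = fst p \<otimes> snd p"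
    by (auto simp: set_mult_def)
  then obtain p where p: "\<And>d. d \<in> X <#> Z \<Longrightarrow> fst (p d) \<in> X \<and> snd (p d) \<in> Z \<and> d = fst (p d) \<otimes> snd (p d)"
    by metis
  define f where "f = (\<lambda>(d, y). (fst (p d) \<otimes> inv y, y \<otimes> snd (p d)))"
  have eq: "fst (f (d, y)) \<otimes> snd (f (d, y)) = d" if "d \<in> X <#> Z" "y \<in> Y" for d y
  proof -
    have c: "fst (p d) \<in> carrier G" "snd (p d) \<in> carrier G" "y \<in> carrier G"
      using p[OF that(1)] that X Y Z by auto
    then have "fst (p d) \<otimes> inv y \<otimes> (y \<otimes> snd (p d)) = fst (p d) \<otimes> snd (p d)"
      by (metis inv_closed inv_solve_right m_assoc m_closed)
    then show ?thesis using p[OF that(1)] by (simp add: f_def)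
  qed
  have "inj_on f ((X <#> Z) \<times> Y)"
  proof (rule inj_onI)
    fix a b assume a: "a \<in> (X <#> Z) \<times> Y" and b: "b \<in> (X <#> Z) \<times> Y" and e: "f a = f b"
    obtain d y d' y' where ab: "a = (d, y)" "b = (d', y')" by fastforce
    have dd: "d = d'" using eq[of d y] eq[of d' y'] a b e ab by auto
    have c: "fst (p d) \<in> carrier G" "y \<in> carrier G" "y' \<in> carrier G" "snd (p d) \<in> carrier G"
      using p[of d] a b X Y Z ab by auto
    have "y \<otimes> snd (p d) = y' \<otimes> snd (p d)" using e ab dd by (simp add: f_def)
    then show "a = b" using c dd ab by (metis right_cancel)
  qed
  moreover have "f ` ((X <#> Z) \<times> Y) \<subseteq> (X <#> set_inv Y) \<times> (Y <#> Z)"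
    using p by (fastforce simp: f_def set_mult_def SET_INV_def)
  ultimately have "card ((X <#> Z) \<times> Y) \<le> card ((X <#> set_inv Y) \<times> (Y <#> Z))"
    by (meson card_inj_on_le finite_SigmaI finite_set_inv finite_set_mult X Y Z)
  then show ?thesis by (simp add: card_cartesian_product)
qed

text \<open>In the inductive step the triangle inequality with \<open>A\<close> inserted between
  \<open>S^n\<close> and \<open>S S\<close> bounds \<open>S^(n+2)\<close> by \<open>S^(n+1)\<close>
  and \<open>S^3\<close>. Measuring against the subset \<open>A\<close> lets one factor
  \<open>card A\<close> cancel and yields the density of \<open>A\<close>, which is what is needed
  later.\<close>

lemma set_pow_growth:
  assumes S: "S \<subseteq> carrier G" "finite S" "set_inv S = S" and A: "A \<subseteq> S" "A \<noteq> {}"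
    and S3: "card (S <#> S <#> S) \<le> \<kappa> * card A"
  shows "card (S [^^] (Suc n)) \<le> \<kappa> ^ Suc n * card A"
proof (induction n)
  case 0
  have "card S \<le> card (S <#> S <#> S)"
    using S A by (intro card_le_set_mult_left finite_set_mult set_mult_closed) (auto simp: set_mult_def)
  then show ?case using S3 S by (simp add: one_set_mult)
next
  case (Suc n)
  have Ac: "A \<subseteq> carrier G" "finite A" using A S by (auto intro: finite_subset)
  define P where "P = S [^^] n"
  have P: "P \<subseteq> carrier G" "finite P" using S by (auto simp: P_def set_pow_closed finite_set_pow)
  have eq: "S [^^] (Suc (Suc n)) = P <#> (S <#> S)"
    using set_mult_assoc[of P S S] P S by (simp add: P_def)
  have "card (P <#> (S <#> S)) * card A \<le> card (P <#> set_inv A) * card (A <#> (S <#> S))"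
    using ruzsa_triangle[of P A "S <#> S"] P Ac S by (simp add: finite_set_mult set_mult_closed)
  also have "\<dots> \<le> card (S [^^] (Suc n)) * card (S <#> S <#> S)"
  proof (intro mult_le_mono card_mono)
    have "set_inv A \<subseteq> S" using A S(3) by (auto simp: SET_INV_def)
    then show "P <#> set_inv A \<subseteq> S [^^] (Suc n)" by (simp add: P_def mono_set_mult)
    have "A <#> (S <#> S) = A <#> S <#> S" using Ac S by (simp add: set_mult_assoc)
    then show "A <#> (S <#> S) \<subseteq> S <#> S <#> S" using A by (simp add: mono_set_mult)
  qed (simp_all add: S finite_set_pow finite_set_mult)
  also have "\<dots> \<le> (\<kappa> ^ Suc n * card A) * (\<kappa> * card A)" using Suc S3 by (intro mult_le_mono)
  finally have "card (P <#> (S <#> S)) * card A \<le> (\<kappa> ^ Suc (Suc n) * card A) * card A"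
    by (simp add: mult_ac)
  moreover have "card A > 0" using A Ac by (simp add: card_gt_0_iff)
  ultimately show ?case unfolding eq by simp
qed

text \<open>Two triangle inequalities, each squaring the constant. Inserting \<open>B\<close> into
  \<open>S S\<close> gives \<open>A B A\<close> and \<open>B A B\<close>, of size at most
  \<open>k * card A\<close>; inserting \<open>A\<close> into \<open>S S S = (A B A) (B A B)\<close>
  gives \<open>S S\<close> twice.\<close>

lemma small_alternation_cube:
  assumes A: "A \<subseteq> carrier G" "finite A" "A \<noteq> {}"
    and k: "card (A <#> set_inv A <#> A) \<le> k * card A"
  shows "card ((A <#> set_inv A) <#> (A <#> set_inv A) <#> (A <#> set_inv A)) \<le> k ^ 4 * card A"
proof -
  define B where "B = set_inv A"
  define S where "S = A <#> B"
  define X where "X = A <#> B <#> A"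
  have B: "B \<subseteq> carrier G" "finite B" "set_inv B = A" "set_inv A = B"
    using A by (auto simp: B_def set_inv_closed finite_set_inv set_inv_set_inv)
  have S: "S \<subseteq> carrier G" "finite S" using A B by (auto simp: S_def set_mult_closed finite_set_mult)
  have X: "X \<subseteq> carrier G" "finite X" using A B by (auto simp: X_def set_mult_closed finite_set_mult)
  define Z where "Z = B <#> A <#> B"
  have Z: "Z \<subseteq> carrier G" "finite Z" using A B by (auto simp: Z_def set_mult_closed finite_set_mult)
  have ZX: "Z = set_inv X" using A B by (simp add: Z_def X_def set_inv_set_mult set_mult_closed set_mult_assoc)
  have cZ: "card Z \<le> k * card A" using k X card_set_inv ZX by (simp add: X_def B_def)
  have cX: "card X \<le> k * card A" using k by (simp add: X_def B_def)
  have pos: "card A > 0" using A by (simp add: card_gt_0_iff)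
  have "card (S <#> S) * card B \<le> card (S <#> set_inv B) * card (B <#> S)"
    by (rule ruzsa_triangle) (use S B in auto)
  moreover have "S <#> set_inv B = X" "B <#> S = Z"
    using A B by (simp_all add: S_def X_def Z_def set_mult_assoc)
  moreover have "card B = card A" using A card_set_inv by (simp add: B_def)
  ultimately have "card (S <#> S) * card A \<le> (k * card A) * (k * card A)"
    using cX cZ by (metis mult_le_mono order_trans)
  then have "card (S <#> S) * card A \<le> (k ^ 2 * card A) * card A" by (simp add: power2_eq_square mult_ac)
  then have S2: "card (S <#> S) \<le> k ^ 2 * card A" using pos by simp
  have "card (X <#> Z) * card A \<le> card (X <#> set_inv A) * card (A <#> Z)"
    by (rule ruzsa_triangle) (use X Z A in auto)
  moreover have "X <#> set_inv A = S <#> S" "A <#> Z = S <#> S" "X <#> Z = S <#> S <#> S"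
    using A B by (simp_all add: S_def X_def Z_def set_mult_assoc set_mult_closed)
  ultimately have "card (S <#> S <#> S) * card A \<le> (k ^ 2 * card A) * (k ^ 2 * card A)"
    using S2 by (metis mult_le_mono order_trans)
  also have "\<dots> = (k ^ 4 * card A) * card A" by (simp add: power4_eq_xxxx power2_eq_square mult_ac)
  finally show ?thesis using pos by (simp add: S_def B_def)
qed

lemma set_inv_eq_empty_iff: "set_inv X = {} \<longleftrightarrow> X = {}"
  by (auto simp: SET_INV_def)

text \<open>The mixed words of length three come from \<open>A A A\<close> by the triangle
  inequality and by inversion, which reverses a word and swaps \<open>A\<close> with its inverse.
  The worst case \<open>A B A\<close> costs \<open>k * k^2\<close>. Allowing \<open>{\<one>}\<close>
  as a letter covers the shorter words in the cube of \<open>sym_set G A\<close>.\<close>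

lemma small_tripling_words:
  assumes A: "A \<subseteq> carrier G" "finite A" "A \<noteq> {}"
    and k: "card (A <#> A <#> A) \<le> k * card A"
    and XYZ: "X \<in> {A, set_inv A, {\<one>}}" "Y \<in> {A, set_inv A, {\<one>}}" "Z \<in> {A, set_inv A, {\<one>}}"
  shows "card (X <#> Y <#> Z) \<le> k ^ 3 * card A"
proof -
  define B where "B = set_inv A"
  define a where "a = card A"
  have B: "B \<subseteq> carrier G" "finite B" "B \<noteq> {}" "set_inv B = A" "set_inv A = B" "card B = a"
    using A by (auto simp: B_def a_def set_inv_closed finite_set_inv set_inv_set_inv card_set_inv set_inv_eq_empty_iff)
  note cl = A B set_mult_closed finite_set_mult
  have pos: "a > 0" using A by (simp add: a_def card_gt_0_iff)
  have "card (A <#> A) \<le> card (A <#> A <#> A)"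
    by (rule card_le_set_mult_right) (simp_all add: cl)
  then have AA: "card (A <#> A) \<le> k * a" using k by (simp add: a_def)
  have "card A \<le> card (A <#> A)"
    by (rule card_le_set_mult_right) (simp_all add: cl)
  then have "a \<le> k * a" using AA unfolding a_def by (rule order_trans)
  then have k1: "k \<ge> 1" using pos by (cases k) auto
  \<comment> \<open>Every word bound below has one of these four factors; they compare with
    \<open>k ^ 3\<close> because \<open>k1\<close> follows from the size of
    \<open>A A\<close>.\<close>
  have le3: "j * a \<le> k ^ 3 * a" if "j = 1 \<or> j = k \<or> j = k ^ 2 \<or> j = k ^ 3" for j
    using k1 that by (auto intro: power_increasing[of 2 3 k] self_le_power)
  have BB: "card (B <#> B) \<le> k * a"
    using card_set_inv[OF set_mult_closed[OF A(1) A(1)]] AA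
    by (simp add: set_inv_set_mult[OF A(1) A(1)] B(5))
  have tri: "card (P <#> R) \<le> i * j * a"
    if "P \<subseteq> carrier G" "finite P" "Q = A \<or> Q = B" "R \<subseteq> carrier G" "finite R"
      "card (P <#> set_inv Q) \<le> i * a" "card (Q <#> R) \<le> j * a" for P Q R i j
  proof -
    have "card (P <#> R) * card Q \<le> (i * a) * (j * a)"
      by (rule order_trans[OF ruzsa_triangle mult_le_mono]) (use that A B in auto)
    then have "card (P <#> R) * a \<le> (i * j * a) * a"
      using that B a_def by (auto simp: mult_ac)
    then show ?thesis using pos by simp
  qed
  have AAA: "card (A <#> A <#> A) \<le> k * a" using k by (simp add: a_def)
  have BAA: "card (B <#> A <#> A) \<le> k ^ 2 * a"
    using tri[of B A "A <#> A" k k] AAA BB cl by (simp add: set_mult_assoc power2_eq_square)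
  have AAB: "card (A <#> A <#> B) \<le> k ^ 2 * a"
    using tri[of "A <#> A" B B k k] AAA BB cl by (simp add: set_mult_assoc power2_eq_square)
  have rev: "card (P <#> Q <#> R) = card (set_inv R <#> set_inv Q <#> set_inv P)"
    if "P \<subseteq> carrier G" "Q \<subseteq> carrier G" "R \<subseteq> carrier G" for P Q R
    using that card_set_inv[of "P <#> Q <#> R"]
    by (simp add: set_inv_set_mult set_mult_closed set_inv_closed set_mult_assoc)
  have BBA: "card (B <#> B <#> A) \<le> k ^ 2 * a" using rev[of B B A] BAA cl by simp
  have ABB: "card (A <#> B <#> B) \<le> k ^ 2 * a" using rev[of A B B] AAB cl by simp
  have BBB: "card (B <#> B <#> B) \<le> k * a" using rev[of B B B] AAA cl by simp
  have ABA: "card (A <#> B <#> A) \<le> k ^ 3 * a"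
    using tri[of A B "B <#> A" k "k ^ 2"] AA BBA cl
    by (simp add: set_mult_assoc power2_eq_square power3_eq_cube mult_ac)
  have BAB: "card (B <#> A <#> B) \<le> k ^ 3 * a" using rev[of B A B] ABA cl by simp
  have three: "card (P <#> Q <#> R) \<le> k ^ 3 * a" if "P \<in> {A, B}" "Q \<in> {A, B}" "R \<in> {A, B}" for P Q R
    using that AAA BAA AAB BBA ABB BBB ABA BAB le3 by (auto intro: order_trans)
  have two: "card (P <#> Q) \<le> k ^ 3 * a" if "P \<in> {A, B}" "Q \<in> {A, B}" for P Q
  proof -
    have "P \<subseteq> carrier G" "finite P" "Q \<subseteq> carrier G" "finite Q" using that A B by auto
    then have "card (P <#> Q) \<le> card (P <#> Q <#> A)"
      using A by (intro card_le_set_mult_right set_mult_closed finite_set_mult)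
    then show ?thesis using three[OF that, of A] by simp
  qed
  have one: "card P \<le> k ^ 3 * a" if "P \<in> {A, B}" for P
    using that B le3[of 1] a_def by auto
  have zero: "1 \<le> k ^ 3 * a" using pos k1 by simp
  have "X = A \<or> X = B \<or> X = {\<one>}" "Y = A \<or> Y = B \<or> Y = {\<one>}" "Z = A \<or> Z = B \<or> Z = {\<one>}"
    using XYZ by (auto simp: B_def)
  then have "card (X <#> Y <#> Z) \<le> k ^ 3 * a"
    using three two one zero cl
    by (elim disjE) (simp_all add: one_set_mult set_mult_one)
  then show ?thesis by (simp add: a_def)
qed

lemma sym_set_closed: "A \<subseteq> carrier G \<Longrightarrow> sym_set G A \<subseteq> carrier G"
  by (auto simp: sym_set_def SET_INV_def)

lemma set_inv_sym_set: "A \<subseteq> carrier G \<Longrightarrow> set_inv (sym_set G A) = sym_set G A"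
  by (force simp: sym_set_def SET_INV_def)

lemma finite_sym_set: "finite A \<Longrightarrow> finite (sym_set G A)"
  by (simp add: sym_set_def finite_set_inv)

text \<open>The cube is the union of the 27 products of three letters. Letters may coincide as sets,
  so \<open>W\<close> only satisfies \<open>card W \<le> 3\<close>.\<close>

lemma small_tripling_cube:
  assumes A: "A \<subseteq> carrier G" "finite A" "A \<noteq> {}"
    and k: "card (A <#> A <#> A) \<le> k * card A"
  shows "card (sym_set G A <#> sym_set G A <#> sym_set G A) \<le> (27 * k ^ 3) * card A"
proof -
  define W where "W = {A, set_inv A, {\<one>}}"
  have S: "sym_set G A = \<Union> W" by (auto simp: sym_set_def W_def)
  have W: "finite W" "card W \<le> 3" unfolding W_def by (auto simp: card_insert_if)
  have fW: "finite (X <#> Y <#> Z)" if "X \<in> W" "Y \<in> W" "Z \<in> W" for X Y Z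
    using that A by (auto simp: W_def intro!: finite_set_mult finite_set_inv)
  have "sym_set G A <#> sym_set G A <#> sym_set G A = (\<Union>(X, Y, Z)\<in>W \<times> W \<times> W. X <#> Y <#> Z)"
    unfolding S set_mult_def by blast
  also have "card \<dots> \<le> (\<Sum>(X, Y, Z)\<in>W \<times> W \<times> W. card (X <#> Y <#> Z))"
    using card_UN_le[of "W \<times> W \<times> W" "\<lambda>(X, Y, Z). X <#> Y <#> Z"] W(1)
    by (simp add: case_prod_unfold)
  also have "\<dots> \<le> (\<Sum>(X, Y, Z)\<in>W \<times> W \<times> W. k ^ 3 * card A)"
    by (intro sum_mono) (auto intro!: small_tripling_words[OF A k] simp: W_def)
  also have "\<dots> = card W * card W * card W * (k ^ 3 * card A)"
    by (simp add: card_cartesian_product)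
  also have "\<dots> \<le> 3 * 3 * 3 * (k ^ 3 * card A)"
    using W(2) by (intro mult_le_mono) auto
  finally show ?thesis by simp
qed

end


section \<open>Functions on a finite set\<close>

text \<open>Counting measure without normalisation, linear in the first argument. Functions live on
  the whole type and their values off \<open>K\<close> are invisible, so identities between them are
  mostly stated pointwise on \<open>K\<close>.\<close>

definition ip :: "'a set \<Rightarrow> ('a \<Rightarrow> complex) \<Rightarrow> ('a \<Rightarrow> complex) \<Rightarrow> complex" where
  "ip K f g = (\<Sum>x\<in>K. f x * cnj (g x))"

definition nsq :: "'a set \<Rightarrow> ('a \<Rightarrow> complex) \<Rightarrow> real" where
  "nsq K f = (\<Sum>x\<in>K. (cmod (f x))\<^sup>2)"

lemma nsq_nonneg [simp]: "0 \<le> nsq K f"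
  by (simp add: nsq_def sum_nonneg)

lemma ip_self: "ip K f f = of_real (nsq K f)"
  by (simp add: ip_def nsq_def complex_norm_square[symmetric] flip: of_real_power)

lemma nsq_eq_0_iff: "finite K \<Longrightarrow> nsq K f = 0 \<longleftrightarrow> (\<forall>x\<in>K. f x = 0)"
  by (simp add: nsq_def sum_nonneg_eq_0_iff)

lemma cnj_ip: "cnj (ip K f g) = ip K g f"
  by (simp add: ip_def mult.commute)

lemma cmod_ip_swap: "cmod (ip K f g) = cmod (ip K g f)"
  by (metis cnj_ip complex_mod_cnj)

lemma ip_add_left: "ip K (\<lambda>x. f x + g x) h = ip K f h + ip K g h"
  by (simp add: ip_def algebra_simps sum.distrib)

lemma ip_diff_left: "ip K (\<lambda>x. f x - g x) h = ip K f h - ip K g h"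
  by (simp add: ip_def algebra_simps sum_subtractf)

lemma ip_scale_left: "ip K (\<lambda>x. c * f x) h = c * ip K f h"
  by (simp add: ip_def algebra_simps sum_distrib_left)

lemma ip_sum_left: "ip K (\<lambda>x. \<Sum>i\<in>I. f i x) h = (\<Sum>i\<in>I. ip K (f i) h)"
  unfolding ip_def sum_distrib_right by (rule sum.swap)

lemma ip_add_right: "ip K h (\<lambda>x. f x + g x) = ip K h f + ip K h g"
  by (simp add: ip_def algebra_simps sum.distrib)

lemma ip_diff_right: "ip K h (\<lambda>x. f x - g x) = ip K h f - ip K h g"
  by (simp add: ip_def algebra_simps sum_subtractf)

lemma ip_scale_right: "ip K h (\<lambda>x. c * f x) = cnj c * ip K h f"
  by (simp add: ip_def algebra_simps sum_distrib_left)

lemma ip_sum_right: "ip K h (\<lambda>x. \<Sum>i\<in>I. f i x) = (\<Sum>i\<in>I. ip K h (f i))"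
  unfolding ip_def cnj_sum sum_distrib_left by (rule sum.swap)

lemmas ip_linear = ip_add_left ip_diff_left ip_scale_left ip_sum_left
  ip_add_right ip_diff_right ip_scale_right ip_sum_right

lemma ip_zero: "ip K (\<lambda>_. 0) g = 0"
  by (simp add: ip_def)

lemma ip_cong: "(\<And>x. x \<in> K \<Longrightarrow> f x = f' x) \<Longrightarrow> (\<And>x. x \<in> K \<Longrightarrow> g x = g' x) \<Longrightarrow> ip K f g = ip K f' g'"
  unfolding ip_def by (rule sum.cong) auto

lemma nsq_cong: "(\<And>x. x \<in> K \<Longrightarrow> f x = f' x) \<Longrightarrow> nsq K f = nsq K f'"
  unfolding nsq_def by (rule sum.cong) auto

lemma nsq_scale: "nsq K (\<lambda>x. c * f x) = (cmod c)\<^sup>2 * nsq K f"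
  by (simp add: nsq_def norm_mult power_mult_distrib sum_distrib_left)

lemma cauchy_schwarz: "(cmod (ip K f g))\<^sup>2 \<le> nsq K f * nsq K g"
proof -
  have "cmod (ip K f g) \<le> (\<Sum>x\<in>K. \<bar>cmod (f x)\<bar> * \<bar>cmod (g x)\<bar>)"
    unfolding ip_def by (rule order_trans[OF norm_sum]) (simp add: norm_mult)
  also have "\<dots> \<le> L2_set (\<lambda>x. cmod (f x)) K * L2_set (\<lambda>x. cmod (g x)) K"
    by (rule L2_set_mult_ineq)
  finally have "(cmod (ip K f g))\<^sup>2 \<le> (L2_set (\<lambda>x. cmod (f x)) K * L2_set (\<lambda>x. cmod (g x)) K)\<^sup>2"
    by (simp add: power_mono)
  also have "\<dots> = nsq K f * nsq K g"
    by (simp add: power_mult_distrib L2_set_def nsq_def sum_nonneg)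
  finally show ?thesis .
qed

section \<open>Orthonormal families and projections\<close>

definition orthonormal :: "'a set \<Rightarrow> (nat \<Rightarrow> 'a \<Rightarrow> complex) \<Rightarrow> nat \<Rightarrow> bool" where
  "orthonormal K e r \<longleftrightarrow> (\<forall>i<r. \<forall>j<r. ip K (e i) (e j) = (if i = j then 1 else 0))"

definition orth_proj :: "'a set \<Rightarrow> (nat \<Rightarrow> 'a \<Rightarrow> complex) \<Rightarrow> nat \<Rightarrow> ('a \<Rightarrow> complex) \<Rightarrow> 'a \<Rightarrow> complex" where
  "orth_proj K e r f = (\<lambda>x. \<Sum>i<r. ip K f (e i) * e i x)"

lemma orthonormal_nsq: "orthonormal K e r \<Longrightarrow> i < r \<Longrightarrow> nsq K (e i) = 1"
  by (metis ip_self of_real_eq_1_iff orthonormal_def)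

lemma ip_orth_proj:
  assumes "orthonormal K e r" "j < r"
  shows "ip K (orth_proj K e r f) (e j) = ip K f (e j)"
proof -
  have "ip K (orth_proj K e r f) (e j) = (\<Sum>i<r. ip K f (e i) * ip K (e i) (e j))"
    by (simp add: orth_proj_def ip_linear)
  also have "\<dots> = (\<Sum>i<r. if i = j then ip K f (e j) else 0)"
    using assms by (intro sum.cong) (auto simp: orthonormal_def)
  finally show ?thesis using assms by simp
qed

lemma ip_orth_proj_perp:
  assumes "\<And>i. i < r \<Longrightarrow> ip K g (e i) = 0"
  shows "ip K (orth_proj K e r f) g = 0" "ip K g (orth_proj K e r f) = 0"
proof -
  show "ip K g (orth_proj K e r f) = 0"
    using assms by (simp add: orth_proj_def ip_linear)
  then show "ip K (orth_proj K e r f) g = 0" by (metis cnj_ip complex_cnj_zero)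
qed

lemma nsq_orth_proj:
  assumes "orthonormal K e r"
  shows "nsq K (orth_proj K e r f) = (\<Sum>i<r. (cmod (ip K f (e i)))\<^sup>2)"
proof -
  have "of_real (nsq K (orth_proj K e r f)) = (\<Sum>i<r. cnj (ip K f (e i)) * ip K (orth_proj K e r f) (e i))"
    unfolding ip_self[symmetric] by (subst (2) orth_proj_def) (simp add: ip_linear)
  also have "\<dots> = (\<Sum>i<r. of_real ((cmod (ip K f (e i)))\<^sup>2))"
    by (intro sum.cong refl) (simp add: ip_orth_proj[OF assms] complex_norm_square mult.commute del: of_real_power)
  finally show ?thesis unfolding of_real_sum[symmetric] of_real_eq_iff .
qed

lemma nsq_add_perp:
  assumes "ip K f g = 0"
  shows "nsq K (\<lambda>x. f x + g x) = nsq K f + nsq K g"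
proof -
  have "ip K g f = 0" using assms by (metis cnj_ip complex_cnj_zero)
  then have "ip K (\<lambda>x. f x + g x) (\<lambda>x. f x + g x) = ip K f f + ip K g g"
    using assms by (simp add: ip_linear)
  then show ?thesis unfolding ip_self of_real_add[symmetric] of_real_eq_iff .
qed

lemma ip_residual:
  assumes "orthonormal K e r" "j < r"
  shows "ip K (\<lambda>x. f x - orth_proj K e r f x) (e j) = 0"
  using ip_orth_proj[OF assms] by (simp add: ip_diff_left)

lemma nsq_split:
  assumes "orthonormal K e r"
  shows "nsq K f = nsq K (orth_proj K e r f) + nsq K (\<lambda>x. f x - orth_proj K e r f x)"
  using nsq_add_perp[of K "orth_proj K e r f" "\<lambda>x. f x - orth_proj K e r f x"]
    ip_orth_proj_perp(1)[OF ip_residual[OF assms]] by simp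

lemma bessel:
  assumes "orthonormal K e r"
  shows "(\<Sum>i<r. (cmod (ip K f (e i)))\<^sup>2) \<le> nsq K f"
  unfolding nsq_orth_proj[OF assms, symmetric] nsq_split[OF assms, of f] by simp

lemma orthonormal_extend:
  assumes "orthonormal K e r" "nsq K v = 1" "\<And>i. i < r \<Longrightarrow> ip K v (e i) = 0"
  shows "orthonormal K (e(r := v)) (Suc r)"
proof -
  have "ip K (e i) v = 0" if "i < r" for i using assms(3)[OF that] by (metis cnj_ip complex_cnj_zero)
  then show ?thesis using assms by (auto simp: orthonormal_def less_Suc_eq ip_self)
qed

text \<open>A longest family exists because the lengths are bounded; a unit vector with
  \<open>P\<close> orthogonal to it would lengthen it. \<open>P\<close> need not be linear: it is
  used for eigenvectors with large eigenvalue and for joint eigenvectors.\<close>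

lemma maximal_orthonormal:
  assumes "\<And>e r. orthonormal K e r \<Longrightarrow> (\<And>i. i < r \<Longrightarrow> P (e i)) \<Longrightarrow> r \<le> D"
  obtains e r where "orthonormal K e r" "\<And>i. i < r \<Longrightarrow> P (e i)"
    "\<And>v. P v \<Longrightarrow> nsq K v = 1 \<Longrightarrow> \<exists>i<r. ip K v (e i) \<noteq> 0"
proof -
  define R where "R r \<longleftrightarrow> (\<exists>e. orthonormal K e r \<and> (\<forall>i<r. P (e i)))" for r
  have "R 0" by (auto simp: R_def orthonormal_def)
  moreover have "\<And>r. R r \<Longrightarrow> r \<le> D" using assms by (auto simp: R_def)
  ultimately obtain r where r: "R r" "\<And>s. R s \<Longrightarrow> s \<le> r"
    using GreatestI_nat[of R 0 D] Greatest_le_nat[of R _ D] by blast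
  from r(1) obtain e where e: "orthonormal K e r" "\<forall>i<r. P (e i)" by (auto simp: R_def)
  have "\<exists>i<r. ip K v (e i) \<noteq> 0" if "P v" "nsq K v = 1" for v
  proof (rule ccontr)
    assume "\<not> ?thesis"
    then have "orthonormal K (e(r := v)) (Suc r)" using orthonormal_extend e that by blast
    moreover have "\<forall>i<Suc r. P ((e(r := v)) i)" using e that by (auto simp: less_Suc_eq)
    ultimately have "R (Suc r)" unfolding R_def by blast
    then show False using r(2) by fastforce
  qed
  then show ?thesis using that e by blast
qed

lemma nsq_normalise:
  assumes "nsq K v > 0"
  shows "nsq K (\<lambda>x. of_real (1 / sqrt (nsq K v)) * v x) = 1"
  using assms unfolding nsq_scale by (simp add: norm_divide power_divide)

section \<open>The positive operator of a finite family and its large eigenvalues\<close>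

definition qform :: "'a set \<Rightarrow> 't set \<Rightarrow> ('t \<Rightarrow> 'a \<Rightarrow> complex) \<Rightarrow> ('a \<Rightarrow> complex) \<Rightarrow> real" where
  "qform K T l v = (\<Sum>t\<in>T. (cmod (ip K v (l t)))\<^sup>2)"

text \<open>The sum of the rank-one operators given by the vectors \<open>l t\<close>. For the
  translates of an indicator function it is convolution composed with its adjoint, and the sum of
  all \<open>nsq K (l t)\<close> is its trace, the squared Hilbert-Schmidt norm of the
  convolution.\<close>

definition qop :: "'a set \<Rightarrow> 't set \<Rightarrow> ('t \<Rightarrow> 'a \<Rightarrow> complex) \<Rightarrow> ('a \<Rightarrow> complex) \<Rightarrow> 'a \<Rightarrow> complex" where
  "qop K T l v = (\<lambda>x. \<Sum>t\<in>T. ip K v (l t) * l t x)"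

lemma ip_qop: "ip K (qop K T l v) w = (\<Sum>t\<in>T. ip K v (l t) * ip K (l t) w)"
  by (simp add: qop_def ip_linear)

lemma ip_qop_self: "ip K (qop K T l v) v = of_real (qform K T l v)"
proof -
  have "ip K v (l t) * ip K (l t) v = of_real ((cmod (ip K v (l t)))\<^sup>2)" for t
    unfolding complex_norm_square cnj_ip ..
  then show ?thesis by (simp add: ip_qop qform_def)
qed

lemma ip_qop_swap: "ip K (qop K T l v) w = ip K v (qop K T l w)"
proof -
  have "ip K v (qop K T l w) = cnj (ip K (qop K T l w) v)" by (simp add: cnj_ip)
  also have "\<dots> = ip K (qop K T l v) w" by (simp add: ip_qop cnj_ip mult.commute)
  finally show ?thesis ..
qed

lemma qform_scale: "qform K T l (\<lambda>x. c * v x) = (cmod c)\<^sup>2 * qform K T l v"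
  by (simp add: qform_def ip_linear norm_mult power_mult_distrib sum_distrib_left)

lemma qform_cong:
  assumes "\<And>x. x \<in> K \<Longrightarrow> v x = w x"
  shows "qform K T l v = qform K T l w"
proof -
  have "ip K v (l t) = ip K w (l t)" for t by (rule ip_cong) (simp_all add: assms)
  then show ?thesis by (simp add: qform_def)
qed

text \<open>Requiring the value 0 off \<open>K\<close> puts the unit sphere inside a product of
  discs and points, which is compact by Tychonoff even when the type is infinite; the remaining
  conditions are closed.\<close>

lemma compact_unit_perp:
  fixes e :: "nat \<Rightarrow> 'a \<Rightarrow> complex"
  assumes "finite K"
  shows "compact {v. (\<forall>y. y \<notin> K \<longrightarrow> v y = 0) \<and> nsq K v = 1 \<and> (\<forall>i<r. ip K v (e i) = 0)}" (is "compact ?S")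
proof -
  define C :: "'a \<Rightarrow> complex set" where "C y = (if y \<in> K then cball 0 1 else {0})" for y
  have "compactin (product_topology (\<lambda>i. euclidean) UNIV) (PiE UNIV C)"
    unfolding compactin_PiE by (auto simp: C_def)
  then have cP: "compact (PiE UNIV C)"
    by (simp add: euclidean_product_topology)
  have eq: "?S = PiE UNIV C \<inter> ({v. nsq K v = 1} \<inter> (\<Inter>i\<in>{..<r}. {v. ip K v (e i) = 0}))" (is "_ = ?R")
  proof (intro equalityI subsetI)
    fix v assume v: "v \<in> ?S"
    have "cmod (v y) \<le> 1" if "y \<in> K" for y
    proof -
      have "(cmod (v y))\<^sup>2 \<le> nsq K v"
        unfolding nsq_def by (rule member_le_sum) (use assms that in auto)
      then show ?thesis using v by (simp add: abs_square_le_1)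
    qed
    then show "v \<in> ?R" using v by (auto simp: C_def PiE_iff)
  next
    fix v assume v: "v \<in> ?R"
    have "v y = 0" if "y \<notin> K" for y
    proof -
      have "v y \<in> C y" using v by (auto simp: PiE_iff)
      then show ?thesis using that by (simp add: C_def)
    qed
    then show "v \<in> ?S" using v by auto
  qed
  have "closed ({v. nsq K v = 1} \<inter> (\<Inter>i\<in>{..<r}. {v. ip K v (e i) = 0}))"
    unfolding nsq_def ip_def
    by (intro closed_Int closed_INT ballI closed_Collect_eq continuous_intros
        continuous_on_product_coordinates)
  then show ?thesis unfolding eq by (rule compact_Int_closed[OF cP])
qed

text \<open>For small \<open>t\<close> the linear term dominates. When \<open>b > 0\<close>, the
  minimiser \<open>t = - c / b\<close> gives the value \<open>- c^2 / b\<close>.\<close>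

lemma quadratic_nonneg_imp:
  fixes b c :: real
  assumes "\<And>t. 0 \<le> 2 * t * c + t\<^sup>2 * b" "0 \<le> c"
  shows "c = 0"
proof (cases "b \<le> 0")
  case True
  then show ?thesis using assms(1)[of "-1"] assms(2) by simp
next
  case False
  have "0 \<le> 2 * (- (c / b)) * c + (- (c / b))\<^sup>2 * b" using assms(1) by blast
  also have "\<dots> = - (c\<^sup>2 / b)" using False by (simp add: power2_eq_square field_simps)
  finally have "c\<^sup>2 / b \<le> 0" by simp
  then show ?thesis using False by (auto simp: divide_le_0_iff)
qed

text \<open>Let \<open>u\<close> maximise the form on the unit sphere of the orthogonal complement,
  with maximum \<open>M\<close>. Then \<open>M * nsq - qform\<close> is nonnegative on the
  complement and zero at \<open>u\<close>. Along the residual \<open>d = M u - Q u\<close> its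
  first-order coefficient is \<open>2 * nsq d\<close>, so \<open>d\<close> vanishes. That
  \<open>d\<close> lies in the complement uses that the \<open>e i\<close> are eigenvectors.\<close>

lemma rayleigh:
  fixes e :: "nat \<Rightarrow> 'a \<Rightarrow> complex"
  assumes K: "finite K"
    and e: "\<And>i. i < r \<Longrightarrow> \<exists>\<mu>. \<forall>x\<in>K. qop K T l (e i) x = of_real \<mu> * e i x"
    and v: "nsq K v > 0" "\<And>i. i < r \<Longrightarrow> ip K v (e i) = 0" "qform K T l v \<ge> \<epsilon> * nsq K v"
  obtains u M where "nsq K u = 1" "\<And>i. i < r \<Longrightarrow> ip K u (e i) = 0" "M \<ge> \<epsilon>"
    "\<forall>x\<in>K. qop K T l u x = of_real M * u x"
proof -
  define S where "S = {v. (\<forall>y. y \<notin> K \<longrightarrow> v y = 0) \<and> nsq K v = 1 \<and> (\<forall>i<r. ip K v (e i) = 0)}"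
  have "compact S" unfolding S_def by (rule compact_unit_perp[OF K])
  \<comment> \<open>Members of \<open>S\<close> vanish off \<open>K\<close>, so a vector is cut off
    as well as normalised; \<open>ip\<close> and \<open>qform\<close> do not see the
    difference.\<close>
  have norm_in: "(\<lambda>x. if x \<in> K then of_real (1 / sqrt (nsq K w)) * w x else 0) \<in> S"
    (is "?w \<in> S") if w: "nsq K w > 0" "\<And>i. i < r \<Longrightarrow> ip K w (e i) = 0" for w
  proof -
    have "nsq K ?w = nsq K (\<lambda>x. of_real (1 / sqrt (nsq K w)) * w x)" by (rule nsq_cong) auto
    also have "\<dots> = 1" by (rule nsq_normalise[OF w(1)])
    finally have "nsq K ?w = 1" .
    moreover have "ip K ?w (e i) = 0" if "i < r" for i
    proof -
      have "ip K ?w (e i) = ip K (\<lambda>x. of_real (1 / sqrt (nsq K w)) * w x) (e i)" by (rule ip_cong) auto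
      then show ?thesis using w(2)[OF that] by (simp only: ip_scale_left) simp
    qed
    ultimately show ?thesis by (auto simp: S_def)
  qed
  have qnorm: "qform K T l (\<lambda>x. if x \<in> K then of_real (1 / sqrt (nsq K w)) * w x else 0) = qform K T l w / nsq K w"
    if "nsq K w > 0" for w
  proof -
    have "qform K T l (\<lambda>x. if x \<in> K then of_real (1 / sqrt (nsq K w)) * w x else 0)
        = qform K T l (\<lambda>x. of_real (1 / sqrt (nsq K w)) * w x)" by (rule qform_cong) auto
    also have "\<dots> = qform K T l w / nsq K w"
      using that unfolding qform_scale by (simp add: norm_divide power_divide)
    finally show ?thesis .
  qed
  have "S \<noteq> {}" using norm_in[OF v(1,2)] by blast
  moreover have "continuous_on S (qform K T l)"
  proof -
    have "continuous_on UNIV (qform K T l)"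
      unfolding qform_def[abs_def] ip_def
      by (intro continuous_intros continuous_on_product_coordinates)
    then show ?thesis by (rule continuous_on_subset) auto
  qed
  ultimately obtain u where u: "u \<in> S" "\<And>w. w \<in> S \<Longrightarrow> qform K T l w \<le> qform K T l u"
    using continuous_attains_sup[OF \<open>compact S\<close>] by metis
  define M where "M = qform K T l u"
  have M: "qform K T l w \<le> M * nsq K w" if w: "\<And>i. i < r \<Longrightarrow> ip K w (e i) = 0" for w
  proof (cases "nsq K w > 0")
    case True
    then have "qform K T l w / nsq K w \<le> M"
      using u(2)[OF norm_in[OF True w]] qnorm[OF True] by (simp add: M_def)
    then show ?thesis using True by (simp add: field_simps)
  next
    case False
    then have "nsq K w = 0" using nsq_nonneg[of K w] by linarith
    moreover from this have "qform K T l w = qform K T l (\<lambda>_. 0)"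
      using nsq_eq_0_iff[OF K] by (intro qform_cong) auto
    moreover have "qform K T l (\<lambda>_. 0) = 0" by (simp add: qform_def ip_def)
    ultimately show ?thesis by simp
  qed
  have "\<epsilon> \<le> qform K T l v / nsq K v" using v by (simp add: field_simps)
  also have "\<dots> \<le> M" using u(2)[OF norm_in[OF v(1,2)]] qnorm[OF v(1)] by (simp add: M_def)
  finally have "\<epsilon> \<le> M" .
  have u1: "nsq K u = 1" "\<And>i. i < r \<Longrightarrow> ip K u (e i) = 0" using u(1) by (auto simp: S_def)
  define d where "d = (\<lambda>x. of_real M * u x - qop K T l u x)"
  have d_perp: "ip K d (e i) = 0" if i: "i < r" for i
  proof -
    obtain \<mu> where "\<forall>x\<in>K. qop K T l (e i) x = of_real \<mu> * e i x" using e[OF i] by auto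
    then have "ip K (qop K T l u) (e i) = ip K u (\<lambda>x. of_real \<mu> * e i x)"
      unfolding ip_qop_swap by (intro ip_cong) auto
    then show ?thesis using u1(2)[OF i] by (simp add: d_def ip_linear)
  qed
  have "0 \<le> 2 * t * nsq K d + t\<^sup>2 * (M * nsq K d - qform K T l d)" for t :: real
  proof -
    define w where "w = (\<lambda>x. u x + of_real t * d x)"
    have "ip K w (e i) = 0" if "i < r" for i using u1(2) d_perp that by (simp add: w_def ip_linear)
    then have "0 \<le> M * nsq K w - qform K T l w" using M by fastforce
    moreover have "of_real (M * nsq K w - qform K T l w)
        = of_real (2 * t * nsq K d + t\<^sup>2 * (M * nsq K d - qform K T l d) :: real) + (0 :: complex)"
    proof -
      have lin: "qop K T l w = (\<lambda>x. qop K T l u x + of_real t * qop K T l d x)"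
        by (simp add: w_def qop_def ip_linear algebra_simps sum.distrib sum_distrib_left)
      have "of_real (M * nsq K w - qform K T l w) = of_real M * ip K w w - ip K (qop K T l w) w"
        by (simp add: ip_self ip_qop_self)
      also have "\<dots> = (of_real M * ip K u u - ip K (qop K T l u) u)
          + of_real t * (of_real M * ip K u d - ip K (qop K T l u) d)
          + of_real t * (of_real M * ip K d u - ip K (qop K T l d) u)
          + of_real t ^ 2 * (of_real M * ip K d d - ip K (qop K T l d) d)"
        unfolding lin by (simp add: w_def ip_linear algebra_simps power2_eq_square)
      also have "of_real M * ip K u d - ip K (qop K T l u) d = ip K d d"
        by (subst (3) d_def) (simp add: ip_linear)
      also have "of_real M * ip K d u - ip K (qop K T l d) u = ip K d d"
        unfolding ip_qop_swap by (subst (4) d_def) (simp add: ip_linear)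
      also have "of_real M * ip K u u - ip K (qop K T l u) u = 0"
        using u1 by (simp add: ip_self ip_qop_self M_def)
      finally show ?thesis by (simp add: ip_self ip_qop_self algebra_simps)
    qed
    ultimately show ?thesis unfolding add_0_right of_real_eq_iff by simp
  qed
  then have "nsq K d = 0" using quadratic_nonneg_imp nsq_nonneg by metis
  then have "\<forall>x\<in>K. qop K T l u x = of_real M * u x"
    using nsq_eq_0_iff[OF K] by (auto simp: d_def)
  then show ?thesis using that u1 \<open>\<epsilon> \<le> M\<close> by blast
qed

text \<open>The trace inequality: after exchanging the sums, Bessel's inequality applies to each
  \<open>l t\<close>.\<close>

lemma sum_qform_orthonormal_le:
  assumes "orthonormal K e r"
  shows "(\<Sum>i<r. qform K T l (e i)) \<le> (\<Sum>t\<in>T. nsq K (l t))"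
proof -
  have "(\<Sum>i<r. qform K T l (e i)) = (\<Sum>t\<in>T. \<Sum>i<r. (cmod (ip K (e i) (l t)))\<^sup>2)"
    unfolding qform_def by (rule sum.swap)
  also have "\<dots> = (\<Sum>t\<in>T. \<Sum>i<r. (cmod (ip K (l t) (e i)))\<^sup>2)"
    by (intro sum.cong refl) (metis cmod_ip_swap)
  also have "\<dots> \<le> (\<Sum>t\<in>T. nsq K (l t))" by (intro sum_mono bessel[OF assms])
  finally show ?thesis .
qed

text \<open>By the trace inequality at most \<open>D\<close> orthonormal eigenvectors have
  eigenvalue at least \<epsilon>, so a maximal family exists. A vector orthogonal to it on which the
  form is large would produce one more through \<open>rayleigh\<close>.\<close>

lemma large_spectrum:
  assumes K: "finite K" and \<epsilon>: "\<epsilon> > 0" and tr: "(\<Sum>t\<in>T. nsq K (l t)) \<le> real D * \<epsilon>"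
  obtains e r where "orthonormal K e r" "r \<le> D"
    "\<And>i. i < r \<Longrightarrow> \<exists>\<mu>\<ge>\<epsilon>. \<forall>x\<in>K. qop K T l (e i) x = of_real \<mu> * e i x"
    "\<And>v. nsq K v > 0 \<Longrightarrow> (\<And>i. i < r \<Longrightarrow> ip K v (e i) = 0) \<Longrightarrow> qform K T l v < \<epsilon> * nsq K v"
proof -
  define P where "P = (\<lambda>u. \<exists>\<mu>\<ge>\<epsilon>. \<forall>x\<in>K. qop K T l u x = of_real \<mu> * u x)"
  have bound: "r \<le> D" if "orthonormal K e r" "\<And>i. i < r \<Longrightarrow> P (e i)" for e r
  proof -
    have "qform K T l (e i) \<ge> \<epsilon>" if i: "i < r" for i
    proof -
      obtain \<mu> where l: "\<mu> \<ge> \<epsilon>" "\<forall>x\<in>K. qop K T l (e i) x = of_real \<mu> * e i x"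
        using \<open>\<And>i. i < r \<Longrightarrow> P (e i)\<close>[OF i] by (auto simp: P_def)
      have "ip K (qop K T l (e i)) (e i) = ip K (\<lambda>x. of_real \<mu> * e i x) (e i)"
        using l by (intro ip_cong) auto
      then have "of_real (qform K T l (e i)) = of_real \<mu> * (1 :: complex)"
        using \<open>orthonormal K e r\<close> i by (simp add: ip_qop_self ip_linear orthonormal_def)
      then show ?thesis using l(1) by (metis mult.right_neutral of_real_eq_iff)
    qed
    then have "(\<Sum>i<r. \<epsilon>) \<le> (\<Sum>i<r. qform K T l (e i))" by (intro sum_mono) auto
    also have "\<dots> \<le> real D * \<epsilon>" using sum_qform_orthonormal_le[OF that(1)] tr by (rule order_trans)
    finally show ?thesis using \<epsilon> by simp
  qed
  obtain e r where er: "orthonormal K e r" "\<And>i. i < r \<Longrightarrow> P (e i)"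
    "\<And>v. P v \<Longrightarrow> nsq K v = 1 \<Longrightarrow> \<exists>i<r. ip K v (e i) \<noteq> 0"
    using maximal_orthonormal[of K P D] bound by metis
  have "qform K T l v < \<epsilon> * nsq K v" if v: "nsq K v > 0" "\<And>i. i < r \<Longrightarrow> ip K v (e i) = 0" for v
  proof (rule ccontr)
    assume "\<not> ?thesis"
    then have ge: "qform K T l v \<ge> \<epsilon> * nsq K v" by simp
    have ev: "\<exists>\<mu>. \<forall>x\<in>K. qop K T l (e i) x = of_real \<mu> * e i x" if "i < r" for i
      using er(2)[OF that] by (auto simp: P_def)
    show False
    proof (rule rayleigh[OF K ev v(1) v(2) ge])
      fix u M
      assume u: "nsq K u = 1" "\<And>i. i < r \<Longrightarrow> ip K u (e i) = 0" "M \<ge> \<epsilon>"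
        "\<forall>x\<in>K. qop K T l u x = of_real M * u x"
      then have "P u" by (auto simp: P_def)
      then show False using er(3)[of u] u by auto
    qed
  qed
  then show ?thesis using that[OF er(1) bound[OF er(1,2)] er(2)[unfolded P_def]] by blast
qed


section \<open>Isometric actions\<close>

lemma nonpos_if_le_powers:
  fixes a b q :: real
  assumes "\<And>k::nat. a \<le> b * q ^ k" "0 \<le> q" "q < 1"
  shows "a \<le> 0"
proof -
  have "(\<lambda>k. b * q ^ k) \<longlonglongrightarrow> b * 0"
    using assms by (intro tendsto_mult tendsto_const LIMSEQ_realpow_zero)
  then show ?thesis using LIMSEQ_le_const assms(1) by fastforce
qed

text \<open>Only what the commutator argument uses is assumed: \<open>W\<close> is an additive group
  and \<open>nrm\<close> a norm in which doubling a vector doubles its length. Inner products and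
  scalars do not enter.\<close>

locale isometric_action = group G for G (structure) +
  fixes W :: "'v::ab_group_add set" and act :: "'a \<Rightarrow> 'v \<Rightarrow> 'v" and nrm :: "'v \<Rightarrow> real"
  assumes diff_mem: "u \<in> W \<Longrightarrow> v \<in> W \<Longrightarrow> u - v \<in> W"
    and act_mem: "x \<in> carrier G \<Longrightarrow> w \<in> W \<Longrightarrow> act x w \<in> W"
    and act_one: "w \<in> W \<Longrightarrow> act \<one> w = w"
    and act_mult: "x \<in> carrier G \<Longrightarrow> y \<in> carrier G \<Longrightarrow> w \<in> W \<Longrightarrow> act (x \<otimes> y) w = act x (act y w)"
    and act_diff: "x \<in> carrier G \<Longrightarrow> u \<in> W \<Longrightarrow> v \<in> W \<Longrightarrow> act x (u - v) = act x u - act x v"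
    and nrm_act: "x \<in> carrier G \<Longrightarrow> w \<in> W \<Longrightarrow> nrm (act x w) = nrm w"
    and nrm_diff: "u \<in> W \<Longrightarrow> v \<in> W \<Longrightarrow> nrm (u - v) \<le> nrm u + nrm v"
    and nrm_double: "u \<in> W \<Longrightarrow> nrm (u + u) = 2 * nrm u"
    and nrm_nonneg: "0 \<le> nrm u"
    and nrm_eq_0: "u \<in> W \<Longrightarrow> nrm u = 0 \<Longrightarrow> u = 0"
begin

definition near :: "'a \<Rightarrow> real \<Rightarrow> bool" where
  "near x c \<longleftrightarrow> (\<forall>w\<in>W. nrm (act x w - w) \<le> c * nrm w)"

text \<open>The action need not be faithful, so membership in its kernel replaces equality with the
  identity.\<close>

definition acts_trivially :: "'a \<Rightarrow> bool" where
  "acts_trivially x \<longleftrightarrow> (\<forall>w\<in>W. act x w = w)"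

definition comm :: "'a \<Rightarrow> 'a \<Rightarrow> 'a" where
  "comm x y = x \<otimes> y \<otimes> inv x \<otimes> inv y"

lemma comm_closed [simp]: "x \<in> carrier G \<Longrightarrow> y \<in> carrier G \<Longrightarrow> comm x y \<in> carrier G"
  by (simp add: comm_def)

lemma comm_mult:
  assumes [simp]: "x \<in> carrier G" "y \<in> carrier G"
  shows "comm x y \<otimes> (y \<otimes> x) = x \<otimes> y"
proof -
  have "comm x y = (x \<otimes> y) \<otimes> inv (y \<otimes> x)"
    by (simp add: comm_def inv_mult_group m_assoc)
  then show ?thesis by (simp add: m_assoc[of "x \<otimes> y" "inv (y \<otimes> x)" "y \<otimes> x"])
qed

lemma nrm_minus: "u \<in> W \<Longrightarrow> v \<in> W \<Longrightarrow> nrm (u - v) = nrm (v - u)"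
proof -
  have le: "nrm (u - v) \<le> nrm (v - u)" if "u \<in> W" "v \<in> W" for u v
  proof -
    have 0: "0 \<in> W" using diff_mem[OF that(1) that(1)] by simp
    have "nrm 0 = 0" using nrm_double[OF 0] by simp
    then show ?thesis
      using nrm_diff[OF 0 diff_mem[OF that(2) that(1)]] by simp
  qed
  show "u \<in> W \<Longrightarrow> v \<in> W \<Longrightarrow> nrm (u - v) = nrm (v - u)"
    by (intro antisym le)
qed

lemma near_mult:
  assumes x: "x \<in> carrier G" "near x a" and y: "y \<in> carrier G" "near y b"
  shows "near (x \<otimes> y) (a + b)"
  unfolding near_def
proof
  fix w assume w: "w \<in> W"
  define v where "v = act y w"
  have v: "v \<in> W" using act_mem y w by (simp add: v_def)
  have "act (x \<otimes> y) w - w = (act x v - v) - (w - v)"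
    using act_mult x y w by (simp add: v_def)
  also have "nrm \<dots> \<le> nrm (act x v - v) + nrm (w - v)"
    using x v w by (intro nrm_diff diff_mem act_mem)
  also have "\<dots> \<le> a * nrm v + b * nrm w"
    using x y v w nrm_minus[OF w v] by (intro add_mono) (auto simp: near_def v_def)
  also have "nrm v = nrm w" using nrm_act y w by (simp add: v_def)
  finally show "nrm (act (x \<otimes> y) w - w) \<le> (a + b) * nrm w" by (simp add: algebra_simps)
qed

lemma near_inv:
  assumes x: "x \<in> carrier G" "near x a"
  shows "near (inv x) a"
  unfolding near_def
proof
  fix w assume w: "w \<in> W"
  define v where "v = act (inv x) w"
  have v: "v \<in> W" "nrm v = nrm w" using act_mem nrm_act x w by (simp_all add: v_def)
  have "act x v = w" using act_mult[of x "inv x" w] x w act_one by (simp add: v_def)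
  then have "nrm (v - w) \<le> a * nrm v" using x v w nrm_minus[OF v(1) w] by (auto simp: near_def)
  then show "nrm (act (inv x) w - w) \<le> a * nrm w" using v by (simp add: v_def)
qed

lemma near_conj:
  assumes x: "x \<in> carrier G" "near x a" and g: "g \<in> carrier G"
  shows "near (g \<otimes> x \<otimes> inv g) a"
  unfolding near_def
proof
  fix w assume w: "w \<in> W"
  define v where "v = act (inv g) w"
  have v: "v \<in> W" "nrm v = nrm w" using act_mem nrm_act g w by (simp_all add: v_def)
  have gv: "act g v = w" using act_mult[of g "inv g" w] g w act_one by (simp add: v_def)
  have "act (g \<otimes> x \<otimes> inv g) w = act g (act x v)"
    using g x w by (simp add: act_mult act_mem v_def)
  then have "act (g \<otimes> x \<otimes> inv g) w - w = act g (act x v - v)"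
    using g x v by (simp add: act_diff act_mem gv)
  then have "nrm (act (g \<otimes> x \<otimes> inv g) w - w) = nrm (act x v - v)"
    using g x v by (simp add: nrm_act act_mem diff_mem)
  then show "nrm (act (g \<otimes> x \<otimes> inv g) w - w) \<le> a * nrm w"
    using x v by (auto simp: near_def)
qed

text \<open>With \<open>u = (y x)^-1 w\<close>, the displacement of \<open>w\<close> under
  \<open>[x, y]\<close> is \<open>(x - 1)(y - 1) u - (y - 1)(x - 1) u\<close>, and each term
  contributes \<open>a * b\<close>.\<close>

lemma near_comm:
  assumes x: "x \<in> carrier G" "near x a" "a \<ge> 0" and y: "y \<in> carrier G" "near y b" "b \<ge> 0"
  shows "near (comm x y) (2 * a * b)"
  unfolding near_def
proof
  fix w assume w: "w \<in> W"
  define u where "u = act (inv (y \<otimes> x)) w"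
  have u: "u \<in> W" "nrm u = nrm w" using act_mem nrm_act x y w by (simp_all add: u_def)
  have w_eq: "act (y \<otimes> x) u = w"
    using act_mult[of "y \<otimes> x" "inv (y \<otimes> x)" w] x y w act_one by (simp add: u_def del: act_mult)
  have "act (comm x y) w = act (comm x y \<otimes> (y \<otimes> x)) u"
    using act_mult[of "comm x y" "y \<otimes> x" u] x y u w_eq by simp
  also have "\<dots> = act x (act y u)" using x y u by (simp add: comm_mult act_mult)
  finally have cw: "act (comm x y) w = act x (act y u)" .
  define p q where "p = act y u - u" and "q = act x u - u"
  have pq: "p \<in> W" "q \<in> W" using x y u by (auto simp: p_def q_def intro!: diff_mem act_mem)
  have "act (comm x y) w - w = (act x p - p) - (act y q - q)"
    unfolding cw using w_eq x y u
    by (simp add: p_def q_def act_diff act_mem act_mult algebra_simps)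
  also have "nrm \<dots> \<le> nrm (act x p - p) + nrm (act y q - q)"
    using x y pq by (intro nrm_diff diff_mem act_mem)
  also have "\<dots> \<le> a * nrm p + b * nrm q"
    using x y pq by (intro add_mono) (auto simp: near_def)
  also have "\<dots> \<le> a * (b * nrm u) + b * (a * nrm u)"
    using x y u by (intro add_mono mult_left_mono) (auto simp: near_def p_def q_def)
  finally show "nrm (act (comm x y) w - w) \<le> 2 * a * b * nrm w" using u by (simp add: algebra_simps)
qed

text \<open>Squaring an isometry close to the identity nearly doubles its distance to the identity.\<close>

lemma no_small_subgroups:
  assumes c: "c \<in> carrier G" and near: "\<And>n::nat. near (c [^] n) (1/2)"
  shows "acts_trivially c"
proof -
  \<comment> \<open>The ratio is \<open>1 / (2 - 1/2)\<close>: for \<open>u = (x - 1) w\<close> one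
    has \<open>2 u = (x^2 - 1) w - (x - 1) u\<close>, whose last term has norm at most half that of
    \<open>u\<close>. All powers are treated at once because the step passes from \<open>n\<close>
    to \<open>n + n\<close>.\<close>
  have "near (c [^] n) (1/2 * (2/3) ^ k)" for n k :: nat
  proof (induction k arbitrary: n)
    case 0
    then show ?case using near by simp
  next
    case (Suc k)
    show ?case unfolding near_def
    proof
      fix w assume w: "w \<in> W"
      define x where "x = c [^] n"
      define u where "u = act x w - w"
      have x: "x \<in> carrier G" "x \<otimes> x = c [^] (n + n)" using c by (simp_all add: x_def nat_pow_mult)
      have u: "u \<in> W" using x w by (simp add: u_def diff_mem act_mem)
      have eq: "u + u = (act (x \<otimes> x) w - w) - (act x u - u)"
        using x(1) w by (simp add: u_def act_mult act_diff act_mem algebra_simps)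
      have "2 * nrm u = nrm (u + u)" using nrm_double[OF u] by simp
      also have "\<dots> \<le> nrm (act (x \<otimes> x) w - w) + nrm (act x u - u)"
        unfolding eq using x(1) u w by (intro nrm_diff diff_mem act_mem m_closed)
      also have "\<dots> \<le> 1/2 * (2/3) ^ k * nrm w + 1/2 * nrm u"
        using Suc[of "n + n", folded x(2)] near[of n, folded x_def] w u by (intro add_mono) (auto simp: near_def)
      finally have "nrm u \<le> 1/2 * (2/3) ^ Suc k * nrm w" by simp
      then show "nrm (act (c [^] n) w - w) \<le> 1/2 * (2/3) ^ Suc k * nrm w"
        by (simp add: u_def x_def)
    qed
  qed
  from this[of 1] have le: "nrm (act c w - w) \<le> (1/2 * nrm w) * (2/3) ^ k" if "w \<in> W" for w k
    using that c by (auto simp: near_def mult_ac)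
  show ?thesis unfolding acts_trivially_def
  proof
    fix w assume w: "w \<in> W"
    have "nrm (act c w - w) \<le> 0" by (rule nonpos_if_le_powers[OF le[OF w]]) auto
    then have "nrm (act c w - w) = 0" using nrm_nonneg by (intro antisym)
    then have "act c w - w = 0" using nrm_eq_0 diff_mem act_mem c w by blast
    then show "act c w = w" by simp
  qed
qed

lemma comm_trivialD:
  assumes x: "x \<in> carrier G" and y: "y \<in> carrier G" and t: "acts_trivially (comm x y)" and w: "w \<in> W"
  shows "act x (act y w) = act y (act x w)"
proof -
  have "act x (act y w) = act (comm x y \<otimes> (y \<otimes> x)) w"
    using x y w by (simp only: comm_mult act_mult)
  also have "\<dots> = act (comm x y) (act (y \<otimes> x) w)" using x y w by (intro act_mult) auto
  also have "\<dots> = act (y \<otimes> x) w" using t x y w act_mem by (auto simp: acts_trivially_def)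
  finally show ?thesis using act_mult x y w by simp
qed

text \<open>If \<open>x\<close> commutes with \<open>C = [x, y]\<close>, then \<open>C\<^sup>n = x\<^sup>n y x\<^sup>-\<^sup>n y\<^sup>-\<^sup>1\<close> stays close to the identity.\<close>

lemma comm_trivial_step:
  assumes x: "x \<in> carrier G" and y: "y \<in> carrier G" "near y (1/4)"
    and t: "acts_trivially (comm x (comm x y))"
  shows "acts_trivially (comm x y)"
proof (rule no_small_subgroups)
  define C where "C = comm x y"
  have C: "C \<in> carrier G" using x y by (simp add: C_def)
  have C_y: "C \<otimes> y = x \<otimes> y \<otimes> inv x" using x y by (simp add: C_def comm_def m_assoc)
  have xC: "act x (act C w) = act C (act x w)" if "w \<in> W" for w
    using comm_trivialD[OF x C] t that by (simp add: C_def)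
  have xCn: "act x (act (C [^] n) w) = act (C [^] n) (act x w)" if "w \<in> W" for w and n :: nat
    using that
  proof (induction n arbitrary: w)
    case 0
    then show ?case using act_one act_mem x by simp
  next
    case (Suc n)
    then show ?case using C x by (simp add: act_mult act_mem xC)
  qed
  \<comment> \<open>\<open>D n\<close> is the conjugate of \<open>y\<close> by the n-th power of
    \<open>x\<close>, hence as close to the identity as \<open>y\<close>.\<close>
  define D where "D = rec_nat y (\<lambda>_ d. x \<otimes> d \<otimes> inv x)"
  have D: "D 0 = y" "\<And>n. D (Suc n) = x \<otimes> D n \<otimes> inv x" by (simp_all add: D_def)
  have Dc: "D n \<in> carrier G" for n using x y by (induction n) (simp_all add: D)
  have Dn: "near (D n) (1/4)" for n
    using y x Dc by (induction n) (simp_all add: D near_conj)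
  have DC: "act (D n) w = act (C [^] n) (act y w)" if "w \<in> W" for w and n :: nat
    using that
  proof (induction n arbitrary: w)
    case 0
    then show ?case using y by (simp add: D act_one act_mem)
  next
    case (Suc n)
    have iw: "act (inv x) w \<in> W" using x Suc by (simp add: act_mem)
    have "act (D (Suc n)) w = act x (act (D n) (act (inv x) w))"
      using x Dc Suc by (simp add: D act_mult act_mem)
    also have "\<dots> = act x (act (C [^] n) (act y (act (inv x) w)))" using Suc iw by simp
    also have "\<dots> = act (C [^] n) (act x (act y (act (inv x) w)))" using iw y by (simp add: xCn act_mem)
    also have "act x (act y (act (inv x) w)) = act (C \<otimes> y) w"
      unfolding C_y using x y Suc by (simp add: act_mult act_mem)
    also have "act (C [^] n) (act (C \<otimes> y) w) = act (C [^] Suc n) (act y w)"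
      using C y Suc by (simp add: act_mult act_mem)
    finally show ?case .
  qed
  fix n :: nat
  \<comment> \<open>The threshold 1/2 of \<open>no_small_subgroups\<close> is what limits
    \<open>y\<close> to radius 1/4.\<close>
  have "near (D n \<otimes> inv y) (1/4 + 1/4)"
    using Dc Dn y near_inv by (intro near_mult) auto
  moreover have "act (D n \<otimes> inv y) w = act (C [^] n) w" if w: "w \<in> W" for w
  proof -
    have "act y (act (inv y) w) = w" using y w act_mult[of y "inv y" w] by (simp add: act_one)
    then show ?thesis using Dc y w by (simp add: act_mult act_mem DC)
  qed
  ultimately show "near (comm x y [^] n) (1/2)" by (simp add: near_def C_def)
qed (use x y in simp)

text \<open>The commutators \<open>[x, [x, ... [x, y]]]\<close> halve their distance to the identity
  at each stage. In a finite group they eventually act trivially, and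
  \<open>comm_trivial_step\<close> carries this back to \<open>[x, y]\<close>.\<close>

lemma near_commute:
  assumes fin: "finite (carrier G)"
    and x: "x \<in> carrier G" "near x (1/4)" and y: "y \<in> carrier G" "near y (1/4)" and w: "w \<in> W"
  shows "act x (act y w) = act y (act x w)"
proof -
  define Y where "Y = rec_nat y (\<lambda>_ z. comm x z)"
  have Y: "Y 0 = y" "\<And>n. Y (Suc n) = comm x (Y n)" by (simp_all add: Y_def)
  have Yc: "Y n \<in> carrier G" for n using x y by (induction n) (simp_all add: Y)
  have Yn: "near (Y n) (1/4 * (1/2) ^ n)" for n
  proof (induction n)
    case (Suc n)
    have "near (comm x (Y n)) (2 * (1/4) * (1/4 * (1/2) ^ n))"
      using x Yc Suc by (intro near_comm) auto
    then show ?case by (simp add: Y)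
  qed (use y Y in simp)
  have Y4: "near (Y n) (1/4)" for n
  proof -
    have "1/4 * (1/2) ^ n * nrm w \<le> 1/4 * nrm w" for w
      using nrm_nonneg[of w] by (intro mult_right_mono) (simp_all add: power_le_one)
    then show ?thesis using Yn[of n] unfolding near_def by (meson order_trans)
  qed
  \<comment> \<open>An element that acts nontrivially moves some vector by a positive amount, so it
    fails to be near at all small radii. Finiteness of the group then gives one exponent for all
    elements.\<close>
  have "\<forall>\<^sub>F n in sequentially. near z (1/4 * (1/2) ^ n) \<longrightarrow> acts_trivially z" if z: "z \<in> carrier G" for z
  proof (cases "acts_trivially z")
    case False
    then obtain w where w: "w \<in> W" "act z w \<noteq> w" by (auto simp: acts_trivially_def)
    then have "nrm (act z w - w) \<noteq> 0" using nrm_eq_0 diff_mem act_mem z by force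
    then have pos: "nrm (act z w - w) > 0" using nrm_nonneg[of "act z w - w"] by simp
    have "(\<lambda>n. 1/4 * (1/2) ^ n * nrm w) \<longlonglongrightarrow> 1/4 * 0 * nrm w"
      by (intro tendsto_mult tendsto_const LIMSEQ_realpow_zero) auto
    then have "\<forall>\<^sub>F n in sequentially. 1/4 * (1/2) ^ n * nrm w < nrm (act z w - w)"
      using pos order_tendstoD(2) by fastforce
    then show ?thesis by eventually_elim (use w in \<open>auto simp: near_def\<close>)
  qed auto
  then have "\<forall>\<^sub>F n in sequentially. \<forall>z\<in>carrier G. near z (1/4 * (1/2) ^ n) \<longrightarrow> acts_trivially z"
    by (intro eventually_ball_finite fin) auto
  then obtain n where "\<forall>k\<ge>n. \<forall>z\<in>carrier G. near z (1/4 * (1/2) ^ k) \<longrightarrow> acts_trivially z"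
    unfolding eventually_sequentially by blast
  then have "acts_trivially (Y (Suc n))" using Yc Yn le_SucI by blast
  \<comment> \<open>Descent along the chain, with \<open>Y n\<close> in the role of
    \<open>y\<close>; this is why every \<open>Y n\<close> was shown to be near with the fixed
    radius 1/4.\<close>
  then have "acts_trivially (Y (Suc 0))"
  proof (induction n)
    case (Suc n)
    then show ?case using comm_trivial_step[OF x(1) Yc Y4, of n] by (simp add: Y)
  qed
  then show ?thesis using comm_trivialD[OF x(1) y(1) _ w] by (simp add: Y)
qed

text \<open>A centraliser argument used twice: \<open>Z y\<close> is a subgroup, so first the
  generated group lies in \<open>Z e\<close> for each generator \<open>e\<close>; by symmetry the
  generators lie in \<open>Z y\<close> for each generated \<open>y\<close>, and hence so does the
  generated group.\<close>

lemma commute_generate: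
  assumes E: "E \<subseteq> carrier G"
    and comm: "\<And>x y w. x \<in> E \<Longrightarrow> y \<in> E \<Longrightarrow> w \<in> W \<Longrightarrow> act x (act y w) = act y (act x w)"
    and x: "x \<in> generate G E" and y: "y \<in> generate G E" and w: "w \<in> W"
  shows "act x (act y w) = act y (act x w)"
proof -
  define Z where "Z = (\<lambda>y. {x \<in> carrier G. \<forall>w\<in>W. act x (act y w) = act y (act x w)})"
  have sub: "subgroup (Z y) G" if y: "y \<in> carrier G" for y
  proof
    show "\<one> \<in> Z y" using y by (simp add: Z_def act_one act_mem)
    show "a \<otimes> b \<in> Z y" if "a \<in> Z y" "b \<in> Z y" for a b
      using that y by (simp add: Z_def act_mult act_mem)
    show "inv a \<in> Z y" if a: "a \<in> Z y" for a
    proof -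
      have "act (inv a) (act y w) = act y (act (inv a) w)" if w: "w \<in> W" for w
      proof -
        define v where "v = act (inv a) w"
        have v: "v \<in> W" "act a v = w"
          using a w act_mult[of a "inv a" w] by (simp_all add: Z_def v_def act_mem act_one)
        have "act (inv a) (act y w) = act (inv a) (act a (act y v))" using a v by (auto simp: Z_def)
        also have "\<dots> = act (inv a \<otimes> a) (act y v)"
          by (rule act_mult[symmetric]) (use a y v act_mem in \<open>auto simp: Z_def\<close>)
        also have "\<dots> = act y v" using a y v by (simp add: Z_def act_one act_mem)
        finally show ?thesis by (simp add: v_def)
      qed
      then show ?thesis using a by (simp add: Z_def)
    qed
  qed (auto simp: Z_def)
  have yc: "y \<in> carrier G" using generate_in_carrier E y by blast
  have "E \<subseteq> Z e" if "e \<in> E" for e using comm that E by (auto simp: Z_def)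
  then have "generate G E \<subseteq> Z e" if "e \<in> E" for e
    using that E sub generate_subgroup_incl by blast
  then have "E \<subseteq> Z y" using E y by (fastforce simp: Z_def)
  then have "generate G E \<subseteq> Z y" using sub[OF yc] generate_subgroup_incl by blast
  then show ?thesis using x w by (auto simp: Z_def)
qed

text \<open>The argument of Frobenius and Bieberbach for Jordan's theorem.\<close>

lemma near_generated_subgroup:
  assumes fin: "finite (carrier G)"
  defines "H \<equiv> generate G {x \<in> carrier G. near x (1/4)}"
  shows "H \<lhd> G" and "\<And>x y w. x \<in> H \<Longrightarrow> y \<in> H \<Longrightarrow> w \<in> W \<Longrightarrow> act x (act y w) = act y (act x w)"
proof -
  show "H \<lhd> G" unfolding H_def
    by (rule normal_generateI) (auto simp: near_conj)
  show "act x (act y w) = act y (act x w)" if "x \<in> H" "y \<in> H" "w \<in> W" for x y w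
    using that unfolding H_def by (intro commute_generate[OF _ near_commute[OF fin]]) auto
qed

end


section \<open>Translations on a finite group\<close>

locale finite_grp = group G for G (structure) +
  assumes finite_carrier: "finite (carrier G)"
begin

text \<open>The left regular representation. The value 0 off the carrier makes
  \<open>shift_mult\<close> an equality of functions, not merely an equality on the carrier.\<close>

definition shift :: "'a \<Rightarrow> ('a \<Rightarrow> complex) \<Rightarrow> 'a \<Rightarrow> complex" where
  "shift x f = (\<lambda>y. if y \<in> carrier G then f (inv x \<otimes> y) else 0)"

lemma bij_betw_translate: "x \<in> carrier G \<Longrightarrow> bij_betw (\<lambda>y. x \<otimes> y) (carrier G) (carrier G)"
  by (rule bij_betwI[where g = "\<lambda>y. inv x \<otimes> y"]) (auto simp: m_assoc[symmetric])

lemma ip_shift_shift: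
  assumes "x \<in> carrier G"
  shows "ip (carrier G) (shift x f) (shift x g) = ip (carrier G) f g"
proof -
  have "ip (carrier G) (shift x f) (shift x g)
      = (\<Sum>y\<in>carrier G. f (inv x \<otimes> y) * cnj (g (inv x \<otimes> y)))"
    unfolding ip_def by (intro sum.cong) (auto simp: shift_def)
  also have "\<dots> = ip (carrier G) f g"
    unfolding ip_def using assms by (intro sum.reindex_bij_betw bij_betw_translate) auto
  finally show ?thesis .
qed

lemma nsq_shift: "x \<in> carrier G \<Longrightarrow> nsq (carrier G) (shift x f) = nsq (carrier G) f"
  using ip_shift_shift[of x f f] unfolding ip_self of_real_eq_iff .

lemma shift_mult:
  assumes "x \<in> carrier G" "y \<in> carrier G"
  shows "shift (x \<otimes> y) f = shift x (shift y f)"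
  using assms by (auto simp: shift_def inv_mult_group m_assoc fun_eq_iff)

lemma shift_one: "(\<And>y. y \<notin> carrier G \<Longrightarrow> f y = 0) \<Longrightarrow> shift \<one> f = f"
  by (auto simp: shift_def fun_eq_iff)

lemma ip_shift_left:
  assumes x: "x \<in> carrier G"
  shows "ip (carrier G) (shift x f) g = ip (carrier G) f (shift (inv x) g)"
proof -
  have "ip (carrier G) (shift x f) g = ip (carrier G) (shift x f) (shift x (shift (inv x) g))"
    using x by (intro ip_cong) (auto simp: shift_def m_assoc[symmetric])
  then show ?thesis using ip_shift_shift[OF x] by simp
qed

lemma shift_lin: "shift x (\<lambda>y. f y + c * g y) = (\<lambda>y. shift x f y + c * shift x g y)"
  by (auto simp: shift_def)

lemma shift_sum: "shift x (\<lambda>y. \<Sum>i\<in>I. c i * f i y) = (\<lambda>y. \<Sum>i\<in>I. c i * shift x (f i) y)"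
  by (auto simp: shift_def)

lemma shift_scale: "shift x (\<lambda>y. c * f y) = (\<lambda>y. c * shift x f y)"
  by (auto simp: shift_def)

lemma shift_cong: "x \<in> carrier G \<Longrightarrow> (\<And>y. y \<in> carrier G \<Longrightarrow> f y = g y) \<Longrightarrow> shift x f = shift x g"
  by (auto simp: shift_def)

text \<open>Translation by \<open>x\<close> permutes the family \<open>l\<close> through \<pi> and
  is unitary, so it commutes with the operator.\<close>

lemma qop_shift:
  assumes x: "x \<in> carrier G" and \<pi>: "bij_betw \<pi> T T"
    and l: "\<And>t y. t \<in> T \<Longrightarrow> y \<in> carrier G \<Longrightarrow> l (\<pi> t) y = shift x (l t) y" and y: "y \<in> carrier G"
  shows "qop (carrier G) T l (shift x f) y = shift x (qop (carrier G) T l f) y"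
proof -
  have "qop (carrier G) T l (shift x f) y
      = (\<Sum>t\<in>T. ip (carrier G) (shift x f) (l (\<pi> t)) * l (\<pi> t) y)"
    unfolding qop_def by (rule sum.reindex_bij_betw[OF \<pi>, symmetric])
  also have "\<dots> = (\<Sum>t\<in>T. ip (carrier G) f (l t) * shift x (l t) y)"
  proof (rule sum.cong[OF refl])
    fix t assume t: "t \<in> T"
    have "ip (carrier G) (shift x f) (l (\<pi> t)) = ip (carrier G) (shift x f) (shift x (l t))"
      by (rule ip_cong) (auto simp: l t)
    then show "ip (carrier G) (shift x f) (l (\<pi> t)) * l (\<pi> t) y = ip (carrier G) f (l t) * shift x (l t) y"
      using l t y ip_shift_shift[OF x] by simp
  qed
  also have "\<dots> = shift x (qop (carrier G) T l f) y" unfolding qop_def shift_sum ..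
  finally show ?thesis .
qed

text \<open>The component of a translated eigenvector orthogonal to the family is an eigenvector for the same
  eigenvalue, which is too large for a nonzero vector orthogonal to the family.\<close>

lemma large_spectrum_invariant:
  assumes \<epsilon>: "\<epsilon> > 0" and e: "orthonormal (carrier G) e r"
    and ev: "\<And>i. i < r \<Longrightarrow> \<exists>\<mu>\<ge>\<epsilon>. \<forall>y\<in>carrier G. qop (carrier G) T l (e i) y = of_real \<mu> * e i y"
    and small: "\<And>v. nsq (carrier G) v > 0 \<Longrightarrow> (\<And>i. i < r \<Longrightarrow> ip (carrier G) v (e i) = 0)
      \<Longrightarrow> qform (carrier G) T l v < \<epsilon> * nsq (carrier G) v"
    and x: "x \<in> carrier G" and \<pi>: "bij_betw \<pi> T T"
    and l: "\<And>t y. t \<in> T \<Longrightarrow> y \<in> carrier G \<Longrightarrow> l (\<pi> t) y = shift x (l t) y"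
    and i: "i < r" and y: "y \<in> carrier G"
  shows "shift x (e i) y = orth_proj (carrier G) e r (shift x (e i)) y"
proof -
  let ?K = "carrier G"
  define s p v where "s = shift x (e i)" and "p = orth_proj ?K e r s" and "v = (\<lambda>y. s y - p y)"
  have v_perp: "ip ?K v (e j) = 0" if "j < r" for j
    using ip_residual[OF e that] by (simp add: v_def p_def)
  have v_perp': "ip ?K (e j) v = 0" if "j < r" for j
    using v_perp[OF that] by (metis cnj_ip complex_cnj_zero)
  obtain \<mu> where \<mu>: "\<mu> \<ge> \<epsilon>" "\<And>y. y \<in> ?K \<Longrightarrow> qop ?K T l (e i) y = of_real \<mu> * e i y"
    using ev[OF i] by blast
  have pv: "ip ?K p v = 0" using ip_orth_proj_perp(1)[OF v_perp] by (simp add: p_def)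
  then have sv: "ip ?K s v = of_real (nsq ?K v)"
    unfolding ip_self[symmetric] by (subst (2) v_def) (simp add: ip_linear)
  have "ip ?K (qop ?K T l s) v = ip ?K (\<lambda>y. of_real \<mu> * s y) v"
  proof (rule ip_cong)
    fix y assume y: "y \<in> ?K"
    then show "qop ?K T l s y = of_real \<mu> * s y"
      unfolding s_def using qop_shift[where l = l and \<pi> = \<pi> and f = "e i", OF x \<pi> l y] \<mu>(2)[of "inv x \<otimes> y"] x by (simp add: shift_def)
  qed auto
  then have 1: "ip ?K (qop ?K T l s) v = of_real (\<mu> * nsq ?K v)" using sv by (simp add: ip_linear)
  have "ip ?K (e j) (qop ?K T l v) = 0" if j: "j < r" for j
  proof -
    obtain \<nu> where "\<And>y. y \<in> ?K \<Longrightarrow> qop ?K T l (e j) y = of_real \<nu> * e j y" using ev[OF j] by blast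
    then have "ip ?K (qop ?K T l (e j)) v = ip ?K (\<lambda>y. of_real \<nu> * e j y) v" by (intro ip_cong) auto
    then show ?thesis using v_perp'[OF j] by (simp add: ip_qop_swap ip_linear)
  qed
  then have 2: "ip ?K (qop ?K T l p) v = 0"
    unfolding ip_qop_swap by (simp add: p_def orth_proj_def ip_linear)
  have "of_real (qform ?K T l v) = ip ?K v (qop ?K T l v)"
    by (simp add: ip_qop_self flip: ip_qop_swap)
  also have "\<dots> = ip ?K s (qop ?K T l v) - ip ?K p (qop ?K T l v)"
    by (subst v_def) (simp add: ip_linear)
  also have "\<dots> = of_real (\<mu> * nsq ?K v)" using 1 2 by (simp add: ip_qop_swap)
  finally have "qform ?K T l v = \<mu> * nsq ?K v" unfolding of_real_eq_iff .
  then have "\<not> nsq ?K v > 0"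
    using small[OF _ v_perp] mult_right_mono[OF \<mu>(1) nsq_nonneg[of ?K v]] by fastforce
  then have "nsq ?K v = 0" using nsq_nonneg[of ?K v] by simp
  then show ?thesis using nsq_eq_0_iff[OF finite_carrier] y by (auto simp: v_def p_def s_def)
qed

end

text \<open>Members vanish off \<open>K\<close>, so norm zero forces equality with the zero
  function, as \<open>isometric_action\<close> demands.\<close>

definition span_on :: "'a set \<Rightarrow> (nat \<Rightarrow> 'a \<Rightarrow> complex) \<Rightarrow> nat \<Rightarrow> ('a \<Rightarrow> complex) set" where
  "span_on K e r = {w. (\<forall>y. y \<notin> K \<longrightarrow> w y = 0) \<and> (\<exists>c. \<forall>y\<in>K. w y = (\<Sum>i<r. c i * e i y))}"

lemma span_on_lin:
  assumes "f \<in> span_on K e r" "g \<in> span_on K e r"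
  shows "(\<lambda>y. f y + c * g y) \<in> span_on K e r"
proof -
  obtain a b where "\<forall>y\<in>K. f y = (\<Sum>i<r. a i * e i y)" "\<forall>y\<in>K. g y = (\<Sum>i<r. b i * e i y)"
    using assms by (auto simp: span_on_def)
  then have "\<forall>y\<in>K. f y + c * g y = (\<Sum>i<r. (a i + c * b i) * e i y)"
    by (simp add: algebra_simps sum.distrib sum_distrib_left)
  then show ?thesis using assms unfolding span_on_def by fastforce
qed

lemma span_on_0: "(\<lambda>_. 0) \<in> span_on K e r"
  by (auto simp: span_on_def intro!: exI[of _ "\<lambda>_. 0"])

lemma span_on_outside: "w \<in> span_on K e r \<Longrightarrow> y \<notin> K \<Longrightarrow> w y = 0"
  by (simp add: span_on_def)

lemma span_on_orth_proj:
  assumes e: "orthonormal K e r" and w: "w \<in> span_on K e r" and y: "y \<in> K"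
  shows "w y = orth_proj K e r w y"
proof -
  obtain c where c: "\<And>y. y \<in> K \<Longrightarrow> w y = (\<Sum>i<r. c i * e i y)" using w by (auto simp: span_on_def)
  have "ip K w (e j) = c j" if j: "j < r" for j
  proof -
    have "ip K w (e j) = ip K (\<lambda>y. \<Sum>i<r. c i * e i y) (e j)" by (rule ip_cong) (auto simp: c)
    also have "\<dots> = (\<Sum>i<r. c i * ip K (e i) (e j))" by (simp add: ip_linear)
    also have "\<dots> = (\<Sum>i<r. if i = j then c j else 0)"
      using e j by (intro sum.cong) (auto simp: orthonormal_def)
    finally show ?thesis using j by simp
  qed
  then show ?thesis using c[OF y] by (simp add: orth_proj_def)
qed

lemma span_on_perp:
  assumes w: "w \<in> span_on K e r" and v: "\<And>i. i < r \<Longrightarrow> ip K v (e i) = 0"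
  shows "ip K v w = 0" "ip K w v = 0"
proof -
  obtain c where c: "\<And>y. y \<in> K \<Longrightarrow> w y = (\<Sum>i<r. c i * e i y)" using w by (auto simp: span_on_def)
  have "ip K v w = ip K v (\<lambda>y. \<Sum>i<r. c i * e i y)" by (rule ip_cong) (auto simp: c)
  also have "\<dots> = 0" using v by (simp add: ip_linear)
  finally show "ip K v w = 0" .
  then show "ip K w v = 0" by (metis cnj_ip complex_cnj_zero)
qed

lemma nsq_span_on:
  assumes e: "orthonormal K e r" and w: "w \<in> span_on K e r"
  shows "nsq K w = (\<Sum>i<r. (cmod (ip K w (e i)))\<^sup>2)"
  using nsq_orth_proj[OF e, of w] nsq_cong[of K w "orth_proj K e r w"] span_on_orth_proj[OF e w] by simp

definition nrm :: "'a set \<Rightarrow> ('a \<Rightarrow> complex) \<Rightarrow> real" where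
  "nrm K f = sqrt (nsq K f)"

lemma nrm_diff_le: "nrm K (u - v) \<le> nrm K u + nrm K v"
proof -
  have L: "nrm K f = L2_set (\<lambda>x. cmod (f x)) K" for f by (simp add: nrm_def nsq_def L2_set_def)
  have "L2_set (\<lambda>x. cmod ((u - v) x)) K \<le> L2_set (\<lambda>x. cmod (u x) + cmod (v x)) K"
    by (intro L2_set_mono) (auto simp: norm_triangle_ineq4)
  also have "\<dots> \<le> L2_set (\<lambda>x. cmod (u x)) K + L2_set (\<lambda>x. cmod (v x)) K" by (rule L2_set_triangle_ineq)
  finally show ?thesis unfolding L .
qed

text \<open>Invariance is stated for the basis and only on the carrier, since the \<open>e i\<close>
  are unconstrained off it; \<open>shift_W\<close> extends it to the span.\<close>

locale invariant_span = finite_grp G for G (structure) +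
  fixes e :: "nat \<Rightarrow> 'a \<Rightarrow> complex" and r :: nat
  assumes orthonormal_e: "orthonormal (carrier G) e r"
    and invariant: "\<And>x i y. x \<in> carrier G \<Longrightarrow> i < r \<Longrightarrow> y \<in> carrier G
      \<Longrightarrow> shift x (e i) y = orth_proj (carrier G) e r (shift x (e i)) y"
begin

abbreviation "W \<equiv> span_on (carrier G) e r"

lemma shift_W:
  assumes x: "x \<in> carrier G" and w: "w \<in> W"
  shows "shift x w \<in> W"
proof -
  obtain c where c: "\<And>y. y \<in> carrier G \<Longrightarrow> w y = (\<Sum>i<r. c i * e i y)" using w by (auto simp: span_on_def)
  let ?d = "\<lambda>i j. ip (carrier G) (shift x (e i)) (e j)"
  have "shift x w y = (\<Sum>j<r. (\<Sum>i<r. c i * ?d i j) * e j y)" if y: "y \<in> carrier G" for y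
  proof -
    have "shift x w = shift x (\<lambda>y. \<Sum>i<r. c i * e i y)" using x c by (intro shift_cong) auto
    then have "shift x w y = (\<Sum>i<r. c i * shift x (e i) y)" by (simp add: shift_sum)
    also have "\<dots> = (\<Sum>i<r. c i * orth_proj (carrier G) e r (shift x (e i)) y)"
      using invariant[OF x _ y] by (intro sum.cong) auto
    also have "\<dots> = (\<Sum>i<r. \<Sum>j<r. c i * ?d i j * e j y)"
      by (simp add: orth_proj_def sum_distrib_left mult.assoc)
    also have "\<dots> = (\<Sum>j<r. \<Sum>i<r. c i * ?d i j * e j y)" by (rule sum.swap)
    finally show ?thesis by (simp add: sum_distrib_right)
  qed
  moreover have "shift x w y = 0" if "y \<notin> carrier G" for y using that by (simp add: shift_def)
  ultimately show ?thesis unfolding span_on_def by auto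
qed

sublocale isometric_action G W shift "nrm (carrier G)"
proof
  show "u - v \<in> W" if "u \<in> W" "v \<in> W" for u v
    using span_on_lin[OF that, of "-1"] by (simp add: fun_diff_def)
  show "shift x w \<in> W" if "x \<in> carrier G" "w \<in> W" for x w using shift_W that .
  show "shift \<one> w = w" if "w \<in> W" for w using shift_one span_on_outside[OF that] by blast
  show "shift (x \<otimes> y) w = shift x (shift y w)" if "x \<in> carrier G" "y \<in> carrier G" for x y w
    using shift_mult that .
  show "shift x (u - v) = shift x u - shift x v" for x u v
    by (auto simp: shift_def fun_eq_iff)
  show "nrm (carrier G) (shift x w) = nrm (carrier G) w" if "x \<in> carrier G" for x w
    using nsq_shift[OF that] by (simp add: nrm_def)
  show "nrm (carrier G) (u - v) \<le> nrm (carrier G) u + nrm (carrier G) v" for u v by (rule nrm_diff_le)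
  show "nrm (carrier G) (u + u) = 2 * nrm (carrier G) u" for u
    using nsq_scale[of "carrier G" 2 u] by (simp add: nrm_def plus_fun_def real_sqrt_mult)
  show "0 \<le> nrm (carrier G) u" for u by (simp add: nrm_def)
  show "u = 0" if "u \<in> W" "nrm (carrier G) u = 0" for u
    using that nsq_eq_0_iff[OF finite_carrier, of u] span_on_outside[OF that(1)]
    by (auto simp: nrm_def fun_eq_iff)
qed

end

section \<open>The index of the subgroup generated near the identity\<close>

lemma abs_diff_le_of_floor_eq:
  fixes a b q :: real
  assumes "\<lfloor>q * a\<rfloor> = \<lfloor>q * b\<rfloor>" "q > 0"
  shows "\<bar>a - b\<bar> \<le> 1 / q"
proof -
  have "\<bar>q * a - q * b\<bar> \<le> 1" using assms by linarith
  moreover have "\<bar>q * a - q * b\<bar> = q * \<bar>a - b\<bar>"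
    using assms by (simp add: abs_mult right_diff_distrib[symmetric])
  ultimately show ?thesis using assms by (simp add: field_simps)
qed

lemma card_image_le_of_factor:
  assumes "finite (g ` A)" and "\<And>x y. x \<in> A \<Longrightarrow> y \<in> A \<Longrightarrow> g x = g y \<Longrightarrow> f x = f y"
  shows "finite (f ` A)" "card (f ` A) \<le> card (g ` A)"
proof -
  have "f x = (f \<circ> inv_into A g) (g x)" if "x \<in> A" for x
    using assms(2)[of x "inv_into A g (g x)"] that by (simp add: inv_into_into f_inv_into_f)
  then have "f ` A = (f \<circ> inv_into A g) ` g ` A" by force
  then show "finite (f ` A)" "card (f ` A) \<le> card (g ` A)"
    using assms(1) card_image_le by (metis finite_imageI)+
qed

context invariant_span
begin

definition coeff :: "'a \<Rightarrow> nat \<Rightarrow> nat \<Rightarrow> complex" where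
  "coeff x i j = ip (carrier G) (shift x (e i)) (e j)"

lemma norm_coeff_le:
  assumes "x \<in> carrier G" "i < r" "j < r"
  shows "cmod (coeff x i j) \<le> 1"
proof -
  have "(cmod (coeff x i j))\<^sup>2 \<le> 1"
    using cauchy_schwarz[of "carrier G" "shift x (e i)" "e j"] orthonormal_nsq[OF orthonormal_e] assms nsq_shift
    by (simp add: coeff_def)
  then show ?thesis by (simp add: abs_square_le_1)
qed

text \<open>Passes from closeness of matrix entries to closeness in operator norm: each of the
  \<open>r\<close> coordinates of the difference is a sum of \<open>r\<close> terms, each at most
  \<open>c\<close> times the norm of \<open>w\<close>.\<close>

lemma nrm_shift_diff_le:
  assumes x: "x \<in> carrier G" and y: "y \<in> carrier G" and w: "w \<in> W" and c: "c \<ge> 0"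
    and close: "\<And>i j. i < r \<Longrightarrow> j < r \<Longrightarrow> cmod (coeff x i j - coeff y i j) \<le> c"
  shows "nrm (carrier G) (shift x w - shift y w) \<le> real r ^ 2 * c * nrm (carrier G) w"
proof -
  let ?K = "carrier G"
  define d where "d = shift x w - shift y w"
  have d: "d \<in> W" unfolding d_def using x y w by (intro diff_mem act_mem)
  define a where "a i = ip ?K w (e i)" for i
  have a: "cmod (a i) \<le> nrm ?K w" if "i < r" for i
  proof -
    have "(cmod (a i))\<^sup>2 \<le> nsq ?K w"
      using cauchy_schwarz[of ?K w "e i"] orthonormal_nsq[OF orthonormal_e that] by (simp add: a_def)
    then show ?thesis unfolding nrm_def by (rule real_le_rsqrt)
  qed
  have shift_e: "ip ?K (shift z w) (e j) = (\<Sum>i<r. a i * coeff z i j)" if z: "z \<in> ?K" for z j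
  proof -
    have "ip ?K (shift z w) (e j) = ip ?K w (shift (inv z) (e j))" by (rule ip_shift_left[OF z])
    also have "\<dots> = ip ?K (orth_proj ?K e r w) (shift (inv z) (e j))"
      using span_on_orth_proj[OF orthonormal_e w] by (intro ip_cong) auto
    also have "\<dots> = (\<Sum>i<r. a i * ip ?K (e i) (shift (inv z) (e j)))"
      by (simp add: orth_proj_def ip_linear a_def)
    finally show ?thesis by (simp add: coeff_def ip_shift_left[OF z])
  qed
  have "cmod (ip ?K d (e j)) \<le> real r * (nrm ?K w * c)" if j: "j < r" for j
  proof -
    have "ip ?K d (e j) = (\<Sum>i<r. a i * (coeff x i j - coeff y i j))"
      using shift_e x y by (simp add: d_def fun_diff_def ip_linear sum_subtractf right_diff_distrib)
    also have "cmod \<dots> \<le> (\<Sum>i<r. nrm ?K w * c)"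
      by (rule sum_norm_le) (use a close j c nrm_nonneg in \<open>auto simp: norm_mult intro!: mult_mono\<close>)
    finally show ?thesis by simp
  qed
  then have "(cmod (ip ?K d (e j)))\<^sup>2 \<le> (real r * (nrm ?K w * c))\<^sup>2" if "j < r" for j
    using that by (intro power_mono) auto
  then have "(\<Sum>j<r. (cmod (ip ?K d (e j)))\<^sup>2) \<le> (\<Sum>j<r. (real r * (nrm ?K w * c))\<^sup>2)"
    by (intro sum_mono) auto
  then have "nsq ?K d \<le> real r * (real r * (nrm ?K w * c))\<^sup>2"
    using nsq_span_on[OF orthonormal_e d] by simp
  \<comment> \<open>Enlarging \<open>r\<close> to its square makes the bound a perfect square and
    avoids a root.\<close>
  also have "\<dots> \<le> real r ^ 2 * (real r * (nrm ?K w * c))\<^sup>2"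
    using le_square[of r] by (intro mult_right_mono) (auto simp: power2_eq_square simp flip: of_nat_mult)
  also have "\<dots> = (real r ^ 2 * c * nrm ?K w)\<^sup>2" by (simp add: power2_eq_square)
  finally show ?thesis
    unfolding d_def[symmetric] using c nrm_nonneg by (subst nrm_def) (auto intro: real_le_lsqrt)
qed

text \<open>Rounding the matrix entries of the action to multiples of \<open>1 / q\<close> separates the cosets.\<close>

lemma index_near_generated_subgroup:
  fixes D :: nat
  assumes D: "r \<le> D"
  defines "H \<equiv> generate G {x \<in> carrier G. near x (1/4)}"
    and "N \<equiv> (2 * (8 * D\<^sup>2 + 1) + 1)\<^sup>2 ^ D\<^sup>2"
  shows "finite (rcosets H)" "card (rcosets H) \<le> N"
proof -
  \<comment> \<open>Entries with equal rounding differ by at most \<open>2 / q\<close>, hence the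
    operators by at most \<open>2 * r^2 / q \<le> 1/4\<close>. The summand 1 keeps \<open>q\<close>
    positive for \<open>D = 0\<close>.\<close>
  define q where "q = 8 * D\<^sup>2 + 1"
  have "q > 0" by (simp add: q_def)
  then have qpos: "real q > 0" by (simp only: of_nat_0_less_iff)
  define Z where "Z = {- int q..int q}"
  define I where "I = {..<r} \<times> {..<r}"
  define key where "key x = (\<lambda>p\<in>I. (\<lfloor>q * Re (coeff x (fst p) (snd p))\<rfloor>, \<lfloor>q * Im (coeff x (fst p) (snd p))\<rfloor>))" for x
  have floor: "\<lfloor>real q * a\<rfloor> \<in> Z" if "\<bar>a\<bar> \<le> 1" for a
  proof -
    have "\<bar>real q * a\<bar> \<le> real q" using that by (simp add: abs_mult mult_left_le)
    then show ?thesis unfolding Z_def by (simp add: le_floor_iff floor_le_iff) linarith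
  qed
  have keyP: "key ` carrier G \<subseteq> PiE I (\<lambda>_. Z \<times> Z)"
    using norm_coeff_le by (fastforce simp: key_def I_def intro!: floor
        intro: order_trans[OF abs_Re_le_cmod] order_trans[OF abs_Im_le_cmod])
  have finP: "finite (PiE I (\<lambda>_. Z \<times> Z))" by (simp add: finite_PiE I_def Z_def)
  have fin: "finite (key ` carrier G)" using keyP finP by (rule finite_subset)
  have "card (key ` carrier G) \<le> card (PiE I (\<lambda>_. Z \<times> Z))" by (rule card_mono[OF finP keyP])
  \<comment> \<open>Entries have modulus at most 1, so the real and the imaginary part each have
    \<open>2 * q + 1\<close> possible roundings, for \<open>r * r\<close> entries.\<close>
  also have "\<dots> = ((2 * q + 1)\<^sup>2) ^ (r * r)"
  proof -
    have "card Z = 2 * q + 1" by (simp add: Z_def)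
    then show ?thesis by (simp add: card_PiE I_def card_cartesian_product power2_eq_square)
  qed
  also have "\<dots> \<le> N" unfolding N_def q_def
    using D by (intro power_increasing) (auto simp: power2_eq_square mult_le_mono)
  finally have card: "card (key ` carrier G) \<le> N" .
  have Hsub: "subgroup H G" unfolding H_def by (rule generate_is_subgroup) auto
  have key_eq: "H #> x = H #> y"
    if x: "x \<in> carrier G" and y: "y \<in> carrier G" and eq: "key x = key y" for x y
  proof -
    have close: "cmod (coeff x i j - coeff y i j) \<le> 2 / q" if ij: "i < r" "j < r" for i j
    proof -
      have "key x (i, j) = key y (i, j)" using eq by simp
      then have "\<lfloor>q * Re (coeff x i j)\<rfloor> = \<lfloor>q * Re (coeff y i j)\<rfloor>"
        "\<lfloor>q * Im (coeff x i j)\<rfloor> = \<lfloor>q * Im (coeff y i j)\<rfloor>"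
        using ij by (simp_all add: key_def I_def)
      then have "\<bar>Re (coeff x i j) - Re (coeff y i j)\<bar> \<le> 1 / q" "\<bar>Im (coeff x i j) - Im (coeff y i j)\<bar> \<le> 1 / q"
        by (auto intro!: abs_diff_le_of_floor_eq qpos)
      then show ?thesis using cmod_le[of "coeff x i j - coeff y i j"] by simp
    qed
    have "real r ^ 2 * (2 / q) \<le> 1 / 4"
    proof -
      have "real r ^ 2 \<le> real D ^ 2" using D by (intro power_mono) auto
      moreover have "real q = 8 * real D ^ 2 + 1" by (simp add: q_def)
      ultimately have "8 * real r ^ 2 \<le> real q" by linarith
      then show ?thesis using qpos by (simp add: field_simps)
    qed
    then have small: "real r ^ 2 * (2 / q) * nrm (carrier G) w \<le> 1 / 4 * nrm (carrier G) w" for w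
      using nrm_nonneg by (intro mult_right_mono)
    have "near (x \<otimes> inv y) (1/4)" unfolding near_def
    proof
      fix w assume w: "w \<in> W"
      define v where "v = shift (inv y) w"
      have v: "v \<in> W" "nrm (carrier G) v = nrm (carrier G) w" using y w by (simp_all add: v_def act_mem nrm_act)
      have "shift y v = w" using act_mult[of y "inv y" w] y w act_one by (simp add: v_def)
      then have "shift (x \<otimes> inv y) w - w = shift x v - shift y v"
        using x y w by (simp add: act_mult v_def)
      then have "nrm (carrier G) (shift (x \<otimes> inv y) w - w) \<le> real r ^ 2 * (2 / q) * nrm (carrier G) v"
        using nrm_shift_diff_le[OF x y v(1) _ close] by simp
      then show "nrm (carrier G) (shift (x \<otimes> inv y) w - w) \<le> 1/4 * nrm (carrier G) w"
        using small[of v] v by simp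
    qed
    then have "x \<otimes> inv y \<in> H" unfolding H_def using x y by (intro generate.incl) simp
    then have "x \<in> H #> y" using subgroup.rcos_module_rev[OF Hsub is_group] x y by simp
    then show ?thesis using repr_independence[OF _ _ Hsub] y by simp
  qed
  have eq: "rcosets H = (\<lambda>x. H #> x) ` carrier G" by (auto simp: RCOSETS_def)
  show "finite (rcosets H)"
    unfolding eq by (rule card_image_le_of_factor(1)[where f = "\<lambda>x. H #> x", OF fin key_eq])
  show "card (rcosets H) \<le> N"
    unfolding eq
    by (rule order_trans[OF card_image_le_of_factor(2)[where f = "\<lambda>x. H #> x", OF fin key_eq] card])
qed

end


section \<open>Simultaneous diagonalisation\<close>

text \<open>A geometric sum expressing orthogonality of the characters of a cyclic group; it
  recovers a vector from its components under the powers of one group element.\<close>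

lemma sum_cis_root_of_unity:
  fixes N j :: nat
  assumes "j < N"
  shows "(\<Sum>k<N. cis (2 * pi * k / N) ^ j) = (if j = 0 then of_nat N else 0)"
proof (cases "j = 0")
  case False
  define z where "z = cis (2 * pi * j / N)"
  have "(\<Sum>k<N. cis (2 * pi * k / N) ^ j) = (\<Sum>k<N. z ^ k)"
    by (intro sum.cong refl) (simp add: z_def Complex.DeMoivre mult_ac)
  moreover have "z ^ N = 1"
  proof -
    have "z ^ N = cis (2 * pi * real j)" using assms by (simp add: z_def Complex.DeMoivre)
    also have "\<dots> = 1" by (rule cis_multiple_2pi) simp
    finally show ?thesis .
  qed
  moreover have "z \<noteq> 1"
  proof
    assume "z = 1"
    then have "cos (2 * pi * j / N) = 1" by (simp add: z_def complex_eq_iff)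
    then obtain n :: int where "2 * pi * j / N = real_of_int n * (2 * pi)"
      by (auto simp: cos_one_2pi_int)
    then have "real j = real_of_int n * real N" using assms by (simp add: field_simps)
    then have "int j = n * int N" by (metis of_int_eq_iff of_int_mult of_int_of_nat_eq)
    then have "int N dvd int j" by simp
    then show False using assms False by (auto dest: dvd_imp_le)
  qed
  ultimately show ?thesis using geometric_sum[of z N] False by simp
qed simp

definition csubspace :: "('a \<Rightarrow> complex) set \<Rightarrow> bool" where
  "csubspace U \<longleftrightarrow> (\<lambda>_. 0) \<in> U \<and> (\<forall>f\<in>U. \<forall>g\<in>U. \<forall>c. (\<lambda>y. f y + c * g y) \<in> U)"

lemma csubspace_sum:
  assumes "csubspace U" "finite I" "\<And>i. i \<in> I \<Longrightarrow> f i \<in> U"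
  shows "(\<lambda>y. \<Sum>i\<in>I. c i * f i y) \<in> U"
  using assms(2,3)
proof (induction I rule: finite_induct)
  case empty
  then show ?case using assms(1) by (simp add: csubspace_def)
next
  case (insert i I)
  then have "(\<lambda>y. (\<Sum>i\<in>I. c i * f i y) + c i * f i y) \<in> U"
    using assms(1) by (simp add: csubspace_def)
  then show ?case using insert(1,2) by (simp add: add.commute)
qed

context finite_grp
begin

text \<open>Induction on \<open>X\<close>. An eigenvector \<open>u\<close> for the old elements is
  split into eigenvectors of the new \<open>x\<close> by averaging over the powers of
  \<open>x\<close> against roots of unity. Some component is nonzero, and all remain eigenvectors of
  the old elements by commutation.\<close>

lemma common_eigenvector:
  assumes U: "csubspace U" "\<And>u y. u \<in> U \<Longrightarrow> y \<notin> carrier G \<Longrightarrow> u y = 0"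
    and X: "finite X" "X \<subseteq> carrier G"
    and inv: "\<And>x u. x \<in> X \<Longrightarrow> u \<in> U \<Longrightarrow> shift x u \<in> U"
    and comm: "\<And>x y u. x \<in> X \<Longrightarrow> y \<in> X \<Longrightarrow> u \<in> U \<Longrightarrow> shift x (shift y u) = shift y (shift x u)"
    and ex: "\<exists>u\<in>U. u \<noteq> (\<lambda>_. 0)"
  shows "\<exists>u\<in>U. u \<noteq> (\<lambda>_. 0) \<and> (\<forall>x\<in>X. \<exists>c. shift x u = (\<lambda>y. c * u y))"
  using X inv comm
proof (induction X rule: finite_induct)
  case empty
  then show ?case using ex by simp
next
  case (insert x X)
  have "\<exists>u\<in>U. u \<noteq> (\<lambda>_. 0) \<and> (\<forall>x\<in>X. \<exists>c. shift x u = (\<lambda>y. c * u y))"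
    by (rule insert.IH) (simp_all add: insert.prems[simplified])
  then obtain u where u: "u \<in> U" "u \<noteq> (\<lambda>_. 0)" "\<And>z. z \<in> X \<Longrightarrow> \<exists>c. shift z u = (\<lambda>y. c * u y)"
    by blast
  have x: "x \<in> carrier G" using insert by simp
  define N where "N = order G"
  have N: "N > 0" using finite_carrier by (simp add: N_def order_gt_0_iff_finite)
  define s where "s j = shift (x [^] j) u" for j :: nat
  have s0: "s 0 = u" using shift_one U(2)[OF u(1)] by (simp add: s_def)
  have s_Suc: "shift x (s j) = s (Suc j)" for j
    unfolding s_def nat_pow_Suc2[OF x] by (rule shift_mult[OF x nat_pow_closed[OF x], symmetric])
  have sN: "s N = u"
    unfolding s_def N_def pow_order_eq_1[OF x] using shift_one U(2)[OF u(1)] by blast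
  have sU: "s j \<in> U" for j
  proof (induction j)
    case (Suc j)
    then show ?case using insert.prems(2)[of x "s j"] s_Suc by simp
  qed (use s0 u in simp)
  \<comment> \<open>\<open>P k\<close> is \<open>N\<close> times the component of \<open>u\<close>
    in the eigenspace of \<open>x\<close> for the eigenvalue \<open>inverse z\<close>, with
    \<open>z\<close> as below.\<close>
  define P where "P k = (\<lambda>y. \<Sum>j<N. cis (2 * pi * k / N) ^ j * s j y)" for k :: nat
  have PU: "P k \<in> U" for k unfolding P_def by (intro csubspace_sum U sU) auto
  have sumP: "(\<Sum>k<N. P k y) = of_nat N * u y" for y
  proof -
    have "(\<Sum>k<N. P k y) = (\<Sum>j<N. \<Sum>k<N. cis (2 * pi * k / N) ^ j * s j y)"
      unfolding P_def by (rule sum.swap)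
    also have "\<dots> = (\<Sum>j<N. if j = 0 then of_nat N * s j y else 0)"
      by (intro sum.cong) (auto simp: sum_distrib_right[symmetric] sum_cis_root_of_unity)
    also have "\<dots> = of_nat N * u y" using N s0 by (simp add: sum.delta)
    finally show ?thesis .
  qed
  obtain k where k: "P k \<noteq> (\<lambda>_. 0)"
  proof (rule ccontr)
    assume "\<not> thesis"
    then have "P k = (\<lambda>_. 0)" for k using that by blast
    then have "of_nat N * u y = 0" for y using sumP[of y] by simp
    then show False using u(2) N by auto
  qed
  define z where "z = cis (2 * pi * k / N)"
  have zN: "z ^ N = 1"
  proof -
    have "z ^ N = cis (2 * pi * real k)" using N by (simp add: z_def Complex.DeMoivre)
    also have "\<dots> = 1" by (rule cis_multiple_2pi) simp
    finally show ?thesis .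
  qed
  have z0: "z \<noteq> 0" by (simp add: z_def)
  have "shift x (P k) = (\<lambda>y. inverse z * P k y)"
  proof
    fix y
    have "shift x (P k) y = (\<Sum>j<N. z ^ j * s (Suc j) y)"
      by (simp only: P_def shift_sum s_Suc z_def)
    then have "z * shift x (P k) y = (\<Sum>j<N. z ^ Suc j * s (Suc j) y)"
      by (simp add: sum_distrib_left mult_ac)
    \<comment> \<open>The shifted sum loses the term \<open>j = 0\<close> and gains
      \<open>j = N\<close>; these agree because \<open>z ^ N = 1\<close> and
      \<open>s N = u\<close>.\<close>
    also have "\<dots> = (\<Sum>j<Suc N. z ^ j * s j y) - u y"
      by (subst sum.lessThan_Suc_shift) (simp add: s0)
    also have "\<dots> = P k y" unfolding P_def z_def[symmetric] by (simp add: zN sN)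
    finally show "shift x (P k) y = inverse z * P k y" using z0 by (simp add: field_simps)
  qed
  moreover have "\<exists>c. shift t (P k) = (\<lambda>y. c * P k y)" if t: "t \<in> X" for t
  proof -
    obtain c where c: "shift t u = (\<lambda>y. c * u y)" using u(3)[OF t] by blast
    have "shift t (s j) = (\<lambda>y. c * s j y)" for j
    proof (induction j)
      case 0
      then show ?case using c s0 by simp
    next
      case (Suc j)
      have "shift t (s (Suc j)) = shift x (shift t (s j))"
        using insert.prems(3)[of t x "s j"] t sU s_Suc by simp
      then show ?case using Suc s_Suc by (simp add: shift_scale)
    qed
    then have "shift t (P k) = (\<lambda>y. c * P k y)"
      unfolding P_def shift_sum by (simp add: sum_distrib_left mult_ac)
    then show ?thesis by blast
  qed
  ultimately show ?case using PU k by blast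
qed

end

text \<open>A dimension count by double summation: the squared coefficients add up to
  \<open>s\<close> when grouped by \<open>k\<close>, and by Bessel to at most \<open>r\<close> when
  grouped by \<open>i\<close>.\<close>

lemma orthonormal_span_on_card_le:
  assumes e: "orthonormal K e r" and u: "orthonormal K u s" "\<And>k. k < s \<Longrightarrow> u k \<in> span_on K e r"
  shows "s \<le> r"
proof -
  have "real s = (\<Sum>k<s. nsq K (u k))" using orthonormal_nsq[OF u(1)] by simp
  also have "\<dots> = (\<Sum>k<s. \<Sum>i<r. (cmod (ip K (u k) (e i)))\<^sup>2)"
    using nsq_span_on[OF e u(2)] by simp
  also have "\<dots> = (\<Sum>i<r. \<Sum>k<s. (cmod (ip K (e i) (u k)))\<^sup>2)"
    by (subst sum.swap) (intro sum.cong refl, metis cmod_ip_swap)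
  also have "\<dots> \<le> (\<Sum>i<r. nsq K (e i))" by (intro sum_mono bessel[OF u(1)])
  also have "\<dots> = real r" using orthonormal_nsq[OF e] by simp
  finally show ?thesis by simp
qed

context invariant_span
begin

text \<open>Take a maximal orthonormal family of joint eigenvectors. Its orthogonal complement in
  \<open>W\<close> is invariant, because the adjoint of translation by \<open>h\<close> is
  translation by the inverse of \<open>h\<close>. If the complement were nonzero,
  \<open>common_eigenvector\<close> would extend the family.\<close>

lemma simultaneous_diagonalisation:
  assumes H: "subgroup H G"
    and comm: "\<And>x y w. x \<in> H \<Longrightarrow> y \<in> H \<Longrightarrow> w \<in> W \<Longrightarrow> shift x (shift y w) = shift y (shift x w)"
  obtains u s where "orthonormal (carrier G) u s" "s \<le> r" "\<And>k. k < s \<Longrightarrow> u k \<in> W"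
    "\<And>k h. k < s \<Longrightarrow> h \<in> H \<Longrightarrow> \<exists>c. shift h (u k) = (\<lambda>y. c * u k y)"
    "\<And>w y. w \<in> W \<Longrightarrow> y \<in> carrier G \<Longrightarrow> w y = orth_proj (carrier G) u s w y"
proof -
  let ?K = "carrier G"
  define P where "P v \<longleftrightarrow> v \<in> W \<and> (\<forall>h\<in>H. \<exists>c. shift h v = (\<lambda>y. c * v y))" for v
  have HG: "h \<in> H \<Longrightarrow> h \<in> ?K" for h using subgroup.mem_carrier[OF H] .
  obtain u s where u: "orthonormal ?K u s" "\<And>k. k < s \<Longrightarrow> P (u k)"
    "\<And>v. P v \<Longrightarrow> nsq ?K v = 1 \<Longrightarrow> \<exists>k<s. ip ?K v (u k) \<noteq> 0"
  proof (rule maximal_orthonormal[of ?K P r])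
    fix u s assume "orthonormal ?K u s" "\<And>k. k < s \<Longrightarrow> P (u k)"
    then show "s \<le> r" by (intro orthonormal_span_on_card_le[OF orthonormal_e]) (auto simp: P_def)
  next
    fix u s
    assume "orthonormal ?K u s" "\<And>k. k < s \<Longrightarrow> P (u k)"
      "\<And>v. P v \<Longrightarrow> nsq ?K v = 1 \<Longrightarrow> \<exists>k<s. ip ?K v (u k) \<noteq> 0"
    then show thesis by (rule that)
  qed
  have uW: "u k \<in> W" if "k < s" for k using u(2)[OF that] by (simp add: P_def)
  have "w y = orth_proj ?K u s w y" if w: "w \<in> W" and y: "y \<in> ?K" for w y
  proof (rule ccontr)
    assume ne: "w y \<noteq> orth_proj ?K u s w y"
    define v where "v = (\<lambda>y. w y + (-1) * orth_proj ?K u s w y)"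
    define U where "U = {v \<in> W. \<forall>k<s. ip ?K v (u k) = 0}"
    have csubspaceW: "csubspace W" using span_on_lin span_on_0 by (auto simp: csubspace_def)
    have "csubspace U" unfolding csubspace_def U_def
      by (auto simp: ip_linear ip_zero intro: span_on_lin span_on_0)
    moreover have "v \<in> U"
    proof -
      have "orth_proj ?K u s w \<in> W" unfolding orth_proj_def by (intro csubspace_sum csubspaceW uW) auto
      then have "v \<in> W" unfolding v_def by (rule span_on_lin[OF w])
      moreover have "ip ?K v (u k) = 0" if "k < s" for k
        using ip_residual[OF u(1) that, of w] by (simp add: v_def)
      ultimately show ?thesis by (simp add: U_def)
    qed
    moreover have "v \<noteq> (\<lambda>_. 0)" using ne by (auto simp: v_def fun_eq_iff)
    moreover have "shift h f \<in> U" if h: "h \<in> H" and f: "f \<in> U" for h f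
    proof -
      have "ip ?K (shift h f) (u k) = 0" if k: "k < s" for k
      proof -
        have "inv h \<in> H" using H h by (rule subgroup.m_inv_closed)
        then obtain c where "shift (inv h) (u k) = (\<lambda>y. c * u k y)" using u(2)[OF k] by (auto simp: P_def)
        then show ?thesis using f k h HG by (simp add: ip_shift_left ip_linear U_def)
      qed
      then show ?thesis using f h HG shift_W by (simp add: U_def)
    qed
    moreover have "finite H" using HG finite_carrier by (meson finite_subset subsetI)
    ultimately have "\<exists>f\<in>U. f \<noteq> (\<lambda>_. 0) \<and> (\<forall>x\<in>H. \<exists>c. shift x f = (\<lambda>y. c * f y))"
      using HG comm span_on_outside by (intro common_eigenvector) (auto simp: U_def)
    then obtain f where f: "f \<in> U" "f \<noteq> (\<lambda>_. 0)" "P f" by (auto simp: P_def U_def)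
    have "nsq ?K f \<noteq> 0"
      using nsq_eq_0_iff[OF finite_carrier, of f] f span_on_outside by (fastforce simp: U_def)
    then have pos: "nsq ?K f > 0" by (metis less_le nsq_nonneg)
    define g where "g = (\<lambda>y. of_real (1 / sqrt (nsq ?K f)) * f y)"
    have "nsq ?K g = 1" unfolding g_def by (rule nsq_normalise[OF pos])
    moreover have "P g"
    proof -
      have "(\<lambda>y. 0 + of_real (1 / sqrt (nsq ?K f)) * f y) \<in> W"
        using f(1) by (intro span_on_lin span_on_0) (simp add: U_def)
      then have "g \<in> W" by (simp add: g_def)
      moreover have "\<exists>c. shift h g = (\<lambda>y. c * g y)" if h: "h \<in> H" for h
      proof -
        obtain c where "shift h f = (\<lambda>y. c * f y)" using f(3) h unfolding P_def by blast
        then have "shift h g = (\<lambda>y. c * g y)" unfolding g_def shift_scale by (simp add: mult_ac)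
        then show ?thesis ..
      qed
      ultimately show ?thesis by (simp add: P_def)
    qed
    ultimately obtain k where "k < s" "ip ?K g (u k) \<noteq> 0" using u(3) by blast
    then show False using f(1) by (simp only: g_def ip_linear) (simp add: U_def)
  qed
  moreover have "s \<le> r" using orthonormal_span_on_card_le[OF orthonormal_e u(1) uW] .
  ultimately show ?thesis using that[OF u(1)] uW u(2) by (auto simp: P_def)
qed

text \<open>\<phi> \<open>k\<close> is the eigenvalue on the k-th joint eigenvector. In that basis
  the correlation of \<open>w\<close> with its translate by \<open>h\<close> is the sum of \<phi>
  \<open>k h\<close> weighted by the squared coefficients of \<open>w\<close>.\<close>

lemma characters:
  assumes H: "subgroup H G"
    and comm: "\<And>x y w. x \<in> H \<Longrightarrow> y \<in> H \<Longrightarrow> w \<in> W \<Longrightarrow> shift x (shift y w) = shift y (shift x w)"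
  obtains \<phi> :: "nat \<Rightarrow> 'a \<Rightarrow> complex" and s where "s \<le> r"
    "\<And>k h. k < s \<Longrightarrow> h \<in> H \<Longrightarrow> cmod (\<phi> k h) = 1"
    "\<And>k h h'. k < s \<Longrightarrow> h \<in> H \<Longrightarrow> h' \<in> H \<Longrightarrow> \<phi> k (h \<otimes> h') = \<phi> k h * \<phi> k h'"
    "\<And>h w. h \<in> H \<Longrightarrow> (\<And>k. k < s \<Longrightarrow> Re (\<phi> k h) \<ge> 1/2) \<Longrightarrow> w \<in> W
      \<Longrightarrow> Re (ip (carrier G) (shift h w) w) \<ge> 1/2 * nsq (carrier G) w"
proof -
  let ?K = "carrier G"
  obtain u s where u: "orthonormal ?K u s" "s \<le> r" "\<And>k. k < s \<Longrightarrow> u k \<in> W"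
    "\<And>k h. k < s \<Longrightarrow> h \<in> H \<Longrightarrow> \<exists>c. shift h (u k) = (\<lambda>y. c * u k y)"
    "\<And>w y. w \<in> W \<Longrightarrow> y \<in> ?K \<Longrightarrow> w y = orth_proj ?K u s w y"
    by (rule simultaneous_diagonalisation[OF H comm]) auto
  have HG: "h \<in> H \<Longrightarrow> h \<in> ?K" for h using subgroup.mem_carrier[OF H] .
  obtain \<phi> where \<phi>: "\<And>k h. k < s \<Longrightarrow> h \<in> H \<Longrightarrow> shift h (u k) = (\<lambda>y. \<phi> k h * u k y)"
    using u(4) by metis
  have inj: "a = b" if "k < s" "(\<lambda>y. a * u k y) = (\<lambda>y. b * u k y)" for k a b
  proof -
    have "ip ?K (\<lambda>y. a * u k y) (u k) = ip ?K (\<lambda>y. b * u k y) (u k)" using that by simp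
    then show ?thesis using u(1) that(1) by (simp add: ip_linear orthonormal_def)
  qed
  have "cmod (\<phi> k h) = 1" if k: "k < s" and h: "h \<in> H" for k h
  proof -
    have "(cmod (\<phi> k h))\<^sup>2 = 1"
      using nsq_shift[OF HG[OF h], of "u k"] orthonormal_nsq[OF u(1) k] by (simp add: \<phi>[OF k h] nsq_scale)
    then show ?thesis by (simp add: power2_eq_1_iff) (metis norm_ge_zero not_one_le_zero neg_0_le_iff_le)
  qed
  moreover have "\<phi> k (h \<otimes> h') = \<phi> k h * \<phi> k h'" if k: "k < s" and h: "h \<in> H" "h' \<in> H" for k h h'
  proof (rule inj[OF k])
    have "h \<otimes> h' \<in> H" using H h by (rule subgroup.m_closed)
    then have "(\<lambda>y. \<phi> k (h \<otimes> h') * u k y) = shift h (shift h' (u k))"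
      using \<phi>[OF k] shift_mult[OF HG HG] h by metis
    also have "\<dots> = (\<lambda>y. \<phi> k h * \<phi> k h' * u k y)"
      using \<phi>[OF k] h by (simp add: shift_scale mult_ac)
    finally show "(\<lambda>y. \<phi> k (h \<otimes> h') * u k y) = (\<lambda>y. \<phi> k h * \<phi> k h' * u k y)" .
  qed
  moreover have "Re (ip ?K (shift h w) w) \<ge> 1/2 * nsq ?K w"
    if h: "h \<in> H" and re: "\<And>k. k < s \<Longrightarrow> Re (\<phi> k h) \<ge> 1/2" and w: "w \<in> W" for h w
  proof -
    define a where "a k = ip ?K w (u k)" for k
    have eq: "w y = (\<Sum>k<s. a k * u k y)" if "y \<in> ?K" for y
      using u(5)[OF w that] by (simp add: orth_proj_def a_def)
    have "shift h w = shift h (\<lambda>y. \<Sum>k<s. a k * u k y)"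
      using HG[OF h] eq by (intro shift_cong) auto
    also have "\<dots> = (\<lambda>y. \<Sum>k<s. a k * \<phi> k h * u k y)"
      by (simp add: shift_sum \<phi>[OF _ h] mult.assoc)
    finally have "ip ?K (shift h w) w = (\<Sum>k<s. a k * \<phi> k h * ip ?K (u k) w)" by (simp add: ip_linear)
    also have "\<dots> = (\<Sum>k<s. \<phi> k h * of_real ((cmod (a k))\<^sup>2))"
      by (intro sum.cong refl) (simp add: a_def complex_norm_square cnj_ip mult_ac del: of_real_power)
    finally have "Re (ip ?K (shift h w) w) = (\<Sum>k<s. Re (\<phi> k h) * (cmod (a k))\<^sup>2)" by simp
    also have "\<dots> \<ge> (\<Sum>k<s. 1/2 * (cmod (a k))\<^sup>2)"
      using re by (intro sum_mono mult_right_mono) auto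
    also have "(\<Sum>k<s. 1/2 * (cmod (a k))\<^sup>2) = 1/2 * nsq ?K (orth_proj ?K u s w)"
      unfolding nsq_orth_proj[OF u(1)] a_def sum_distrib_left ..
    also have "nsq ?K (orth_proj ?K u s w) = nsq ?K w" using u(5)[OF w] by (intro nsq_cong) auto
    finally show ?thesis .
  qed
  ultimately show ?thesis using that u(2) by blast
qed

end


section \<open>Characters and the torus\<close>

text \<open>The inverse of the isomorphism from \<open>\<real>/\<int>\<close> to the unit circle:
  for \<open>z\<close> of modulus 1 it is a coset of the integers, and \<open>circ 1\<close> is
  \<open>\<int>\<close>.\<close>

definition circ :: "complex \<Rightarrow> real set" where
  "circ z = {t. cis (2 * pi * t) = z}"

lemma cis_2pi_eq_1_iff: "cis (2 * pi * t) = 1 \<longleftrightarrow> t \<in> \<int>"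
proof
  assume "cis (2 * pi * t) = 1"
  then have "cos (2 * pi * t) = 1" by (simp add: complex_eq_iff)
  then obtain n :: int where "2 * pi * t = real_of_int n * (2 * pi)" by (auto simp: cos_one_2pi_int)
  then have "t = real_of_int n" by simp
  then show "t \<in> \<int>" by simp
qed simp

lemma cis_2pi_eq_iff: "cis (2 * pi * s) = cis (2 * pi * t) \<longleftrightarrow> s - t \<in> \<int>"
proof -
  have "cis (2 * pi * (s - t)) = cis (2 * pi * s) / cis (2 * pi * t)"
    by (simp add: cis_divide right_diff_distrib)
  then show ?thesis unfolding cis_2pi_eq_1_iff[symmetric] by simp
qed

lemma circ_nonempty:
  assumes "cmod z = 1"
  shows "circ z \<noteq> {}"
proof -
  have "z \<noteq> 0" using assms by auto
  then have "cis (2 * pi * (Arg z / (2 * pi))) = z" using cis_Arg[of z] assms by (simp add: sgn_eq)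
  then have "Arg z / (2 * pi) \<in> circ z" unfolding circ_def by (rule CollectI)
  then show ?thesis by blast
qed

lemma circ_eq_coset:
  assumes "t \<in> circ z"
  shows "circ z = \<int> #>\<^bsub>real_group\<^esub> t"
proof -
  have "s \<in> circ z \<longleftrightarrow> s - t \<in> \<int>" for s
    using assms by (simp add: circ_def flip: cis_2pi_eq_iff)
  then show ?thesis
    by (force simp: r_coset_def real_group_def algebra_simps)
qed

lemma circ_in_carrier:
  assumes "cmod z = 1"
  shows "circ z \<in> carrier circle_group"
proof -
  obtain t where "t \<in> circ z" using circ_nonempty[OF assms] by auto
  moreover have "t \<in> carrier real_group" by (simp add: real_group_def)
  ultimately show ?thesis
    unfolding circle_group_def carrier_FactGroup using circ_eq_coset by blast
qed

lemma circ_mult: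
  assumes "cmod z = 1" "cmod w = 1"
  shows "circ (z * w) = circ z \<otimes>\<^bsub>circle_group\<^esub> circ w"
proof -
  obtain t where t: "t \<in> circ w" using circ_nonempty[OF assms(2)] by auto
  have "s - t \<in> circ z" if "s \<in> circ (z * w)" for s
  proof -
    have "cis (2 * pi * (s - t)) = cis (2 * pi * s) / cis (2 * pi * t)"
      by (simp add: cis_divide right_diff_distrib)
    then show ?thesis using that t assms by (auto simp: circ_def)
  qed
  then have "\<exists>a\<in>circ z. \<exists>b\<in>circ w. s = a + b" if "s \<in> circ (z * w)" for s
    using that t by (metis diff_add_cancel)
  moreover have "a + b \<in> circ (z * w)" if "a \<in> circ z" "b \<in> circ w" for a b
    using that by (auto simp: circ_def distrib_left simp flip: cis_mult)
  ultimately show ?thesis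
    by (auto simp: circle_group_def set_mult_def real_group_def)
qed

text \<open>Distance below 1/6 on a circle of length 1 is an angle below \<open>pi / 3\<close>,
  where the cosine is at least 1/2. This fixes the Bohr radius.\<close>

lemma Re_ge_half_of_setdist:
  assumes "cmod z = 1" "setdist \<int> (circ z) < 1/6"
  shows "Re z \<ge> 1/2"
proof -
  obtain a b where ab: "a \<in> \<int>" "b \<in> circ z" "dist a b < 1/6"
    by (rule setdist_ltE[OF assms(2)]) (use circ_nonempty[OF assms(1)] Ints_0 in auto)
  define t where "t = b - a"
  have "cis (2 * pi * t) = cis (2 * pi * b)"
    using ab(1) by (simp add: cis_2pi_eq_iff t_def)
  then have z: "z = cis (2 * pi * t)" using ab by (simp add: circ_def)
  have "\<bar>t\<bar> \<le> 1/6" using ab by (simp add: t_def dist_real_def abs_minus_commute)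
  then have "2 * pi * \<bar>t\<bar> \<le> 2 * pi * (1/6)" by (intro mult_left_mono) auto
  then have "cos (pi / 3) \<le> cos (2 * pi * \<bar>t\<bar>)"
    by (intro cos_monotone_0_pi_le) auto
  also have "cos (2 * pi * \<bar>t\<bar>) = cos (2 * pi * t)" by (simp add: abs_if)
  finally show ?thesis by (simp add: z cos_60)
qed

context invariant_span
begin

lemma bohr_nbhd_of_commuting:
  assumes H: "subgroup H G"
    and comm: "\<And>x y w. x \<in> H \<Longrightarrow> y \<in> H \<Longrightarrow> w \<in> W \<Longrightarrow> shift x (shift y w) = shift y (shift x w)"
  obtains B where "bohr_nbhd (1/6) (Suc r) (G\<lparr>carrier := H\<rparr>) B"
    "\<And>x. x \<in> B \<Longrightarrow> x \<in> H"
    "\<And>x w. x \<in> B \<Longrightarrow> w \<in> W \<Longrightarrow> Re (ip (carrier G) (shift x w) w) \<ge> 1/2 * nsq (carrier G) w"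
proof -
  obtain \<phi> :: "nat \<Rightarrow> 'a \<Rightarrow> complex" and s where \<phi>: "s \<le> r"
    "\<And>k h. k < s \<Longrightarrow> h \<in> H \<Longrightarrow> cmod (\<phi> k h) = 1"
    "\<And>k h h'. k < s \<Longrightarrow> h \<in> H \<Longrightarrow> h' \<in> H \<Longrightarrow> \<phi> k (h \<otimes> h') = \<phi> k h * \<phi> k h'"
    "\<And>h w. h \<in> H \<Longrightarrow> (\<And>k. k < s \<Longrightarrow> Re (\<phi> k h) \<ge> 1/2) \<Longrightarrow> w \<in> W
      \<Longrightarrow> Re (ip (carrier G) (shift h w) w) \<ge> 1/2 * nsq (carrier G) w"
    by (rule characters[OF H comm]) auto
  \<comment> \<open>There may be fewer than \<open>Suc r\<close> characters, even none. Trivial ones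
    fill up the remaining coordinates, so the dimension is positive and the maximum in
    \<open>torus_dist\<close> is over a nonempty set.\<close>
  define \<psi> where "\<psi> k h = (if k < s then \<phi> k h else 1)" for k h
  have \<psi>1: "cmod (\<psi> k h) = 1" if "h \<in> H" for k h using \<phi>(2) that by (simp add: \<psi>_def)
  have \<psi>m: "\<psi> k (h \<otimes> h') = \<psi> k h * \<psi> k h'" if "h \<in> H" "h' \<in> H" for k h h'
    using \<phi>(3) that by (simp add: \<psi>_def)
  define n where "n = Suc r"
  define \<tau> where "\<tau> h = (\<lambda>i\<in>{..<n}. circ (\<psi> i h))" for h
  have hom: "\<tau> \<in> hom (G\<lparr>carrier := H\<rparr>) (torus n)"
  proof (rule homI)
    show "\<tau> h \<in> carrier (torus n)" if "h \<in> carrier (G\<lparr>carrier := H\<rparr>)" for h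
      using that by (auto simp: \<tau>_def torus_def circ_in_carrier \<psi>1)
    show "\<tau> (h \<otimes>\<^bsub>G\<lparr>carrier := H\<rparr>\<^esub> h') = \<tau> h \<otimes>\<^bsub>torus n\<^esub> \<tau> h'"
      if "h \<in> carrier (G\<lparr>carrier := H\<rparr>)" "h' \<in> carrier (G\<lparr>carrier := H\<rparr>)" for h h'
      using that by (auto simp: \<tau>_def torus_def circ_mult \<psi>1 \<psi>m intro!: restrict_ext)
  qed
  define B where "B = {x \<in> H. torus_dist n \<one>\<^bsub>torus n\<^esub> (\<tau> x) < 1/6}"
  have "bohr_nbhd (1/6) (Suc r) (G\<lparr>carrier := H\<rparr>) B"
    using hom by (auto simp: bohr_nbhd_def n_def B_def)
  moreover have "x \<in> H" if "x \<in> B" for x using that by (simp add: B_def)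
  moreover have "Re (ip (carrier G) (shift x w) w) \<ge> 1/2 * nsq (carrier G) w"
    if x: "x \<in> B" and w: "w \<in> W" for x w
  proof (rule \<phi>(4)[OF _ _ w])
    show xH: "x \<in> H" using x by (simp add: B_def)
    fix k assume k: "k < s"
    then have kn: "k < n" using \<phi>(1) by (simp add: n_def)
    have "Max ((\<lambda>i. setdist (\<one>\<^bsub>torus n\<^esub> i) (\<tau> x i)) ` {..<n}) < 1/6"
      using x by (simp add: B_def torus_dist_def)
    then have "setdist (\<one>\<^bsub>torus n\<^esub> k) (\<tau> x k) < 1/6"
      using kn by (subst (asm) Max_less_iff) auto
    then have "setdist \<int> (circ (\<psi> k x)) < 1/6"
      using kn by (simp add: torus_def circle_group_def \<tau>_def)
    then have "Re (\<psi> k x) \<ge> 1/2" by (rule Re_ge_half_of_setdist[OF \<psi>1[OF xH]])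
    then show "Re (\<phi> k x) \<ge> 1/2" using k by (simp add: \<psi>_def)
  qed
  ultimately show ?thesis by (rule that)
qed

end


section \<open>Dense subsets of finite groups\<close>

text \<open>One number for three bounds: the index, the torus dimension of at most
  \<open>D + 1\<close>, and the inverse radius 6. \<open>D\<close> bounds the dimension of
  \<open>W\<close>.\<close>

definition bohr_bound :: "nat \<Rightarrow> nat" where
  "bohr_bound c = (let D = 8 * c ^ 4 in (2 * (8 * D\<^sup>2 + 1) + 1)\<^sup>2 ^ D\<^sup>2 + D + 7)"

context finite_grp
begin

text \<open>Indexing by pairs puts the translates of several sets into one family, and so into one
  operator.\<close>

definition translate_ind :: "'a \<times> 'a set \<Rightarrow> 'a \<Rightarrow> complex" where
  "translate_ind t = (\<lambda>y. if y \<in> carrier G \<and> inv (fst t) \<otimes> y \<in> snd t then 1 else 0)"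

lemma translate_ind_shift:
  assumes "x \<in> carrier G" "z \<in> carrier G" "y \<in> carrier G"
  shows "translate_ind (x \<otimes> z, Y) y = shift x (translate_ind (z, Y)) y"
  using assms by (simp add: translate_ind_def shift_def inv_mult_group m_assoc)

lemma sum_translate_ind:
  assumes z: "z \<in> carrier G" and Y: "Y \<subseteq> carrier G"
  shows "(\<Sum>y\<in>carrier G. translate_ind (z, Y) y) = of_nat (card Y)"
proof -
  have "(\<Sum>y\<in>carrier G. translate_ind (z, Y) y) = (\<Sum>y\<in>carrier G. if inv z \<otimes> y \<in> Y then 1 else 0)"
    by (intro sum.cong) (auto simp: translate_ind_def)
  also have "\<dots> = (\<Sum>y\<in>carrier G. if y \<in> Y then 1 else 0)"
    using z by (intro sum.reindex_bij_betw[of "\<lambda>y. inv z \<otimes> y"] bij_betw_translate) auto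
  also have "\<dots> = of_nat (card Y)"
    using Y finite_carrier by (simp add: sum.If_cases Int_absorb1)
  finally show ?thesis .
qed

lemma nsq_translate_ind_le: "nsq (carrier G) (translate_ind t) \<le> card (carrier G)"
proof -
  have "nsq (carrier G) (translate_ind t) \<le> (\<Sum>y\<in>carrier G. 1)"
    unfolding nsq_def by (intro sum_mono) (auto simp: translate_ind_def)
  then show ?thesis by simp
qed

text \<open>The convolution \<open>1\<^sub>X * 1\<^sub>Y\<close>, written as a sum of translates of \<open>1\<^sub>Y\<close>.\<close>

definition conv_ind :: "'a set \<Rightarrow> 'a set \<Rightarrow> 'a \<Rightarrow> complex" where
  "conv_ind X Y = (\<lambda>z. \<Sum>x\<in>X. translate_ind (x, Y) z)"

lemma conv_ind_nonzero:
  assumes X: "X \<subseteq> carrier G" and nz: "conv_ind X Y z \<noteq> 0"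
  shows "z \<in> X <#> Y"
proof -
  obtain x where x: "x \<in> X" "translate_ind (x, Y) z \<noteq> 0"
    using nz unfolding conv_ind_def by (meson sum.neutral)
  then have "z \<in> carrier G" "inv x \<otimes> z \<in> Y" by (auto simp: translate_ind_def split: if_splits)
  moreover have "z = x \<otimes> (inv x \<otimes> z)" using x X calculation by (simp add: subsetD flip: m_assoc)
  ultimately show ?thesis using x(1) by (auto simp: mem_set_mult)
qed

text \<open>The convolution has total mass \<open>card X * card Y\<close>, spread over the carrier;
  Cauchy-Schwarz turns this into a lower bound for its square norm.\<close>

lemma nsq_conv_ind_ge:
  assumes X: "X \<subseteq> carrier G" and Y: "Y \<subseteq> carrier G"
  shows "(real (card X) * real (card Y))\<^sup>2 \<le> card (carrier G) * nsq (carrier G) (conv_ind X Y)"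
proof -
  have "(\<Sum>z\<in>carrier G. conv_ind X Y z) = (\<Sum>x\<in>X. \<Sum>z\<in>carrier G. translate_ind (x, Y) z)"
    unfolding conv_ind_def by (rule sum.swap)
  also have "\<dots> = of_nat (card X * card Y)"
    using X Y by (simp add: sum_translate_ind subsetD)
  finally have "real (card X * card Y) = cmod (\<Sum>z\<in>carrier G. conv_ind X Y z)"
    by (simp only: norm_of_nat)
  also have "\<dots> \<le> (\<Sum>z\<in>carrier G. cmod (conv_ind X Y z))" by (rule norm_sum)
  finally have "(real (card X * card Y))\<^sup>2 \<le> (\<Sum>z\<in>carrier G. cmod (conv_ind X Y z))\<^sup>2"
    by (intro power_mono) auto
  also have "\<dots> \<le> nsq (carrier G) (conv_ind X Y) * card (carrier G)"
    unfolding nsq_def by (rule sum_squared_le_sum_of_squares)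
  finally show ?thesis by (simp add: mult.commute)
qed

text \<open>The convolution is a sum of members of the family that defines the form, so
  Cauchy-Schwarz over \<open>X\<close> bounds its inner product with \<open>v\<close>. For
  \<open>v\<close> orthogonal to the large eigenvectors the right side is small.\<close>

lemma ip_conv_ind_le:
  assumes X: "X \<subseteq> carrier G" and Y: "Y \<in> \<Y>" and fin: "finite \<Y>"
  shows "(cmod (ip (carrier G) (conv_ind X Y) v))\<^sup>2
    \<le> card (carrier G) * qform (carrier G) (carrier G \<times> \<Y>) translate_ind v"
proof -
  let ?K = "carrier G"
  let ?b = "\<lambda>t. cmod (ip ?K v (translate_ind t))"
  have finX: "finite X" using X finite_carrier by (rule finite_subset)
  have "cmod (ip ?K (conv_ind X Y) v) \<le> (\<Sum>x\<in>X. cmod (ip ?K (translate_ind (x, Y)) v))"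
    by (simp add: conv_ind_def ip_sum_left norm_sum)
  also have "\<dots> = (\<Sum>x\<in>X. ?b (x, Y))" by (simp add: cmod_ip_swap[of ?K v])
  finally have "(cmod (ip ?K (conv_ind X Y) v))\<^sup>2 \<le> (\<Sum>x\<in>X. ?b (x, Y))\<^sup>2" by (intro power_mono) auto
  also have "\<dots> \<le> (\<Sum>x\<in>X. (?b (x, Y))\<^sup>2) * card X" by (rule sum_squared_le_sum_of_squares)
  also have "\<dots> \<le> qform ?K (?K \<times> \<Y>) translate_ind v * card ?K"
  proof (intro mult_mono)
    have "(\<Sum>x\<in>X. (?b (x, Y))\<^sup>2) = (\<Sum>t\<in>X \<times> {Y}. (?b t)\<^sup>2)"
      by (rule sum.reindex_bij_witness[of _ fst "\<lambda>x. (x, Y)"]) auto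
    also have "\<dots> \<le> qform ?K (?K \<times> \<Y>) translate_ind v"
      unfolding qform_def using X Y fin finite_carrier by (intro sum_mono2) auto
    finally show "(\<Sum>x\<in>X. (?b (x, Y))\<^sup>2) \<le> qform ?K (?K \<times> \<Y>) translate_ind v" .
    show "real (card X) \<le> real (card ?K)" using X finite_carrier by (simp add: card_mono)
  qed (auto simp: qform_def sum_nonneg)
  finally show ?thesis by (simp add: mult.commute)
qed

text \<open>A nonzero term of the correlation sits at some \<open>y\<close> with both
  \<open>y\<close> and \<open>x^-1 y\<close> in \<open>X Y\<close>, and
  \<open>x = y (x^-1 y)^-1\<close>.\<close>

lemma mem_of_correlation:
  assumes x: "x \<in> carrier G" and X: "X \<subseteq> carrier G" and Y: "Y \<subseteq> carrier G"
    and nz: "ip (carrier G) (shift x (conv_ind X Y)) (conv_ind X Y) \<noteq> 0"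
  shows "x \<in> (X <#> Y) <#> set_inv (X <#> Y)"
proof -
  obtain y where y: "y \<in> carrier G" "shift x (conv_ind X Y) y * cnj (conv_ind X Y y) \<noteq> 0"
    using nz unfolding ip_def by (meson sum.neutral)
  then have "conv_ind X Y y \<noteq> 0" "conv_ind X Y (inv x \<otimes> y) \<noteq> 0" by (auto simp: shift_def)
  then have m: "y \<in> X <#> Y" "inv x \<otimes> y \<in> X <#> Y" using conv_ind_nonzero[OF X] by auto
  have "y \<otimes> inv (inv x \<otimes> y) = x"
    using x y by (simp add: inv_mult_group flip: m_assoc)
  then show ?thesis using m by (force simp: mem_set_mult mem_set_inv)
qed

text \<open>The threshold \<open>\<epsilon>\<close> leaves at most a quarter of the square norm of \<open>g\<close> outside \<open>W\<close>.\<close>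

theorem dense_bohr:
  assumes A: "A \<subseteq> carrier G" and dense: "card (carrier G) \<le> c * card A"
  defines "S \<equiv> \<Inter>X\<in>{A, set_inv A}. \<Inter>Y\<in>{A, set_inv A}. (X <#> Y) <#> set_inv (X <#> Y)"
  shows "bounded_bohr_in G (carrier G) S (bohr_bound c)"
proof -
  let ?K = "carrier G"
  define \<Y> where "\<Y> = {A, set_inv A}"
  define T where "T = ?K \<times> \<Y>"
  \<comment> \<open>The trace is at most \<open>2 * \<kappa>^2\<close>, and dividing by \<epsilon>
    gives this bound on the number of large eigenvalues.\<close>
  define D where "D = 8 * c ^ 4"
  define \<kappa> where "\<kappa> = real (card ?K)"
  define \<epsilon> where "\<epsilon> = \<kappa>\<^sup>2 / (4 * real c ^ 4)"
  have K0: "card ?K > 0" using finite_carrier one_closed by (auto simp: card_gt_0_iff)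
  then have c0: "c > 0" using dense by (cases c) auto
  have \<kappa>0: "\<kappa> > 0" using K0 by (simp add: \<kappa>_def)
  have \<epsilon>0: "\<epsilon> > 0" using \<kappa>0 c0 by (simp add: \<epsilon>_def)
  have \<Y>: "finite \<Y>" "card \<Y> \<le> 2" "\<And>Y. Y \<in> \<Y> \<Longrightarrow> Y \<subseteq> ?K" "\<And>Y. Y \<in> \<Y> \<Longrightarrow> card Y = card A"
    using A set_inv_closed[OF A] card_set_inv[OF A] by (auto simp: \<Y>_def card_insert_if)
  have "(\<Sum>t\<in>T. nsq ?K (translate_ind t)) \<le> real (card T) * \<kappa>"
    unfolding \<kappa>_def by (rule sum_bounded_above) (rule nsq_translate_ind_le)
  also have "real (card T) = \<kappa> * real (card \<Y>)" by (simp add: T_def card_cartesian_product \<kappa>_def)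
  also have "\<kappa> * real (card \<Y>) * \<kappa> \<le> \<kappa> * 2 * \<kappa>"
    using \<Y>(2) \<kappa>0 by (intro mult_right_mono mult_left_mono) auto
  also have "\<dots> = real D * \<epsilon>"
    using c0 by (simp add: D_def \<epsilon>_def power2_eq_square)
  finally have tr: "(\<Sum>t\<in>T. nsq ?K (translate_ind t)) \<le> real D * \<epsilon>" .
  obtain e r where e: "orthonormal ?K e r" "r \<le> D"
    "\<And>i. i < r \<Longrightarrow> \<exists>\<mu>\<ge>\<epsilon>. \<forall>x\<in>?K. qop ?K T translate_ind (e i) x = of_real \<mu> * e i x"
    "\<And>v. nsq ?K v > 0 \<Longrightarrow> (\<And>i. i < r \<Longrightarrow> ip ?K v (e i) = 0) \<Longrightarrow> qform ?K T translate_ind v < \<epsilon> * nsq ?K v"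
    by (rule large_spectrum[OF finite_carrier \<epsilon>0 tr]) auto
  have "invariant_span_axioms G e r"
  proof
    show "orthonormal ?K e r" by (rule e)
    show "shift x (e i) y = orth_proj ?K e r (shift x (e i)) y" if x: "x \<in> ?K" and i: "i < r" and y: "y \<in> ?K" for x i y
    proof (rule large_spectrum_invariant[OF \<epsilon>0 e(1,3,4) x _ _ i y])
      show "bij_betw (map_prod (\<lambda>z. x \<otimes> z) id) T T"
        unfolding T_def using bij_betw_translate[OF x] by (rule bij_betw_map_prod) auto
      show "translate_ind (map_prod (\<lambda>z. x \<otimes> z) id t) y = shift x (translate_ind t) y"
        if "t \<in> T" "y \<in> ?K" for t y
        using that translate_ind_shift[OF x] by (auto simp: T_def)
    qed
  qed
  then interpret invariant_span G e r by (intro invariant_span.intro finite_grp_axioms)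
  define E where "E = generate G {x \<in> ?K. near x (1/4)}"
  \<comment> \<open>In the abelian case all translations commute, so the whole group can be
    diagonalised on \<open>W\<close>.\<close>
  define H where "H = (if comm_group G then ?K else E)"
  have E: "E \<lhd> G" "\<And>x y w. x \<in> E \<Longrightarrow> y \<in> E \<Longrightarrow> w \<in> W \<Longrightarrow> shift x (shift y w) = shift y (shift x w)"
    unfolding E_def using near_generated_subgroup[OF finite_carrier] by auto
  have K_normal: "?K \<lhd> G" by (simp add: normal_inv_iff subgroup_self)
  have H: "H \<lhd> G" using E(1) K_normal by (simp add: H_def)
  have comm: "shift x (shift y w) = shift y (shift x w)" if "x \<in> H" "y \<in> H" "w \<in> W" for x y w
  proof (cases "comm_group G")
    case True
    then have "x \<otimes> y = y \<otimes> x" using that comm_groupE(4)[OF True] by (simp add: H_def)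
    then show ?thesis using that True by (simp add: H_def flip: shift_mult)
  qed (use that E(2) in \<open>simp add: H_def\<close>)
  have index: "finite (rcosets H)" "card (rcosets H) \<le> bohr_bound c"
  proof -
    have "finite (rcosets E)" "card (rcosets E) \<le> bohr_bound c"
      using index_near_generated_subgroup[OF e(2)] by (simp_all add: E_def bohr_bound_def D_def Let_def)
    moreover have "rcosets ?K = {?K}"
      using coset_join2[OF _ subgroup_self] one_closed by (auto simp: RCOSETS_def)
    moreover have "1 \<le> bohr_bound c" by (simp add: bohr_bound_def Let_def)
    ultimately show "finite (rcosets H)" "card (rcosets H) \<le> bohr_bound c" by (auto simp: H_def)
  qed
  obtain B where B: "bohr_nbhd (1/6) (Suc r) (G\<lparr>carrier := H\<rparr>) B" "\<And>x. x \<in> B \<Longrightarrow> x \<in> H"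
    "\<And>x w. x \<in> B \<Longrightarrow> w \<in> W \<Longrightarrow> Re (ip ?K (shift x w) w) \<ge> 1/2 * nsq ?K w"
    by (rule bohr_nbhd_of_commuting[OF normal_imp_subgroup[OF H] comm]) auto
  have "B \<subseteq> S"
  proof
    fix x assume x: "x \<in> B"
    have xK: "x \<in> ?K" using B(2)[OF x] normal_imp_subgroup[OF H] subgroup.mem_carrier by metis
    have "x \<in> (X <#> Y) <#> set_inv (X <#> Y)" if X: "X \<in> \<Y>" and Y: "Y \<in> \<Y>" for X Y
    proof (rule mem_of_correlation[OF xK \<Y>(3)[OF X] \<Y>(3)[OF Y]])
      define g where "g = conv_ind X Y"
      define w where "w = (\<lambda>y. if y \<in> ?K then orth_proj ?K e r g y else 0)"
      define v where "v = (\<lambda>y. g y - w y)"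
      have w: "w \<in> W" by (auto simp: w_def span_on_def orth_proj_def)
      have v_perp: "ip ?K v (e i) = 0" if "i < r" for i
      proof -
        have "ip ?K v (e i) = ip ?K (\<lambda>y. g y - orth_proj ?K e r g y) (e i)"
          by (rule ip_cong) (auto simp: v_def w_def)
        then show ?thesis using ip_residual[OF e(1) that] by simp
      qed
      have g_eq: "g = (\<lambda>y. w y + v y)" by (simp add: v_def)
      have vw: "ip ?K v u = 0" "ip ?K u v = 0" if "u \<in> W" for u
        using span_on_perp[OF that v_perp] by auto
      have nsq_g: "nsq ?K g = nsq ?K w + nsq ?K v"
        unfolding g_eq by (rule nsq_add_perp) (rule vw(2)[OF w])
      have "ip ?K g v = of_real (nsq ?K v)"
        by (subst g_eq) (simp add: ip_linear vw(2)[OF w] ip_self)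
      \<comment> \<open>Since \<open>g\<close> has inner product \<open>nsq v\<close> with
        \<open>v\<close>, the form bounds the square of \<open>nsq v\<close> by
        \<open>\<kappa> * \<epsilon> * nsq v\<close>; one factor cancels unless \<open>v\<close> has
        norm zero.\<close>
      then have "(nsq ?K v)\<^sup>2 = (cmod (ip ?K g v))\<^sup>2" by simp
      also have "\<dots> \<le> \<kappa> * qform ?K T translate_ind v"
        unfolding g_def \<kappa>_def T_def by (rule ip_conv_ind_le[OF \<Y>(3)[OF X] Y \<Y>(1)])
      finally have sq: "(nsq ?K v)\<^sup>2 \<le> \<kappa> * qform ?K T translate_ind v" .
      have v_le: "nsq ?K v \<le> \<kappa> * \<epsilon>"
      proof (cases "nsq ?K v > 0")
        case True
        have "(nsq ?K v)\<^sup>2 \<le> \<kappa> * (\<epsilon> * nsq ?K v)"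
          using sq e(4)[OF True v_perp] \<kappa>0 by (meson less_imp_le mult_left_mono order_trans)
        then show ?thesis using True by (simp add: power2_eq_square)
      next
        case False
        then show ?thesis using \<kappa>0 \<epsilon>0 by (simp add: not_less order_trans[of _ 0])
      qed
      have "\<kappa> ^ 4 \<le> (real c * real (card A)) ^ 4"
        using dense \<kappa>0 by (intro power_mono) (simp_all add: \<kappa>_def flip: of_nat_mult)
      also have "\<dots> = real c ^ 4 * (real (card X) * real (card Y))\<^sup>2"
        by (simp add: \<Y>(4)[OF X] \<Y>(4)[OF Y] power_mult_distrib power2_eq_square power4_eq_xxxx)
      also have "\<dots> \<le> real c ^ 4 * (\<kappa> * nsq ?K g)"
        unfolding \<kappa>_def g_def
        by (rule mult_left_mono[OF nsq_conv_ind_ge[OF \<Y>(3)[OF X] \<Y>(3)[OF Y]]]) simp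
      finally have "\<kappa> * \<kappa> ^ 3 \<le> \<kappa> * (real c ^ 4 * nsq ?K g)"
        by (simp add: power4_eq_xxxx power3_eq_cube mult_ac)
      then have g_ge: "\<kappa> ^ 3 \<le> real c ^ 4 * nsq ?K g" using \<kappa>0 by simp
      have "\<kappa> * \<epsilon> = \<kappa> ^ 3 / real c ^ 4 / 4" by (simp add: \<epsilon>_def power2_eq_square power3_eq_cube)
      also have "\<dots> \<le> nsq ?K g / 4"
        using g_ge c0 by (simp add: field_simps)
      finally have v_small: "nsq ?K v \<le> nsq ?K g / 4" using v_le by simp
      have "\<kappa> ^ 3 > 0" using \<kappa>0 by simp
      then have "nsq ?K g \<noteq> 0" using g_ge by auto
      then have g_pos: "nsq ?K g > 0" by (metis less_le nsq_nonneg)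
      have inv_x: "inv x \<in> ?K" using xK by simp
      \<comment> \<open>Translations preserve both \<open>W\<close> and its orthogonal complement,
        so the mixed terms drop out.\<close>
      have "ip ?K (shift x g) g = ip ?K (shift x w) w + ip ?K (shift x w) v
          + ip ?K (shift x v) w + ip ?K (shift x v) v"
        unfolding g_eq using shift_lin[of x w 1 v] by (simp add: ip_linear)
      also have "ip ?K (shift x w) v = 0" by (rule vw(2)[OF shift_W[OF xK w]])
      also have "ip ?K (shift x v) w = 0"
        unfolding ip_shift_left[OF xK] by (rule vw(1)[OF shift_W[OF inv_x w]])
      finally have corr: "ip ?K (shift x g) g = ip ?K (shift x w) w + ip ?K (shift x v) v" by simp
      have "(cmod (ip ?K (shift x v) v))\<^sup>2 \<le> (nsq ?K v)\<^sup>2"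
        using cauchy_schwarz[of ?K "shift x v" v] nsq_shift[OF xK, of v] by (simp add: power2_eq_square)
      then have "cmod (ip ?K (shift x v) v) \<le> nsq ?K v" by (rule power2_le_imp_le) simp
      then have "Re (ip ?K (shift x v) v) \<ge> - nsq ?K v"
        using abs_Re_le_cmod[of "ip ?K (shift x v) v"] by linarith
      \<comment> \<open>The part in \<open>W\<close> gives at least \<open>1/2 * 3/4\<close> of
        \<open>nsq g\<close>, the rest loses at most \<open>1/4\<close>, and \<open>1/8\<close>
        remains.\<close>
      then have "Re (ip ?K (shift x g) g) > 0"
        using B(3)[OF x w] corr nsq_g v_small g_pos by simp
      then show "ip ?K (shift x (conv_ind X Y)) (conv_ind X Y) \<noteq> 0" by (auto simp: g_def)
    qed
    then show "x \<in> S" by (auto simp: S_def \<Y>_def)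
  qed
  moreover have "Suc r \<le> bohr_bound c" "6 \<le> bohr_bound c"
    using e(2) by (simp_all add: bohr_bound_def D_def Let_def)
  moreover have "comm_group G \<longrightarrow> H = ?K" by (simp add: H_def)
  ultimately show ?thesis
    unfolding bounded_bohr_in_def using H index B(1)
    by (intro exI[of _ H] exI[of _ "1/6"] exI[of _ "Suc r"] exI[of _ B]) auto
qed

end


section \<open>Sets of small alternation or small tripling\<close>

lemma bounded_bohr_in_mono:
  assumes "bounded_bohr_in G K S C" "S \<subseteq> S'" "C \<le> C'"
  shows "bounded_bohr_in G K S' C'"
proof -
  obtain H \<delta> n B where H: "H \<lhd> (G\<lparr>carrier := K\<rparr>)" "finite (rcosets\<^bsub>G\<lparr>carrier := K\<rparr>\<^esub> H)"
    "card (rcosets\<^bsub>G\<lparr>carrier := K\<rparr>\<^esub> H) \<le> C" "bohr_nbhd \<delta> n (G\<lparr>carrier := H\<rparr>) B"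
    "inverse \<delta> \<le> real C" "n \<le> C" "B \<subseteq> S" "comm_group (G\<lparr>carrier := K\<rparr>) \<longrightarrow> H = K"
    using assms(1) unfolding bounded_bohr_in_def by blast
  have "card (rcosets\<^bsub>G\<lparr>carrier := K\<rparr>\<^esub> H) \<le> C'" "inverse \<delta> \<le> real C'" "n \<le> C'" "B \<subseteq> S'"
    using H assms(2,3) by auto
  then show ?thesis unfolding bounded_bohr_in_def using H by blast
qed

lemma bounded_bohr_in_restrict:
  "bounded_bohr_in (G\<lparr>carrier := K\<rparr>) K S C = bounded_bohr_in G K S C"
  by (simp add: bounded_bohr_in_def)

definition tripling_set :: "('a, 'b) monoid_scheme \<Rightarrow> 'a set \<Rightarrow> 'a set" where
  "tripling_set G A =
    (A <#>\<^bsub>G\<^esub> set_inv\<^bsub>G\<^esub> A) [^^]\<^bsub>G\<^esub> (2::nat) \<inter>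
    (A [^^]\<^bsub>G\<^esub> (2::nat) <#>\<^bsub>G\<^esub> (set_inv\<^bsub>G\<^esub> A) [^^]\<^bsub>G\<^esub> (2::nat)) \<inter>
    (set_inv\<^bsub>G\<^esub> A <#>\<^bsub>G\<^esub> A) [^^]\<^bsub>G\<^esub> (2::nat) \<inter>
    ((set_inv\<^bsub>G\<^esub> A) [^^]\<^bsub>G\<^esub> (2::nat) <#>\<^bsub>G\<^esub> A [^^]\<^bsub>G\<^esub> (2::nat))"

context group
begin

lemma set_inv_restrict:
  assumes "subgroup K G" "X \<subseteq> K"
  shows "set_inv\<^bsub>G\<lparr>carrier := K\<rparr>\<^esub> X = set_inv X"
  unfolding SET_INV_def using m_inv_consistent[OF assms(1) subsetD[OF assms(2)]] by simp

lemma set_pow_restrict: "X [^^]\<^bsub>G\<lparr>carrier := K\<rparr>\<^esub> n = X [^^] n"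
  by (induction n) auto

lemma set_inv_subset_subgroup: "subgroup K G \<Longrightarrow> X \<subseteq> K \<Longrightarrow> set_inv X \<subseteq> K"
  by (auto simp: SET_INV_def intro: subgroup.m_inv_closed)

lemma set_mult_subset_subgroup: "subgroup K G \<Longrightarrow> X \<subseteq> K \<Longrightarrow> Y \<subseteq> K \<Longrightarrow> X <#> Y \<subseteq> K"
  by (auto simp: set_mult_def intro: subgroup.m_closed)

lemma sym_set_restrict:
  assumes "subgroup K G" "X \<subseteq> K"
  shows "sym_set (G\<lparr>carrier := K\<rparr>) X = sym_set G X"
  using set_inv_restrict[OF assms] by (simp add: sym_set_def)

lemma tripling_set_restrict:
  assumes "subgroup K G" "A \<subseteq> K"
  shows "tripling_set (G\<lparr>carrier := K\<rparr>) A = tripling_set G A"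
  using set_inv_restrict[OF assms] by (simp add: tripling_set_def set_pow_restrict)

lemma tripling_set_closed: "A \<subseteq> carrier G \<Longrightarrow> tripling_set G A \<subseteq> carrier G"
  using set_pow_closed[OF set_mult_closed[OF _ set_inv_closed], of A A 2] by (simp add: tripling_set_def le_infI1)

text \<open>\<open>(X Y) (X Y)^-1 = X Y Y^-1 X^-1\<close>; equal choices of \<open>X\<close> and
  \<open>Y\<close> give the two products of squares, different choices the two squares of
  products.\<close>

lemma correlation_sets_subset:
  assumes A: "A \<subseteq> carrier G"
  shows "(\<Inter>X\<in>{A, set_inv A}. \<Inter>Y\<in>{A, set_inv A}. (X <#> Y) <#> set_inv (X <#> Y)) \<subseteq> tripling_set G A"
  using A by (simp add: tripling_set_def set_pow_2 set_inv_set_mult set_inv_set_inv set_inv_closed set_mult_closed)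
    blast

lemma dense_bohr_subgroup:
  assumes K: "subgroup K G" "finite K" and A: "A \<subseteq> K" and dense: "card K \<le> c * card A"
  shows "bounded_bohr_in G K (tripling_set G A) (bohr_bound c)"
proof -
  interpret K: group "G\<lparr>carrier := K\<rparr>" using subgroup_imp_group[OF K(1)] .
  interpret K: finite_grp "G\<lparr>carrier := K\<rparr>" by unfold_locales (simp add: K)
  have "bounded_bohr_in (G\<lparr>carrier := K\<rparr>) (carrier (G\<lparr>carrier := K\<rparr>))
      (tripling_set (G\<lparr>carrier := K\<rparr>) A) (bohr_bound c)"
    by (rule bounded_bohr_in_mono[OF K.dense_bohr K.correlation_sets_subset order_refl]) (use A dense in auto)
  then show ?thesis by (simp add: bounded_bohr_in_restrict tripling_set_restrict[OF K(1) A])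
qed

text \<open>Right translation puts \<open>A\<close> inside \<open>A A\<^sup>-\<^sup>1\<close> without changing \<open>A A\<^sup>-\<^sup>1\<close>.\<close>

lemma alternation_translate:
  assumes A: "A \<subseteq> carrier G" "finite A" "A \<noteq> {}"
  obtains A' where "A' \<subseteq> A <#> set_inv A" "A' \<noteq> {}" "card A' = card A"
    "A' <#> set_inv A' = A <#> set_inv A"
    "card (A' <#> set_inv A' <#> A') = card (A <#> set_inv A <#> A)"
proof -
  obtain a where a: "a \<in> A" using A by auto
  then have ac: "a \<in> carrier G" using A by auto
  define A' where "A' = A <#> {inv a}"
  have card: "card (X <#> {inv a}) = card X" if "X \<subseteq> carrier G" for X
  proof -
    have "X <#> {inv a} = (\<lambda>x. x \<otimes> inv a) ` X" by (auto simp: set_mult_def)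
    moreover have "inj_on (\<lambda>x. x \<otimes> inv a) X"
      using that ac by (intro inj_onI) (metis right_cancel subsetD inv_closed)
    ultimately show ?thesis by (simp add: card_image)
  qed
  have "set_inv {inv a} = {a}" using ac by (simp add: SET_INV_def)
  then have "A' <#> set_inv A' = A <#> {inv a} <#> ({a} <#> set_inv A)"
    using A ac by (simp add: A'_def set_inv_set_mult)
  also have "\<dots> = A <#> ({inv a} <#> {a} <#> set_inv A)"
    using A ac by (simp add: set_mult_assoc set_inv_closed set_mult_closed)
  also have "{inv a} <#> {a} = {\<one>}" using ac by (simp add: set_mult_def)
  also have "{\<one>} <#> set_inv A = set_inv A" using A by (simp add: one_set_mult set_inv_closed)
  finally have eq: "A' <#> set_inv A' = A <#> set_inv A" .
  have "A <#> set_inv A <#> A' = (A <#> set_inv A <#> A) <#> {inv a}"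
    using A ac by (simp add: A'_def set_mult_assoc set_inv_closed set_mult_closed)
  then have "card (A' <#> set_inv A' <#> A') = card (A <#> set_inv A <#> A)"
    unfolding eq using card[of "A <#> set_inv A <#> A"] A by (simp add: set_inv_closed set_mult_closed)
  moreover have "A' \<subseteq> A <#> set_inv A" using a by (auto simp: A'_def set_mult_def SET_INV_def)
  moreover have "A' \<noteq> {}" using a by (auto simp: A'_def set_mult_def)
  ultimately show ?thesis using that[of A'] eq card[OF A(1)] by (simp add: A'_def)
qed

lemma set_inv_alternation: "A \<subseteq> carrier G \<Longrightarrow> set_inv (A <#> set_inv A) = A <#> set_inv A"
  by (simp add: set_inv_set_mult set_inv_closed set_inv_set_inv)

text \<open>\<open>A\<close> need not lie in the generated subgroup, so density is applied to a
  translate \<open>A'\<close> inside it. Right translation preserves \<open>A A^-1\<close>, and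
  \<open>(A A^-1)^2\<close> is the component of \<open>tripling_set G A'\<close> that is
  kept.\<close>

lemma alternation_bohr:
  assumes A: "A \<subseteq> carrier G" "finite A" "A \<noteq> {}" and m: "m > 0"
    and k: "card (A <#> set_inv A <#> A) \<le> k * card A"
    and gen: "generate G (A <#> set_inv A) = (A <#> set_inv A) [^^] m"
  shows "bounded_bohr_in G (generate G (A <#> set_inv A)) ((A <#> set_inv A) [^^] (2::nat))
    (bohr_bound ((k ^ 4) ^ m))"
proof -
  define S where "S = A <#> set_inv A"
  have S: "S \<subseteq> carrier G" "finite S" "set_inv S = S"
    using A by (simp_all add: S_def set_mult_closed set_inv_closed finite_set_mult finite_set_inv set_inv_alternation)
  obtain A' where A': "A' \<subseteq> S" "A' \<noteq> {}" "card A' = card A" "A' <#> set_inv A' = S"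
    "card (A' <#> set_inv A' <#> A') = card (A <#> set_inv A <#> A)"
    unfolding S_def by (rule alternation_translate[OF A])
  have sub: "subgroup (generate G S) G" using generate_is_subgroup[OF S(1)] .
  have gen': "generate G S = S [^^] m" using gen by (simp add: S_def)
  then have fin: "finite (generate G S)" using finite_set_pow[OF S(2)] by simp
  obtain m' where m': "m = Suc m'" using m by (cases m) auto
  have "card (S <#> S <#> S) \<le> k ^ 4 * card A'"
    using small_alternation_cube[OF A k] A' by (simp add: S_def)
  then have "card (generate G S) \<le> (k ^ 4) ^ m * card A'"
    unfolding gen' m' by (rule set_pow_growth[OF S A'(1,2)])
  moreover have AK: "A' \<subseteq> generate G S" using A'(1) by (auto intro: generate.incl)
  ultimately have "bounded_bohr_in G (generate G S) (tripling_set G A') (bohr_bound ((k ^ 4) ^ m))"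
    by (intro dense_bohr_subgroup sub fin)
  then show ?thesis
    unfolding S_def[symmetric] by (rule bounded_bohr_in_mono) (auto simp: tripling_set_def A'(4))
qed

lemma tripling_bohr:
  assumes A: "A \<subseteq> carrier G" "finite A" "A \<noteq> {}" and m: "m > 0"
    and k: "card (A [^^] (3::nat)) \<le> k * card A"
    and gen: "generate G A = sym_set G A [^^] m"
  shows "bounded_bohr_in G (generate G A) (tripling_set G A) (bohr_bound ((27 * k ^ 3) ^ m))"
proof -
  define S where "S = sym_set G A"
  have S: "S \<subseteq> carrier G" "finite S" "set_inv S = S" "A \<subseteq> S"
    using A by (simp_all add: S_def sym_set_closed finite_sym_set set_inv_sym_set) (auto simp: sym_set_def)
  obtain m' where m': "m = Suc m'" using m by (cases m) auto
  have "card (S <#> S <#> S) \<le> (27 * k ^ 3) * card A"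
    using small_tripling_cube[OF A, of k] k A by (simp add: S_def set_pow_3)
  then have "card (generate G A) \<le> (27 * k ^ 3) ^ m * card A"
    unfolding gen m' S_def[symmetric] by (rule set_pow_growth[OF S(1-4) A(3)])
  moreover have "finite (generate G A)" using gen finite_set_pow[OF S(2)] by (simp add: S_def)
  moreover have "A \<subseteq> generate G A" by (auto intro: generate.incl)
  ultimately show ?thesis by (intro dense_bohr_subgroup generate_is_subgroup A)
qed

end

text \<open>Adding the two constants gives one number for both halves, depending on \<open>k\<close>
  and \<open>m\<close> alone and not on the type of the group.\<close>

lemma bound_holds_explicit:
  fixes G (structure)
  assumes "group G" "A \<subseteq> carrier G" "finite A" "A \<noteq> {}" "m > 0"
  shows "bound_holds k m (bohr_bound ((k ^ 4) ^ m) + bohr_bound ((27 * k ^ 3) ^ m)) G A"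
proof -
  interpret group G by fact
  show ?thesis
    unfolding bound_holds_def tripling_set_def[symmetric]
  proof (intro conjI impI; elim conjE)
    assume "card (A <#> set_inv A <#> A) \<le> k * card A"
      and "generate G (A <#> set_inv A) = (A <#> set_inv A) [^^] m"
    then show "bounded_bohr_in G (generate G (A <#> set_inv A)) ((A <#> set_inv A) [^^] (2::nat))
        (bohr_bound ((k ^ 4) ^ m) + bohr_bound ((27 * k ^ 3) ^ m))"
      by (rule bounded_bohr_in_mono[OF alternation_bohr[OF assms(2-5)] order_refl]) simp
  next
    assume "card (A [^^] (3::nat)) \<le> k * card A" and "generate G A = sym_set G A [^^] m"
    then show "bounded_bohr_in G (generate G A) (tripling_set G A)
        (bohr_bound ((k ^ 4) ^ m) + bohr_bound ((27 * k ^ 3) ^ m))"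
      by (rule bounded_bohr_in_mono[OF tripling_bohr[OF assms(2-5)] order_refl]) simp
  qed
qed

text \<open>Whatever value the choice operator returns has the required property, because the
  explicit constant shows that some value has it.\<close>

lemma bohr_const_works:
  fixes G :: "nat monoid"
  assumes "m > 0" "group G" "A \<subseteq> carrier G" "finite A" "A \<noteq> {}"
  shows "bound_holds k m (bohr_const k m) G A"
proof -
  have "\<forall>(G :: nat monoid) A. group G \<and> A \<subseteq> carrier G \<and> finite A \<and> A \<noteq> {} \<longrightarrow>
      bound_holds k m (bohr_const k m) G A"
    unfolding bohr_const_def
    by (rule someI[of _ "bohr_bound ((k ^ 4) ^ m) + bohr_bound ((27 * k ^ 3) ^ m)"])
      (use bound_holds_explicit assms(1) in blast)
  then show ?thesis using assms by blast
qed

section \<open>Transport to groups on the natural numbers\<close>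

lemma (in group) finite_imp_iso_nat_monoid:
  assumes "finite (carrier G)"
  obtains G' :: "nat monoid" and f where "group G'" "f \<in> iso G G'"
proof -
  obtain f :: "'a \<Rightarrow> nat" where f: "inj_on f (carrier G)"
    using finite_imp_inj_to_nat_seg[OF assms] by blast
  let ?g = "inv_into (carrier G) f"
  define G' where "G' = \<lparr>carrier = f ` carrier G, monoid.mult = (\<lambda>a b. f (?g a \<otimes> ?g b)), one = f \<one>\<rparr>"
  have iso: "f \<in> iso G G'"
    using f by (intro isoI homI) (auto simp: G'_def bij_betw_def)
  \<comment> \<open>\<open>iso_imp_img_group\<close> concerns the target record with its unit
    replaced by \<open>f \<one>\<close>, which is already the unit here.\<close>
  have "G'\<lparr>one := f \<one>\<rparr> = G'" by (simp add: G'_def)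
  then have "group G'" using iso_imp_img_group[OF iso] by simp
  then show ?thesis using that iso by blast
qed

text \<open>Everything is pulled back along \<open>f\<close>: the subgroup by the inverse map
  \<open>g\<close>, the torus map as \<open>\<tau> \<circ> f\<close>. Radius and dimension are
  unchanged, and \<open>g\<close> carries the cosets of \<open>H'\<close> to those of
  \<open>H\<close>.\<close>

lemma bounded_bohr_in_iso:
  assumes f: "f \<in> iso G G'" and G: "group G" and G': "group G'" and S: "S \<subseteq> carrier G"
    and bnd: "bounded_bohr_in G' (carrier G') (f ` S) C"
  shows "bounded_bohr_in G (carrier G) S C"
proof -
  interpret G: group G by fact
  interpret G': group G' by fact
  define g where "g = inv_into (carrier G) f"
  have g: "g \<in> iso G' G" unfolding g_def by (rule G.iso_set_sym[OF f])
  have fh: "f \<in> hom G G'" and gh: "g \<in> hom G' G" using f g by (simp_all add: iso_iff)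
  have bij: "bij_betw f (carrier G) (carrier G')" using f by (simp add: iso_def)
  have gf: "g (f x) = x" if "x \<in> carrier G" for x
    using bij that by (simp add: g_def bij_betw_def inv_into_f_f)
  have fg: "f (g x) = x" if "x \<in> carrier G'" for x
    using bij that by (simp add: g_def bij_betw_def f_inv_into_f)
  have fc: "f x \<in> carrier G'" if "x \<in> carrier G" for x using hom_in_carrier[OF fh that] .
  obtain H' \<delta> n B' where H': "H' \<lhd> G'" "finite (rcosets\<^bsub>G'\<^esub> H')" "card (rcosets\<^bsub>G'\<^esub> H') \<le> C"
    and B': "bohr_nbhd \<delta> n (G'\<lparr>carrier := H'\<rparr>) B'" and C: "inverse \<delta> \<le> real C" "n \<le> C"
    and B'S: "B' \<subseteq> f ` S" and comm: "comm_group G' \<longrightarrow> H' = carrier G'"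
    using bnd unfolding bounded_bohr_in_def by auto
  have H'c: "H' \<subseteq> carrier G'" using normal_imp_subgroup[OF H'(1)] subgroup.subset by blast
  define H where "H = g ` H'"
  have H: "H \<lhd> G" unfolding H_def by (rule iso_normal_subgroup[OF g G' G H'(1)])
  have Hc: "H \<subseteq> carrier G" using normal_imp_subgroup[OF H] subgroup.subset by blast
  have fH: "f h \<in> H'" if "h \<in> H" for h using that fg H'c by (auto simp: H_def)
  have cosets: "rcosets\<^bsub>G\<^esub> H \<subseteq> (\<lambda>c. g ` c) ` (rcosets\<^bsub>G'\<^esub> H')"
  proof
    fix c assume "c \<in> rcosets\<^bsub>G\<^esub> H"
    then obtain x where x: "x \<in> carrier G" "c = H #>\<^bsub>G\<^esub> x" by (auto simp: RCOSETS_def)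
    have "g (h \<otimes>\<^bsub>G'\<^esub> f x) = g h \<otimes>\<^bsub>G\<^esub> x" if "h \<in> H'" for h
      using hom_mult[OF gh, of h "f x"] that H'c fc[OF x(1)] gf[OF x(1)] by auto
    then have "c = g ` (H' #>\<^bsub>G'\<^esub> f x)"
      by (auto simp: x(2) H_def r_coset_def image_UN)
    then show "c \<in> (\<lambda>c. g ` c) ` (rcosets\<^bsub>G'\<^esub> H')" using fc[OF x(1)] by (auto simp: RCOSETS_def)
  qed
  have fin: "finite (rcosets\<^bsub>G\<^esub> H)" using cosets H'(2) by (meson finite_imageI finite_subset)
  have card: "card (rcosets\<^bsub>G\<^esub> H) \<le> C"
    using card_mono[OF finite_imageI[OF H'(2)] cosets] card_image_le[OF H'(2)] H'(3) by (meson order_trans)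
  obtain \<tau> where \<tau>: "\<tau> \<in> hom (G'\<lparr>carrier := H'\<rparr>) (torus n)" "\<delta> > 0" "n > 0"
    "B' = {x \<in> H'. torus_dist n \<one>\<^bsub>torus n\<^esub> (\<tau> x) < \<delta>}"
    using B' unfolding bohr_nbhd_def by auto
  define B where "B = {x \<in> H. torus_dist n \<one>\<^bsub>torus n\<^esub> ((\<tau> \<circ> f) x) < \<delta>}"
  have "\<tau> \<circ> f \<in> hom (G\<lparr>carrier := H\<rparr>) (torus n)"
  proof (rule homI)
    show "(\<tau> \<circ> f) x \<in> carrier (torus n)" if "x \<in> carrier (G\<lparr>carrier := H\<rparr>)" for x
      using that hom_in_carrier[OF \<tau>(1)] fH by simp
    show "(\<tau> \<circ> f) (x \<otimes>\<^bsub>G\<lparr>carrier := H\<rparr>\<^esub> y) = (\<tau> \<circ> f) x \<otimes>\<^bsub>torus n\<^esub> (\<tau> \<circ> f) y"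
      if "x \<in> carrier (G\<lparr>carrier := H\<rparr>)" "y \<in> carrier (G\<lparr>carrier := H\<rparr>)" for x y
      using that hom_mult[OF \<tau>(1), of "f x" "f y"] hom_mult[OF fh, of x y] fH Hc by (simp add: subsetD)
  qed
  then have B: "bohr_nbhd \<delta> n (G\<lparr>carrier := H\<rparr>) B"
    unfolding bohr_nbhd_def B_def using \<tau>(2,3) by (intro conjI bexI[of _ "\<tau> \<circ> f"]) auto
  have "B \<subseteq> S"
  proof
    fix x assume x: "x \<in> B"
    then have xc: "x \<in> carrier G" using Hc by (auto simp: B_def)
    have "f x \<in> B'" using x fH by (simp add: B_def \<tau>(4))
    then obtain s where "s \<in> S" "f x = f s" using B'S by auto
    then show "x \<in> S" using xc S bij by (metis bij_betw_def inj_onD subsetD)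
  qed
  moreover have "comm_group G \<longrightarrow> H = carrier G"
  proof
    assume cG: "comm_group G"
    have "comm_group G'"
      by (rule comm_group.iso_imp_comm_group[OF cG]) (use f G'.is_monoid in \<open>auto simp: is_iso_def\<close>)
    then show "H = carrier G" using comm g by (simp add: H_def iso_iff)
  qed
  ultimately show ?thesis
    unfolding bounded_bohr_in_def using H fin card B C
    by (intro exI[of _ H] exI[of _ \<delta>] exI[of _ n] exI[of _ B]) auto
qed

locale group_iso = G: group G + G': group G'
  for G :: "('a, 'b) monoid_scheme" (structure) and G' :: "('c, 'd) monoid_scheme" +
  fixes f assumes f: "f \<in> iso G G'"
begin

lemma f_hom: "f \<in> hom G G'"
  using f by (simp add: iso_iff)

sublocale group_hom G G' f
  by unfold_locales (rule f_hom)

lemma f_set_mult: "X \<subseteq> carrier G \<Longrightarrow> Y \<subseteq> carrier G \<Longrightarrow> f ` (X <#> Y) = (f ` X) <#>\<^bsub>G'\<^esub> (f ` Y)"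
  by (rule set_mult_hom[OF f_hom])

lemma f_set_inv: "X \<subseteq> carrier G \<Longrightarrow> f ` (set_inv X) = set_inv\<^bsub>G'\<^esub> (f ` X)"
  by (force simp: SET_INV_def)

lemma f_set_pow: "X \<subseteq> carrier G \<Longrightarrow> f ` (X [^^] (n::nat)) = (f ` X) [^^]\<^bsub>G'\<^esub> n"
  by (induction n) (simp_all add: f_set_mult G.set_pow_closed)

lemma f_sym_set: "X \<subseteq> carrier G \<Longrightarrow> f ` sym_set G X = sym_set G' (f ` X)"
  by (simp add: sym_set_def image_Un f_set_inv)

lemma f_card: "X \<subseteq> carrier G \<Longrightarrow> card (f ` X) = card X"
  using f by (meson Group.iso_iff card_image inj_on_subset)

lemma f_tripling_set:
  assumes "X \<subseteq> carrier G"
  shows "f ` tripling_set G X = tripling_set G' (f ` X)"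
proof -
  have inj: "inj_on f (carrier G)" using f by (simp add: Group.iso_iff)
  have int: "f ` (P \<inter> Q) = f ` P \<inter> f ` Q" if "P \<subseteq> carrier G" "Q \<subseteq> carrier G" for P Q
    by (rule inj_on_image_Int[OF inj that])
  note cl = G.set_pow_closed G.set_mult_closed G.set_inv_closed assms
  show ?thesis unfolding tripling_set_def
    by (simp add: int cl le_infI1 f_set_mult f_set_inv f_set_pow del: set_pow.simps)
qed

end

text \<open>The isomorphism is defined only on \<open>K\<close>, where \<open>A\<close> may fail to
  lie. The translate \<open>A'\<close> lies in \<open>K\<close>, satisfies the same hypotheses with
  the same \<open>A A^-1\<close>, and is what gets mapped to the natural numbers.\<close>

lemma (in group) alternation_bohr_const:
  assumes A: "A \<subseteq> carrier G" "finite A" "A \<noteq> {}" and m: "m > 0"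
    and k: "card (A <#> set_inv A <#> A) \<le> k * card A"
    and gen: "generate G (A <#> set_inv A) = (A <#> set_inv A) [^^] m"
  shows "bounded_bohr_in G (generate G (A <#> set_inv A)) ((A <#> set_inv A) [^^] (2::nat)) (bohr_const k m)"
proof -
  define S where "S = A <#> set_inv A"
  define K where "K = generate G S"
  have S: "S \<subseteq> carrier G" "finite S"
    using A by (simp_all add: S_def set_mult_closed set_inv_closed finite_set_mult finite_set_inv)
  have SK: "S \<subseteq> K" by (auto simp: K_def intro: generate.incl)
  have sub: "subgroup K G" unfolding K_def using generate_is_subgroup[OF S(1)] .
  have KS: "K = S [^^] m" using gen by (simp add: K_def S_def)
  have fin: "finite K" using finite_set_pow[OF S(2)] by (simp add: KS)
  obtain A' where A': "A' \<subseteq> S" "A' \<noteq> {}" "card A' = card A" "A' <#> set_inv A' = S"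
    "card (A' <#> set_inv A' <#> A') = card (A <#> set_inv A <#> A)"
    unfolding S_def by (rule alternation_translate[OF A])
  have A'c: "card (A' <#> set_inv A' <#> A') \<le> k * card A'"
    unfolding A'(3,5) by (rule k)
  have A'K: "A' \<subseteq> K" "finite A'" using A' SK S finite_subset by blast+
  let ?K = "G\<lparr>carrier := K\<rparr>"
  interpret K: group ?K using subgroup_imp_group[OF sub] .
  obtain G' :: "nat monoid" and f where G': "group G'" "f \<in> iso ?K G'"
    using K.finite_imp_iso_nat_monoid fin by auto
  interpret group_iso ?K G' f by (intro group_iso.intro group_iso_axioms.intro G' K.is_group)
  have inv_eq: "set_inv\<^bsub>?K\<^esub> A' = set_inv A'" by (rule set_inv_restrict[OF sub A'K(1)])
  have inv_sub: "set_inv A' \<subseteq> K" by (rule set_inv_subset_subgroup[OF sub A'K(1)])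
  have fS: "f ` S = f ` A' <#>\<^bsub>G'\<^esub> set_inv\<^bsub>G'\<^esub> (f ` A')"
    using f_set_mult[of A' "set_inv A'"] f_set_inv[of A'] A'K(1) inv_sub by (simp add: inv_eq A'(4))
  have fSA: "f ` A' <#>\<^bsub>G'\<^esub> set_inv\<^bsub>G'\<^esub> (f ` A') <#>\<^bsub>G'\<^esub> f ` A' = f ` (A' <#> set_inv A' <#> A')"
    using f_set_mult[of S A'] SK A'K(1) by (simp add: fS A'(4))
  have "A' <#> set_inv A' <#> A' \<subseteq> K"
    using A'K(1) inv_sub sub by (intro set_mult_subset_subgroup)
  then have 1: "card (f ` A' <#>\<^bsub>G'\<^esub> set_inv\<^bsub>G'\<^esub> (f ` A') <#>\<^bsub>G'\<^esub> f ` A') \<le> k * card (f ` A')"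
    unfolding fSA using A'c A'K(1) by (simp add: f_card)
  have gK: "generate ?K S = K" using generate_consistent[OF SK sub] by (simp add: K_def)
  have fK: "f ` K = carrier G'" using G'(2) by (simp add: Group.iso_iff)
  have gen': "generate G' (f ` S) = carrier G'"
    using generate_img[of S] SK gK fK by simp
  have 2: "generate G' (f ` S) = (f ` S) [^^]\<^bsub>G'\<^esub> m"
    using f_set_pow[of S m] SK by (simp add: gen' set_pow_restrict flip: KS fK)
  have "f ` A' \<subseteq> carrier G'" using A'K(1) fK by blast
  then have "bound_holds k m (bohr_const k m) G' (f ` A')"
    using A' A'K by (intro bohr_const_works[OF m G'(1)]) auto
  then have "bounded_bohr_in G' (carrier G') ((f ` S) [^^]\<^bsub>G'\<^esub> (2::nat)) (bohr_const k m)"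
    using 1 2 unfolding bound_holds_def fS[symmetric] gen' by blast
  then have "bounded_bohr_in G' (carrier G') (f ` (S [^^] (2::nat))) (bohr_const k m)"
    using f_set_pow[of S 2] SK by (simp add: set_pow_restrict)
  then have "bounded_bohr_in ?K (carrier ?K) (S [^^] (2::nat)) (bohr_const k m)"
    using K.set_pow_closed[of S 2] SK
    by (intro bounded_bohr_in_iso[OF G'(2) K.is_group G'(1)]) (simp_all add: set_pow_restrict)
  then show ?thesis by (simp add: bounded_bohr_in_restrict K_def S_def)
qed

text \<open>Here \<open>A\<close> lies in \<open>K\<close>, and products, inverses and symmetrised
  powers computed in \<open>K\<close> agree with those in \<open>G\<close>, so the hypotheses pass
  to the image of \<open>A\<close> itself.\<close>

lemma (in group) tripling_bohr_const:
  assumes A: "A \<subseteq> carrier G" "finite A" "A \<noteq> {}" and m: "m > 0"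
    and k: "card (A [^^] (3::nat)) \<le> k * card A"
    and gen: "generate G A = sym_set G A [^^] m"
  shows "bounded_bohr_in G (generate G A) (tripling_set G A) (bohr_const k m)"
proof -
  define K where "K = generate G A"
  have AK: "A \<subseteq> K" by (auto simp: K_def intro: generate.incl)
  have sub: "subgroup K G" unfolding K_def using generate_is_subgroup[OF A(1)] .
  have KS: "K = sym_set G A [^^] m" using gen by (simp add: K_def)
  have fin: "finite K" using finite_set_pow[OF finite_sym_set[OF A(2)]] by (simp add: KS)
  let ?K = "G\<lparr>carrier := K\<rparr>"
  interpret K: group ?K using subgroup_imp_group[OF sub] .
  obtain G' :: "nat monoid" and f where G': "group G'" "f \<in> iso ?K G'"
    using K.finite_imp_iso_nat_monoid fin by auto
  interpret group_iso ?K G' f by (intro group_iso.intro group_iso_axioms.intro G' K.is_group)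
  have AK': "A \<subseteq> carrier ?K" using AK by simp
  have gK: "generate ?K A = K" using generate_consistent[OF AK sub] by (simp add: K_def)
  have fK: "f ` K = carrier G'" using G'(2) by (simp add: Group.iso_iff)
  have gen': "generate G' (f ` A) = carrier G'"
    using generate_img[OF AK'] gK fK by simp
  have "(f ` A) [^^]\<^bsub>G'\<^esub> (3::nat) = f ` (A [^^] (3::nat))"
    using f_set_pow[OF AK', of 3] by (simp add: set_pow_restrict)
  then have 1: "card ((f ` A) [^^]\<^bsub>G'\<^esub> (3::nat)) \<le> k * card (f ` A)"
    using k f_card[OF AK'] f_card[OF K.set_pow_closed[OF AK', of 3]] by (simp add: set_pow_restrict)
  have "sym_set G' (f ` A) [^^]\<^bsub>G'\<^esub> m = f ` (sym_set ?K A [^^]\<^bsub>?K\<^esub> m)"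
    using f_set_pow[OF K.sym_set_closed[OF AK'], of m] f_sym_set[OF AK'] by simp
  also have "\<dots> = f ` K" by (simp add: set_pow_restrict sym_set_restrict[OF sub AK] KS[symmetric])
  finally have 2: "generate G' (f ` A) = sym_set G' (f ` A) [^^]\<^bsub>G'\<^esub> m"
    by (simp add: gen' fK)
  have "f ` A \<subseteq> carrier G'" using AK fK by blast
  then have "bound_holds k m (bohr_const k m) G' (f ` A)"
    using A by (intro bohr_const_works[OF m G'(1)]) auto
  then have "bounded_bohr_in G' (carrier G') (tripling_set G' (f ` A)) (bohr_const k m)"
    using 1 2 unfolding bound_holds_def gen' tripling_set_def[symmetric] by blast
  then have "bounded_bohr_in ?K (carrier ?K) (tripling_set ?K A) (bohr_const k m)"
    using K.tripling_set_closed[OF AK'] unfolding f_tripling_set[OF AK', symmetric]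
    by (intro bounded_bohr_in_iso[OF G'(2) K.is_group G'(1)])
  then show ?thesis by (simp add: bounded_bohr_in_restrict K_def tripling_set_restrict[OF sub AK, unfolded K_def])
qed

theorem theorem2p4:
  fixes G :: "('a, 'b) monoid_scheme" (structure)
    and A :: "'a set"
    and k m :: nat
  assumes "k > 0" and "m > 0"
    and "group G"
    and "A \<subseteq> carrier G" and "finite A" and "A \<noteq> {}"
  shows "(card (A <#> set_inv A <#> A) \<le> k * card A \<and>
          generate G (A <#> set_inv A) = (A <#> set_inv A) [^^] m \<longrightarrow>
            bounded_bohr_in G (generate G (A <#> set_inv A))
              ((A <#> set_inv A) [^^] (2::nat))
              (bohr_const k m)) \<and>
         (card (A [^^] (3::nat)) \<le> k * card A \<and>
          generate G A = sym_set G A [^^] m \<longrightarrow>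
            bounded_bohr_in G (generate G A)
              ((A <#> set_inv A) [^^] (2::nat) \<inter>
               (A [^^] (2::nat) <#> (set_inv A) [^^] (2::nat)) \<inter>
               (set_inv A <#> A) [^^] (2::nat) \<inter>
               ((set_inv A) [^^] (2::nat) <#> A [^^] (2::nat)))
              (bohr_const k m))"
  using group.alternation_bohr_const[OF assms(3-6,2)] group.tripling_bohr_const[OF assms(3-6,2)]
  unfolding tripling_set_def by blast

end
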